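(* Let $A$ be a unital associative $\mathbf{k}$-algebra such that $\mathbf{k}\to A$ is a $\mathbf{k}$-split injection, where $\mathbf{k}$ is a unital commutative $\mathbb{Q}$-algebra. For every $n$ there is an exact sequence $$0\to\overline{\mathrm{HD}}_n(A)\xrightarrow{S_2}\overline{\mathrm{HC}}_n(A)\xrightarrow{B}\overline{\mathrm{HH}}_{n+1}(A)\xrightarrow{I}\overline{\mathrm{HC}}_{n+1}(A)\xrightarrow{S_1}\overline{\mathrm{HD}}_{n-1}(A)\to0,$$ where, under the identifications $$\overline{\mathrm{HH}}_m(A)=\ker(\mathsf{i}:\overline{\mathrm{DR}}^m\to\overline{\Omega}^{m-1}),\qquad \overline{\mathrm{HC}}_m(A)=\ker(\mathsf{i}:\overline{\mathrm{DR}}^m/\mathsf{d}\overline{\mathrm{DR}}^{m-1}\to\overline{\Omega}^{m-1}/\mathsf{d}\overline{\Omega}^{m-2}),$$ the maps are (well) defined by the assignments $$S_2f_\natural=f_\natural,\qquad Bf_\natural=(\mathsf{d}f)_\natural,\qquad If_\natural=f_\natural,\qquad S_1(f_\natural)=(\bar{\mathsf{d}}^{-1}\mathsf{i}f_\natural)_\natural.$$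
   Context: $\mathbf{k}$ is a unital commutative $\mathbb{Q}$-algebra, $\otimes=\otimes_{\mathbf{k}}$, $\overline{A}=A/\mathbf{k}$. Noncommutative differential forms: $\Omega=\Omega A$ is the dg algebra generated by $A$ (degree $0$) and symbols $\mathsf{d}a$ (degree $1$), $\mathbf{k}$-linear in $a\in\overline{A}$, with relations: products of elements of $A$ are as in $A$ (same unit), and $\mathsf{d}(ab)=\mathsf{d}a\,b+a\,\mathsf{d}b$; the differential is $a\mapsto \mathsf{d}a\mapsto 0$. One has $A\otimes\overline{A}^{\otimes n}\cong\Omega^nA$ via $a_0\otimes\cdots\otimes a_n\mapsto a_0\,\mathsf{d}a_1\cdots \mathsf{d}a_n$. Commutators are supercommutators, $[V,W]$ is the linear span of commutators. $\overline{\Omega}=\Omega/\mathbf{k}$, $\mathrm{DR}=\Omega/[\Omega,\Omega]$, $\overline{\mathrm{DR}}=\mathrm{DR}/\mathbf{k}$; $\mathsf{d}$ descends to these; $f_\natural$ is the image of $f$ in $\overline{\mathrm{DR}}$ (or its quotient by $\mathsf{d}\overline{\mathrm{DR}}$). The reduced Karoubi-de Rham homology is $\overline{\mathrm{HD}}_n(A)=H^n(\overline{\mathrm{DR}},\mathsf{d})$. Since $(\overline{\Omega},\mathsf{d})$ is acyclic, $\mathsf{d}$ induces an isomorphism $\bar{\mathsf{d}}:\overline{\Omega}/\mathsf{d}\overline{\Omega}\to\mathsf{d}\overline{\Omega}$, with inverse $\bar{\mathsf{d}}^{-1}$. In the formula for $S_1$, $\mathsf{i}f_\natural\in\mathsf{d}\overline\Omega$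 for a suitable representative, and $(\cdot)_\natural:\overline{\Omega}/\mathsf{d}\overline{\Omega}\to\overline{\mathrm{DR}}/\mathsf{d}\overline{\mathrm{DR}}$, whose relevant values lie in $\overline{\mathrm{HD}}\subseteq\overline{\mathrm{DR}}/\mathsf{d}\overline{\mathrm{DR}}$. The map $a_0\,\mathsf{d}a_1\cdots\mathsf{d}a_n\mapsto\sum_{\ell=1}^n(-1)^{(\ell-1)(n-1)+1}[a_\ell,\ \mathsf{d}a_{\ell+1}\cdots\mathsf{d}a_n\,a_0\,\mathsf{d}a_1\cdots\mathsf{d}a_{\ell-1}]$ vanishes on $[\Omega,\Omega]$ and induces $\mathsf{i}:\overline{\mathrm{DR}}^\bullet\to\overline{\Omega}^{\bullet-1}$; one has $\mathsf{d}\mathsf{i}+\mathsf{i}\mathsf{d}=0$. Reduced Hochschild and cyclic homology are $\overline{\mathrm{HH}}_\bullet(A)=H_\bullet(\overline{\Omega},\mathsf{b})$ and $\overline{\mathrm{HC}}_\bullet(A)=H_\bullet(\overline{\Omega}\otimes R,\mathsf{b}-u\mathsf{B})$, where $\mathsf{b}(\alpha\,\mathsf{d}a)=(-1)^{n-1}[\alpha,a]$ for $\alpha\in\Omega^{n-1}A$, $\mathsf{b}|_{\Omega^0}=0$, $\kappa(\alpha\,\mathsf{d}a)=(-1)^{|\alpha|}\mathsf{d}a\,\alpha$, $\mathsf{B}|_{\overline{\Omega}^n}=(\mathrm{Id}+\kappa+\cdots+\kappa^n)\mathsf{d}$, $|u|=-2$, $R=\mathbf{k}(\!(u)\!)/u\mathbf{k}[\![u]\!]$.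 The identifications used in the claim are the canonical isomorphisms induced by $f\mapsto f_\natural$ and $\sum_{k\ge0}f_ku^{-k}\mapsto(f_0)_\natural$ respectively. *)

theory Defs
  imports Complex_Main "HOL-Library.Poly_Mapping" "HOL-Library.Set_Algebras" "HOL-Algebra.Coset"
begin

section \<open>Algebras over a commutative ring\<close>

locale unital_algebra = module scale
  for scale :: "'k::comm_ring_1 \<Rightarrow> 'a::ring_1 \<Rightarrow> 'a" +
  assumes scale_mult_left: "scale r x * y = scale r (x * y)"
    and scale_mult_right: "x * scale r y = scale r (x * y)"

text \<open>The unit map is \<open>r \<mapsto> scale r 1\<close>; it is a split injection if it has a linear retraction.\<close>

definition split_unit :: "('k::comm_ring_1 \<Rightarrow> 'a::ring_1 \<Rightarrow> 'a) \<Rightarrow> bool" where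
  "split_unit scale \<longleftrightarrow> (\<exists>p. module_hom scale (*) p \<and> (\<forall>r. p (scale r 1) = r))"


section \<open>Subquotients and linear maps between them\<close>

text \<open>
  Modules are records extending the HOL-Algebra groups; \<open>mult\<close> is the addition and \<open>one\<close> the zero
  element.  Thus \<open>hom\<close>, \<open>iso\<close> and \<open>kernel\<close> are available.
\<close>

record ('k, 'm) kmodule = "'m monoid" +
  smul :: "'k \<Rightarrow> 'm \<Rightarrow> 'm"

definition lin_hom :: "('k, 'm) kmodule \<Rightarrow> ('k, 'n) kmodule \<Rightarrow> ('m \<Rightarrow> 'n) set" where
  "lin_hom M N = {h \<in> hom M N. \<forall>r. \<forall>x\<in>carrier M. h (smul M r x) = smul N r (h x)}"

definition lin_iso :: "('k, 'm) kmodule \<Rightarrow> ('k, 'n) kmodule \<Rightarrow> ('m \<Rightarrow> 'n) set" where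
  "lin_iso M N = lin_hom M N \<inter> iso M N"

text \<open>
  For submodules \<open>Z\<close> and \<open>N\<close> of an ambient module, \<open>subquot s Z N\<close> is the image of \<open>Z\<close> in the quotient
  by \<open>N\<close>, that is \<open>(Z + N) / N\<close>.  We do not require \<open>N \<subseteq> Z\<close>.  Sums of cosets are elementwise sums of
  sets.  The multiple of a coset by \<open>r\<close> has to be saturated, as \<open>r\<close> need not be invertible.
\<close>

definition subquot ::
  "('k \<Rightarrow> 'v \<Rightarrow> 'v) \<Rightarrow> 'v set \<Rightarrow> 'v set \<Rightarrow> ('k, 'v::ab_group_add set) kmodule" where
  "subquot s Z N =
    \<lparr>carrier = (\<lambda>z. z +o N) ` Z, mult = (+), one = N, smul = (\<lambda>r C. s r ` C + N)\<rparr>"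

text \<open>
  Homology at \<open>X\<close> of \<open>Y \<rightarrow> X \<rightarrow> \<dots>\<close> with differential \<open>\<delta>\<close>, everything taken modulo \<open>N\<close>.
\<close>

definition homology ::
  "('k \<Rightarrow> 'v \<Rightarrow> 'v) \<Rightarrow> ('v \<Rightarrow> 'v) \<Rightarrow> 'v set \<Rightarrow> 'v set \<Rightarrow> 'v set \<Rightarrow> ('k, 'v::ab_group_add set) kmodule"
  where
  "homology s \<delta> N X Y = subquot s {x \<in> X. \<delta> x \<in> N} (N + \<delta> ` Y)"


section \<open>The free graded algebra on symbols \<open>a\<close> and \<open>da\<close>\<close>

datatype 'a gen = Elt 'a | Dif 'a

datatype 'a fword = FWord (letters: "'a gen list")

instantiation fword :: (type) monoid_add
begin

definition "0 = FWord []"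

definition "u + v = FWord (letters u @ letters v)"

instance
  by standard (simp_all add: zero_fword_def plus_fword_def)

end

text \<open>Addition of words is concatenation, so the convolution product on \<open>'a fword \<Rightarrow>\<^sub>0 'k\<close> is the
  product of the free associative \<open>'k\<close>-algebra.\<close>

type_synonym ('a, 'k) falg = "'a fword \<Rightarrow>\<^sub>0 'k"

definition const :: "'k \<Rightarrow> ('a, 'k::comm_ring_1) falg" where
  "const r = Poly_Mapping.single 0 r"

definition el :: "'a \<Rightarrow> ('a, 'k::comm_ring_1) falg" where
  "el a = Poly_Mapping.single (FWord [Elt a]) 1"

definition df :: "'a \<Rightarrow> ('a, 'k::comm_ring_1) falg" where
  "df a = Poly_Mapping.single (FWord [Dif a]) 1"

definition fscale :: "'k \<Rightarrow> ('a, 'k::comm_ring_1) falg \<Rightarrow> ('a, 'k) falg" where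
  "fscale r f = const r * f"

lemma module_fscale: "module (fscale :: 'k::comm_ring_1 \<Rightarrow> ('a, 'k) falg \<Rightarrow> _)"
  by standard
    (simp_all add: fscale_def const_def distrib_left distrib_right single_add mult_single
      flip: mult.assoc)

definition lin_ext ::
  "('a fword \<Rightarrow> ('a, 'k) falg) \<Rightarrow> ('a, 'k::comm_ring_1) falg \<Rightarrow> ('a, 'k) falg" where
  "lin_ext g f = (\<Sum>w\<in>Poly_Mapping.keys f. fscale (Poly_Mapping.lookup f w) (g w))"

fun is_dif :: "'a gen \<Rightarrow> bool" where
  "is_dif (Elt a) = False"
| "is_dif (Dif a) = True"

definition wdeg :: "'a fword \<Rightarrow> nat" where
  "wdeg w = length (filter is_dif (letters w))"

text \<open>Degrees are integers; the parts of negative degree are zero.\<close>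

definition degpart :: "int \<Rightarrow> ('a, 'k::comm_ring_1) falg set" where
  "degpart m = {f. \<forall>w\<in>Poly_Mapping.keys f. int (wdeg w) = m}"

text \<open>The differential is the graded derivation with \<open>a \<mapsto> da \<mapsto> 0\<close>.\<close>

fun d_letters :: "'a gen list \<Rightarrow> ('a, 'k::comm_ring_1) falg" where
  "d_letters [] = 0"
| "d_letters (Elt a # w) = df a * Poly_Mapping.single (FWord w) 1 + el a * d_letters w"
| "d_letters (Dif a # w) = - (df a * d_letters w)"

definition form_d :: "('a, 'k::comm_ring_1) falg \<Rightarrow> ('a, 'k) falg" where
  "form_d = lin_ext (\<lambda>w. d_letters (letters w))"


section \<open>Noncommutative differential forms and their quotients\<close>

text \<open>
  \<open>\<Omega> A\<close> is the free graded algebra modulo the two-sided ideal \<open>rel_ideal\<close>.  All the modules below are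
  subquotients of the free graded algebra: a quotient \<open>\<Omega> / V\<close> is represented as the quotient by
  the preimage of \<open>V\<close>, and an operator on \<open>\<Omega>\<close> by a lift to the free graded algebra.
\<close>

definition relators :: "('k \<Rightarrow> 'a \<Rightarrow> 'a) \<Rightarrow> ('a::ring_1, 'k::comm_ring_1) falg set" where
  "relators scale =
     {el (a * b) - el a * el b | a b. True} \<union> {el 1 - 1} \<union>
     {el (a + b) - el a - el b | a b. True} \<union> {el (scale r a) - fscale r (el a) | r a. True} \<union>
     {df (a + b) - df a - df b | a b. True} \<union> {df (scale r a) - fscale r (df a) | r a. True} \<union>
     {df (scale r 1) | r. True} \<union>
     {df (a * b) - (df a * el b + el a * df b) | a b. True}"

definition rel_ideal :: "('k \<Rightarrow> 'a \<Rightarrow> 'a) \<Rightarrow> ('a::ring_1, 'k::comm_ring_1) falg set" where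
  "rel_ideal scale = module.span fscale {x * \<rho> * y | x \<rho> y. \<rho> \<in> relators scale}"

text \<open>The span of the supercommutators.\<close>

definition supercomm :: "('a, 'k::comm_ring_1) falg set" where
  "supercomm = module.span fscale
     {x * y - (-1) ^ (p * q) * (y * x) | x y p q. x \<in> degpart (int p) \<and> y \<in> degpart (int q)}"

text \<open>
  The preimages of \<open>0\<close> under the projections to reduced forms, to the reduced Karoubi-de Rham
  complex, and (in degree \<open>m\<close>) to the quotients of these two by the exact elements.
\<close>

definition N_\<Omega> :: "('k \<Rightarrow> 'a \<Rightarrow> 'a) \<Rightarrow> ('a::ring_1, 'k::comm_ring_1) falg set" where
  "N_\<Omega> scale = rel_ideal scale + range const"

definition N_DR :: "('k \<Rightarrow> 'a \<Rightarrow> 'a) \<Rightarrow> ('a::ring_1, 'k::comm_ring_1) falg set" where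
  "N_DR scale = rel_ideal scale + supercomm + range const"

definition N_\<Omega>d :: "('k \<Rightarrow> 'a \<Rightarrow> 'a) \<Rightarrow> int \<Rightarrow> ('a::ring_1, 'k::comm_ring_1) falg set" where
  "N_\<Omega>d scale m = N_\<Omega> scale + form_d ` degpart (m - 1)"

definition N_DRd :: "('k \<Rightarrow> 'a \<Rightarrow> 'a) \<Rightarrow> int \<Rightarrow> ('a::ring_1, 'k::comm_ring_1) falg set" where
  "N_DRd scale m = N_DR scale + form_d ` degpart (m - 1)"


section \<open>Operators on forms\<close>

text \<open>Lifts of linear endomorphisms of \<open>\<Omega> A\<close>.\<close>

definition form_endo ::
  "('k \<Rightarrow> 'a \<Rightarrow> 'a) \<Rightarrow> (('a::ring_1, 'k::comm_ring_1) falg \<Rightarrow> ('a, 'k) falg) \<Rightarrow> bool" where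
  "form_endo scale \<phi> \<longleftrightarrow> module_hom fscale fscale \<phi> \<and> \<phi> ` rel_ideal scale \<subseteq> rel_ideal scale"

text \<open>
  Each of the following three operators is described by its values on a spanning set of \<open>\<Omega> A\<close>.  Hence
  the chosen lift is unique modulo \<open>rel_ideal\<close>, which is contained in all the submodules by which we
  divide.
\<close>

definition hoch_b ::
  "('k \<Rightarrow> 'a \<Rightarrow> 'a) \<Rightarrow> ('a::ring_1, 'k::comm_ring_1) falg \<Rightarrow> ('a, 'k) falg" where
  "hoch_b scale = (SOME \<phi>. form_endo scale \<phi> \<and>
     (\<forall>x\<in>degpart 0. \<phi> x \<in> rel_ideal scale) \<and>
     (\<forall>n. \<forall>\<alpha>\<in>degpart (int n). \<forall>a.
        \<phi> (\<alpha> * df a) - (-1) ^ n * (\<alpha> * el a - el a * \<alpha>) \<in> rel_ideal scale))"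

text \<open>In degree \<open>0\<close> the Karoubi operator is the identity.\<close>

definition karoubi ::
  "('k \<Rightarrow> 'a \<Rightarrow> 'a) \<Rightarrow> ('a::ring_1, 'k::comm_ring_1) falg \<Rightarrow> ('a, 'k) falg" where
  "karoubi scale = (SOME \<phi>. form_endo scale \<phi> \<and>
     (\<forall>x\<in>degpart 0. \<phi> x - x \<in> rel_ideal scale) \<and>
     (\<forall>n. \<forall>\<alpha>\<in>degpart (int n). \<forall>a. \<phi> (\<alpha> * df a) - (-1) ^ n * (df a * \<alpha>) \<in> rel_ideal scale))"

definition dfs :: "'a list \<Rightarrow> ('a, 'k::comm_ring_1) falg" where
  "dfs as = prod_list (map df as)"

text \<open>
  In the sum, \<open>as ! (l - 1)\<close> is the entry with index \<open>l\<close> of \<open>as = [a\<^sub>1, \<dots>, a\<^sub>n]\<close>, and the supercommutator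
  with an element of degree \<open>0\<close> is an ordinary commutator.
\<close>

definition contr ::
  "('k \<Rightarrow> 'a \<Rightarrow> 'a) \<Rightarrow> ('a::ring_1, 'k::comm_ring_1) falg \<Rightarrow> ('a, 'k) falg" where
  "contr scale = (SOME \<phi>. form_endo scale \<phi> \<and>
     (\<forall>a0 as. \<phi> (el a0 * dfs as) -
        (\<Sum>l = 1..length as.
           let a = el (as ! (l - 1));
               \<beta> = dfs (drop l as) * el a0 * dfs (take (l - 1) as)
           in (-1) ^ ((l - 1) * (length as - 1) + 1) * (a * \<beta> - \<beta> * a)) \<in> rel_ideal scale))"

text \<open>On \<open>n\<close>-forms, \<open>connes_B\<close> is \<open>(1 + \<kappa> + \<dots> + \<kappa>\<^sup>n) d\<close>.\<close>

definition connes_B ::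
  "('k \<Rightarrow> 'a \<Rightarrow> 'a) \<Rightarrow> ('a::ring_1, 'k::comm_ring_1) falg \<Rightarrow> ('a, 'k) falg" where
  "connes_B scale =
     lin_ext (\<lambda>w. \<Sum>j\<le>wdeg w. (karoubi scale ^^ j) (form_d (Poly_Mapping.single w 1)))"


section \<open>Homology\<close>

definition HD :: "('k \<Rightarrow> 'a \<Rightarrow> 'a) \<Rightarrow> int \<Rightarrow> ('k, ('a::ring_1, 'k::comm_ring_1) falg set) kmodule" where
  "HD scale m = homology fscale form_d (N_DR scale) (degpart m) (degpart (m - 1))"

definition HH :: "('k \<Rightarrow> 'a \<Rightarrow> 'a) \<Rightarrow> int \<Rightarrow> ('k, ('a::ring_1, 'k::comm_ring_1) falg set) kmodule" where
  "HH scale m = homology fscale (hoch_b scale) (N_\<Omega> scale) (degpart m) (degpart (m + 1))"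

text \<open>
  The \<open>'k[[u]]\<close>-module \<open>R = 'k((u)) / u 'k[[u]]\<close> is free over \<open>'k\<close> on the classes of \<open>u\<^sup>-\<^sup>k\<close> with \<open>k \<ge> 0\<close>, and
  \<open>u\<close> annihilates \<open>u\<^sup>0\<close>.  So the tensor product of a module with \<open>R\<close> consists of the finite sums
  \<open>\<Sum>\<^sub>k f\<^sub>k u\<^sup>-\<^sup>k\<close>, which we encode as finitely supported functions \<open>k \<mapsto> f\<^sub>k\<close>.  As \<open>u\<close> has degree \<open>-2\<close>, such
  a sum has degree \<open>m\<close> if \<open>f\<^sub>k\<close> has degree \<open>m - 2k\<close>.
\<close>

type_synonym ('a, 'k) uchain = "nat \<Rightarrow>\<^sub>0 ('a, 'k) falg"

definition uscale :: "'k \<Rightarrow> ('a, 'k::comm_ring_1) uchain \<Rightarrow> ('a, 'k) uchain" where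
  "uscale r = Poly_Mapping.map (fscale r)"

definition udegpart :: "int \<Rightarrow> ('a, 'k::comm_ring_1) uchain set" where
  "udegpart m = {c. \<forall>k. Poly_Mapping.lookup c k \<in> degpart (m - 2 * int k)}"

definition uN_\<Omega> :: "('k \<Rightarrow> 'a \<Rightarrow> 'a) \<Rightarrow> ('a::ring_1, 'k::comm_ring_1) uchain set" where
  "uN_\<Omega> scale = {c. \<forall>k. Poly_Mapping.lookup c k \<in> N_\<Omega> scale}"

text \<open>The differential \<open>b - uB\<close>.\<close>

definition cyc_d ::
  "('k \<Rightarrow> 'a \<Rightarrow> 'a) \<Rightarrow> ('a::ring_1, 'k::comm_ring_1) uchain \<Rightarrow> ('a, 'k) uchain" where
  "cyc_d scale c = (\<Sum>k\<in>Poly_Mapping.keys c.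
     Poly_Mapping.single k (hoch_b scale (Poly_Mapping.lookup c k)) -
     (if k = 0 then 0
      else Poly_Mapping.single (k - 1) (connes_B scale (Poly_Mapping.lookup c k))))"

definition HC :: "('k \<Rightarrow> 'a \<Rightarrow> 'a) \<Rightarrow> int \<Rightarrow> ('k, ('a::ring_1, 'k::comm_ring_1) uchain set) kmodule" where
  "HC scale m = homology uscale (cyc_d scale) (uN_\<Omega> scale) (udegpart m) (udegpart (m + 1))"


section \<open>The canonical identifications\<close>

text \<open>
  The kernels of the contraction on the degree \<open>m\<close> part of the reduced Karoubi-de Rham complex, with
  values in reduced forms, and on its quotient by exact elements, with values in reduced forms
  modulo exact ones.
\<close>

definition ker_DR ::
  "('k \<Rightarrow> 'a \<Rightarrow> 'a) \<Rightarrow> int \<Rightarrow> ('k, ('a::ring_1, 'k::comm_ring_1) falg set) kmodule" where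
  "ker_DR scale m = subquot fscale {f \<in> degpart m. contr scale f \<in> N_\<Omega> scale} (N_DR scale)"

definition ker_DRd ::
  "('k \<Rightarrow> 'a \<Rightarrow> 'a) \<Rightarrow> int \<Rightarrow> ('k, ('a::ring_1, 'k::comm_ring_1) falg set) kmodule" where
  "ker_DRd scale m =
     subquot fscale {f \<in> degpart m. contr scale f \<in> N_\<Omega>d scale (m - 1)} (N_DRd scale m)"

text \<open>
  The class of \<open>f\<close> goes to that of \<open>f\<close>, and the class of \<open>\<Sum>\<^sub>k f\<^sub>k u\<^sup>-\<^sup>k\<close> goes to that of \<open>f\<^sub>0\<close>.  On
  cosets: apply the map on representatives to the whole coset and saturate.  The result is a single
  coset precisely if the map is well defined.
\<close>

definition ident_HH ::
  "('k \<Rightarrow> 'a \<Rightarrow> 'a) \<Rightarrow> ('a::ring_1, 'k::comm_ring_1) falg set \<Rightarrow> ('a, 'k) falg set" where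
  "ident_HH scale C = C + N_DR scale"

definition ident_HC ::
  "('k \<Rightarrow> 'a \<Rightarrow> 'a) \<Rightarrow> int \<Rightarrow> ('a::ring_1, 'k::comm_ring_1) uchain set \<Rightarrow> ('a, 'k) falg set" where
  "ident_HC scale m C = (\<lambda>c. Poly_Mapping.lookup c 0) ` C + N_DRd scale m"

end

theory Submission
  imports Defs
begin

text \<open>
  Everything follows from a few identities of Cuntz and Quillen on reduced forms: \<open>b d + d b = 1 - \<kappa>\<close>, so
  that \<open>\<kappa>\<close> commutes with \<open>b\<close> and \<open>d\<close>; \<open>\<kappa>\<^bsup>n+1\<^esup> = 1 - d b\<close> on \<open>n\<close>-forms, so that \<open>\<kappa>\<close> has finite order on the images
  of \<open>b\<close> and \<open>d\<close>; the contraction is \<open>b (1 + \<kappa> + \<dots> + \<kappa>\<^bsup>n-1\<^esup>)\<close>; commutators are \<open>b \<Omega> + d b \<Omega>\<close>; and \<open>d\<close> is exact.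
  As the integers are invertible, an element of finite order under \<open>\<kappa>\<close> is its average plus
  \<open>(1 - \<kappa>) w = (b d + d b) w\<close>. Exactness of \<open>d\<close> then makes \<open>B\<close> exact up to such terms, and both
  identifications and the exact sequence are obtained by correcting representatives.

  The operators are constructed on words, and shown to preserve the ideal of relations; in this way no
  normal form of forms is needed.
\<close>

section \<open>Subquotients\<close>

text \<open>On the image of \<open>b\<close> the first identity shrinks to
  \<open>(1 - \<kappa>) (b y) = b (d (b y))\<close>, because \<open>b b = 0\<close>. The
  non-invariant part of \<open>b f\<close> is therefore removed by replacing \<open>f\<close> with
  \<open>f - d (b y)\<close>; as \<open>d (b y)\<close> is a sum of commutators, the class of
  \<open>f\<close> stays the same. What is left of \<open>b f\<close> is its average, which the
  contraction controls. Likewise \<open>(1 - \<kappa>) (d y) = d (b (d y))\<close>, so an exact form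
  is invariant as soon as this vanishes, and an invariant exact form is a value of \<open>B\<close>:
  in this way the next coefficient of a cyclic cycle is found. These corrections depend on choices,
  so the inverses of the two identifications are available only on representatives. Hence the four
  maps are described by linear relations between representatives; a relation gives a map once
  elements related to zero classes have zero classes. The operators in the definitions are
  themselves chosen lifts, so the argument is carried out for explicit operators and transported at
  the end along congruence modulo the relations.\<close>

lemma elt_set_plus_eq_iff:
  assumes "module s" "module.subspace s N"
  shows "x +o N = y +o N \<longleftrightarrow> x - y \<in> N"
proof
  interpret module s by fact
  assume "x +o N = y +o N"
  moreover have "x \<in> x +o N"
    using subspace_0[OF assms(2)] by (force simp: elt_set_plus_def)
  ultimately have "x \<in> y +o N" by simp
  then show "x - y \<in> N" by (auto simp: elt_set_plus_def)
next
  interpret module s by fact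
  assume a: "x - y \<in> N"
  have aux: "u +o N \<subseteq> v +o N" if "u - v \<in> N" for u v
  proof
    fix w assume "w \<in> u +o N"
    then obtain z where "z \<in> N" "w = u + z" by (auto simp: elt_set_plus_def)
    then have "w = v + ((u - v) + z)" "(u - v) + z \<in> N"
      using that subspace_add[OF assms(2)] by auto
    then show "w \<in> v +o N" unfolding elt_set_plus_def by blast
  qed
  have "y - x \<in> N" using subspace_neg[OF assms(2) a] by simp
  then show "x +o N = y +o N" using aux[OF a] aux[of y x] by blast
qed

text \<open>This computes the saturated images in \<open>smul\<close> and in the identifications:
  \<open>M\<close> will be the image of a submodule under a map on representatives, and
  \<open>M + N\<close> collapses to \<open>N\<close>.\<close>

lemma elt_set_plus_plus_subspace:
  assumes "module s" "module.subspace s N" "M \<subseteq> N" "0 \<in> M"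
  shows "(x +o M) + N = x +o N"
proof -
  interpret module s by fact
  have "M + N = N"
    using assms(3,4) subspace_add[OF assms(2)] set_zero_plus2[of M N]
    by (auto simp: set_plus_def)
  then show ?thesis by (simp add: set_plus_rearrange3)
qed

lemma subspace_set_plus:
  assumes "module s" "module.subspace s M" "module.subspace s N"
  shows "module.subspace s (M + N)"
proof -
  interpret module s by fact
  show ?thesis
  proof (rule subspaceI)
    show "0 \<in> M + N"
      using subspace_0[OF assms(2)] subspace_0[OF assms(3)] by (force simp: set_plus_def)
  next
    fix x y assume "x \<in> M + N" "y \<in> M + N"
    then obtain a b c e where "a \<in> M" "b \<in> N" "c \<in> M" "e \<in> N" "x = a + b" "y = c + e"
      by (auto elim!: set_plus_elim)
    then have "x + y = (a + c) + (b + e)" "a + c \<in> M" "b + e \<in> N"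
      using subspace_add[OF assms(2)] subspace_add[OF assms(3)] by auto
    then show "x + y \<in> M + N" by (metis set_plus_intro)
  next
    fix r x assume "x \<in> M + N"
    then obtain a b where "a \<in> M" "b \<in> N" "x = a + b" by (auto elim!: set_plus_elim)
    then show "s r x \<in> M + N"
      using subspace_scale[OF assms(2)] subspace_scale[OF assms(3)]
      by (auto simp: scale_right_distrib)
  qed
qed

lemma subquot_sel [simp]:
  "carrier (subquot s Z N) = (\<lambda>z. z +o N) ` Z"
  "mult (subquot s Z N) = (+)"
  "one (subquot s Z N) = N"
  "smul (subquot s Z N) = (\<lambda>r C. s r ` C + N)"
  by (simp_all add: subquot_def)

lemma elt_set_plus_add:
  assumes "module s" "module.subspace s N"
  shows "(x +o N) + (y +o N) = (x + y) +o N"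
proof -
  interpret module s by fact
  have "N + N = N"
    using subspace_add[OF assms(2)] subspace_0[OF assms(2)] set_zero_plus2[of N N]
    by (auto simp: set_plus_def)
  then show ?thesis by (simp add: set_plus_rearrange)
qed

lemma elt_set_plus_smul:
  assumes "module s" "module.subspace s N"
  shows "s r ` (x +o N) + N = s r x +o N"
proof -
  interpret module s by fact
  have "s r ` (x +o N) = s r x +o s r ` N"
    by (force simp: elt_set_plus_def scale_right_distrib)
  moreover have "s r ` N \<subseteq> N" using subspace_scale[OF assms(2)] by auto
  moreover have "0 \<in> s r ` N" using subspace_0[OF assms(2)] by (force simp: image_iff)
  ultimately show ?thesis using elt_set_plus_plus_subspace[OF assms] by simp
qed

lemma coset_eq_self:
  assumes "module s" "module.subspace s N"
  shows "x +o N = N \<longleftrightarrow> x \<in> N"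
  using elt_set_plus_eq_iff[OF assms, of x 0] by simp

text \<open>By linearity of the relation, two values for one coset differ by a value related to an
  element of \<open>N\<close>, so independence of all choices is the single condition
  \<open>R_N\<close>.\<close>

lemma relation_lin_hom:
  assumes s: "module s" and s': "module s'"
    and Z: "module.subspace s Z"
    and N: "module.subspace s N" and N': "module.subspace s' N'"
    and R_sub: "R \<subseteq> Z \<times> Z'"
    and R_total: "\<And>z. z \<in> Z \<Longrightarrow> \<exists>z'. (z, z') \<in> R"
    and R_add: "\<And>x x' y y'. (x, x') \<in> R \<Longrightarrow> (y, y') \<in> R \<Longrightarrow> (x + y, x' + y') \<in> R"
    and R_smul: "\<And>r x x'. (x, x') \<in> R \<Longrightarrow> (s r x, s' r x') \<in> R"
    and R_N: "\<And>x x'. (x, x') \<in> R \<Longrightarrow> x \<in> N \<Longrightarrow> x' \<in> N'"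
  shows "\<exists>h. h \<in> lin_hom (subquot s Z N) (subquot s' Z' N') \<and>
    (\<forall>x x'. (x, x') \<in> R \<longrightarrow> h (x +o N) = x' +o N')"
proof -
  interpret M: module s by fact
  interpret M': module s' by fact
  \<comment> \<open>Some representative of \<open>C\<close> that occurs in \<open>R\<close>,
    together with some value; \<open>R_total\<close> provides one on the carrier, and
    \<open>R_N\<close> makes the choice irrelevant.\<close>
  define h where "h C = snd (SOME p. p \<in> R \<and> C = fst p +o N) +o N'" for C
  have h: "h (x +o N) = x' +o N'" if xx': "(x, x') \<in> R" for x x'
  proof -
    define p where "p = (SOME p. p \<in> R \<and> x +o N = fst p +o N)"
    have "\<exists>p. p \<in> R \<and> x +o N = fst p +o N" using xx' by force
    then have p: "p \<in> R \<and> x +o N = fst p +o N" unfolding p_def by (rule someI_ex)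
    then obtain y y' where yy': "p = (y, y')" "(y, y') \<in> R" by (cases p) auto
    have "y - x \<in> N" using p yy' elt_set_plus_eq_iff[OF s N] by (metis fst_conv)
    moreover have "(y + s (-1) x, y' + s' (-1) x') \<in> R"
      by (intro R_add R_smul yy' xx')
    ultimately have "y' - x' \<in> N'" using R_N by simp
    then have "y' +o N' = x' +o N'" using elt_set_plus_eq_iff[OF s' N'] by simp
    then show ?thesis unfolding h_def p_def[symmetric] yy' by simp
  qed
  have "h \<in> lin_hom (subquot s Z N) (subquot s' Z' N')"
    unfolding lin_hom_def hom_def
  proof (clarsimp, intro conjI ballI allI Pi_I, clarsimp)
    fix z assume "z \<in> Z"
    then obtain z' where "(z, z') \<in> R" using R_total by blast
    then show "h (z +o N) \<in> (\<lambda>z. z +o N') ` Z'" using h R_sub by auto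
  next
    fix x y assume "x \<in> Z" "y \<in> Z"
    then obtain x' y' where "(x, x') \<in> R" "(y, y') \<in> R" using R_total by blast
    then show "h ((x +o N) + (y +o N)) = h (x +o N) + h (y +o N)"
      using h R_add by (simp add: elt_set_plus_add[OF s N] elt_set_plus_add[OF s' N'])
  next
    fix r x assume "x \<in> Z"
    then obtain x' where "(x, x') \<in> R" using R_total by blast
    then show "h (s r ` (x +o N) + N) = s' r ` h (x +o N) + N'"
      using h R_smul by (simp add: elt_set_plus_smul[OF s N] elt_set_plus_smul[OF s' N'])
  qed
  then show ?thesis using h by blast
qed

lemma induced_lin_hom:
  assumes s: "module s" and s': "module s'" and \<phi>: "module_hom s s' \<phi>"
    and N: "module.subspace s N" and N': "module.subspace s' N'"
    and Z: "\<phi> ` Z \<subseteq> Z'" and NN': "\<phi> ` N \<subseteq> N'"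
  shows "\<phi> ` (x +o N) + N' = \<phi> x +o N'"
    and "(\<lambda>C. \<phi> ` C + N') \<in> lin_hom (subquot s Z N) (subquot s' Z' N')"
proof -
  interpret M: module s by fact
  interpret M': module s' by fact
  interpret module_hom s s' \<phi> by fact
  have coset: "\<phi> ` (x +o N) + N' = \<phi> x +o N'" for x
  proof -
    have "\<phi> ` (x +o N) = \<phi> x +o \<phi> ` N" by (force simp: elt_set_plus_def add)
    moreover have "0 \<in> \<phi> ` N" using M.subspace_0[OF N] by (force simp: image_iff)
    ultimately show ?thesis using elt_set_plus_plus_subspace[OF s' N' NN'] by simp
  qed
  then show "\<phi> ` (x +o N) + N' = \<phi> x +o N'" .
  show "(\<lambda>C. \<phi> ` C + N') \<in> lin_hom (subquot s Z N) (subquot s' Z' N')"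
    using Z unfolding lin_hom_def hom_def
    by (auto simp: coset elt_set_plus_add[OF s N] elt_set_plus_add[OF s' N'] add scale
        elt_set_plus_smul[OF s N] elt_set_plus_smul[OF s' N'])
qed

lemma induced_lin_iso:
  assumes s: "module s" and s': "module s'" and \<phi>: "module_hom s s' \<phi>"
    and sub: "module.subspace s N" "module.subspace s' N'" "module.subspace s Z"
    and Z: "\<phi> ` Z \<subseteq> Z'" and NN': "\<phi> ` N \<subseteq> N'"
    and inj: "\<And>z. z \<in> Z \<Longrightarrow> \<phi> z \<in> N' \<Longrightarrow> z \<in> N"
    and surj: "\<And>z'. z' \<in> Z' \<Longrightarrow> \<exists>z\<in>Z. \<phi> z - z' \<in> N'"
  shows "(\<lambda>C. \<phi> ` C + N') \<in> lin_iso (subquot s Z N) (subquot s' Z' N')"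
proof -
  interpret M: module s by fact
  interpret module_hom s s' \<phi> by fact
  note ind = induced_lin_hom[OF s s' \<phi> sub(1,2) Z NN']
  have "inj_on (\<lambda>C. \<phi> ` C + N') ((\<lambda>z. z +o N) ` Z)"
  proof (rule inj_onI, clarsimp simp: ind(1))
    fix x y assume xy: "x \<in> Z" "y \<in> Z" "\<phi> x +o N' = \<phi> y +o N'"
    then have "\<phi> (x - y) \<in> N'" using elt_set_plus_eq_iff[OF s' sub(2)] by (simp add: diff)
    then show "x +o N = y +o N"
      using inj[of "x - y"] M.subspace_diff[OF sub(3) xy(1,2)] elt_set_plus_eq_iff[OF s sub(1)]
      by simp
  qed
  moreover have "(\<lambda>C. \<phi> ` C + N') ` (\<lambda>z. z +o N) ` Z = (\<lambda>z. z +o N') ` Z'"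
  proof (intro equalityI subsetI)
    fix C assume "C \<in> (\<lambda>C. \<phi> ` C + N') ` (\<lambda>z. z +o N) ` Z"
    then show "C \<in> (\<lambda>z. z +o N') ` Z'" using Z by (auto simp: ind(1))
  next
    fix C assume "C \<in> (\<lambda>z. z +o N') ` Z'"
    then obtain z' where z': "z' \<in> Z'" "C = z' +o N'" by auto
    then obtain z where z: "z \<in> Z" "\<phi> z - z' \<in> N'" using surj by blast
    then have "C = \<phi> ` (z +o N) + N'"
      using z' elt_set_plus_eq_iff[OF s' sub(2), of "\<phi> z" z'] by (simp add: ind(1))
    then show "C \<in> (\<lambda>C. \<phi> ` C + N') ` (\<lambda>z. z +o N) ` Z" using z by blast
  qed
  ultimately show ?thesis
    using ind(2) unfolding lin_iso_def iso_def bij_betw_def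
    by (simp add: lin_hom_def)
qed

text \<open>Lets the operators chosen in the definitions of homology be traded for explicit ones: a
  change of the differential by values in \<open>N\<close> alters neither the cycles nor the
  boundaries modulo \<open>N\<close>.\<close>

lemma homology_cong:
  assumes s: "module s" and N: "module.subspace s N"
    and \<delta>: "\<And>x. x \<in> X \<union> Y \<Longrightarrow> \<delta> x - \<delta>' x \<in> N"
  shows "homology s \<delta> N X Y = homology s \<delta>' N X Y"
proof -
  interpret module s by fact
  have aux: "N + \<delta> ` Y \<subseteq> N + \<delta>' ` Y" if "\<And>y. y \<in> Y \<Longrightarrow> \<delta> y - \<delta>' y \<in> N" for \<delta> \<delta>'
  proof
    fix x assume "x \<in> N + \<delta> ` Y"
    then obtain n y where ny: "n \<in> N" "y \<in> Y" "x = n + \<delta> y" by (auto elim!: set_plus_elim)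
    then have "x = (n + (\<delta> y - \<delta>' y)) + \<delta>' y" "n + (\<delta> y - \<delta>' y) \<in> N"
      using subspace_add[OF N] that by auto
    then show "x \<in> N + \<delta>' ` Y" using ny(2) by (metis set_plus_intro imageI)
  qed
  have \<delta>': "\<delta>' x - \<delta> x \<in> N" if "x \<in> X \<union> Y" for x
    using subspace_neg[OF N \<delta>[OF that]] by simp
  have "N + \<delta> ` Y = N + \<delta>' ` Y" using aux[of \<delta> \<delta>'] aux[of \<delta>' \<delta>] \<delta> \<delta>' by blast
  moreover have "\<delta> x \<in> N \<longleftrightarrow> \<delta>' x \<in> N" if "x \<in> X" for x
    using subspace_add[OF N, of "\<delta> x - \<delta>' x" "\<delta>' x"] subspace_add[OF N, of "\<delta>' x - \<delta> x" "\<delta> x"]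
      \<delta>[of x] \<delta>'[of x] that by auto
  ultimately show ?thesis unfolding homology_def by (metis (no_types, lifting) Collect_cong)
qed

text \<open>Exactness at the middle term, read on representatives. As \<open>h\<^sub>2\<close> takes
  the same value for all pairs over a given coset, \<open>im_ker\<close> may pick the most
  convenient \<open>z\<close>, and \<open>ker_im\<close> may move \<open>y\<close> within its
  coset.\<close>

lemma relation_exact:
  assumes s\<^sub>2: "module s\<^sub>2" and s\<^sub>3: "module s\<^sub>3"
    and N\<^sub>2: "module.subspace s\<^sub>2 N\<^sub>2" and N\<^sub>3: "module.subspace s\<^sub>3 N\<^sub>3"
    and R\<^sub>1: "R\<^sub>1 \<subseteq> Z\<^sub>1 \<times> Z\<^sub>2" "\<And>x. x \<in> Z\<^sub>1 \<Longrightarrow> \<exists>y. (x, y) \<in> R\<^sub>1"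
    and R\<^sub>2: "R\<^sub>2 \<subseteq> Z\<^sub>2 \<times> Z\<^sub>3" "\<And>y. y \<in> Z\<^sub>2 \<Longrightarrow> \<exists>z. (y, z) \<in> R\<^sub>2"
    and h\<^sub>1: "\<And>x y. (x, y) \<in> R\<^sub>1 \<Longrightarrow> h\<^sub>1 (x +o N\<^sub>1) = y +o N\<^sub>2"
    and h\<^sub>2: "\<And>y z. (y, z) \<in> R\<^sub>2 \<Longrightarrow> h\<^sub>2 (y +o N\<^sub>2) = z +o N\<^sub>3"
    and ker_im: "\<And>y z. (y, z) \<in> R\<^sub>2 \<Longrightarrow> z \<in> N\<^sub>3 \<Longrightarrow> \<exists>x y'. (x, y') \<in> R\<^sub>1 \<and> y' - y \<in> N\<^sub>2"
    and im_ker: "\<And>x y. (x, y) \<in> R\<^sub>1 \<Longrightarrow> \<exists>z\<in>N\<^sub>3. (y, z) \<in> R\<^sub>2"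
  shows "kernel (subquot s\<^sub>2 Z\<^sub>2 N\<^sub>2) (subquot s\<^sub>3 Z\<^sub>3 N\<^sub>3) h\<^sub>2 = h\<^sub>1 ` carrier (subquot s\<^sub>1 Z\<^sub>1 N\<^sub>1)"
proof (intro equalityI subsetI)
  fix C assume "C \<in> kernel (subquot s\<^sub>2 Z\<^sub>2 N\<^sub>2) (subquot s\<^sub>3 Z\<^sub>3 N\<^sub>3) h\<^sub>2"
  then obtain y where y: "y \<in> Z\<^sub>2" "C = y +o N\<^sub>2" "h\<^sub>2 C = N\<^sub>3" by (auto simp: kernel_def)
  obtain z where yz: "(y, z) \<in> R\<^sub>2" using R\<^sub>2(2)[OF y(1)] by blast
  then have "z \<in> N\<^sub>3" using h\<^sub>2[OF yz] y coset_eq_self[OF s\<^sub>3 N\<^sub>3] by simp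
  then obtain x y' where xy': "(x, y') \<in> R\<^sub>1" "y' - y \<in> N\<^sub>2" using ker_im[OF yz] by blast
  then have "C = h\<^sub>1 (x +o N\<^sub>1)" using h\<^sub>1[OF xy'(1)] elt_set_plus_eq_iff[OF s\<^sub>2 N\<^sub>2, of y' y] y(2) by simp
  then show "C \<in> h\<^sub>1 ` carrier (subquot s\<^sub>1 Z\<^sub>1 N\<^sub>1)" using xy'(1) R\<^sub>1(1) by auto
next
  fix C assume "C \<in> h\<^sub>1 ` carrier (subquot s\<^sub>1 Z\<^sub>1 N\<^sub>1)"
  then obtain x where x: "x \<in> Z\<^sub>1" "C = h\<^sub>1 (x +o N\<^sub>1)" by auto
  obtain y where xy: "(x, y) \<in> R\<^sub>1" using R\<^sub>1(2)[OF x(1)] by blast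
  then have C: "C = y +o N\<^sub>2" using x h\<^sub>1 by simp
  obtain z where "z \<in> N\<^sub>3" "(y, z) \<in> R\<^sub>2" using im_ker[OF xy] by blast
  then have "h\<^sub>2 C = N\<^sub>3" using h\<^sub>2[of y z] C coset_eq_self[OF s\<^sub>3 N\<^sub>3] by simp
  then show "C \<in> kernel (subquot s\<^sub>2 Z\<^sub>2 N\<^sub>2) (subquot s\<^sub>3 Z\<^sub>3 N\<^sub>3) h\<^sub>2"
    using C xy R\<^sub>1(1) by (auto simp: kernel_def)
qed

section \<open>Homological algebra of the Karoubi operator\<close>

text \<open>
  \<open>V m\<close> stands for the forms of degree \<open>m\<close>, \<open>N\<close> and \<open>K\<close> for the preimages of \<open>0\<close> under the projections to
  reduced forms and to the reduced Karoubi-de Rham complex. The Karoubi operator is not a parameter,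
  because it is \<open>1 - b d - d b\<close>.
\<close>

locale mixed_forms = module s
  for s :: "'k::comm_ring_1 \<Rightarrow> 'v::ab_group_add \<Rightarrow> 'v" +
  fixes N :: "'v set" and K :: "'v set" and V :: "int \<Rightarrow> 'v set" and b d B \<iota> :: "'v \<Rightarrow> 'v"
  assumes nat_invertible: "0 < k \<Longrightarrow> \<exists>q::'k. q * of_nat k = 1"
    and sub_N: "subspace N" and sub_K: "subspace K" and N_K: "N \<subseteq> K"
    and sub_V: "subspace (V m)" and V_neg: "m < 0 \<Longrightarrow> x \<in> V m \<Longrightarrow> x = 0"
    and hom_b: "module_hom s s b" and hom_d: "module_hom s s d"
    and hom_B: "module_hom s s B" and hom_\<iota>: "module_hom s s \<iota>"
    and b_N: "x \<in> N \<Longrightarrow> b x \<in> N" and d_N: "x \<in> N \<Longrightarrow> d x \<in> N"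
    and B_N: "x \<in> N \<Longrightarrow> B x \<in> N" and \<iota>_N: "x \<in> N \<Longrightarrow> \<iota> x \<in> N"
    and b_V: "x \<in> V m \<Longrightarrow> b x \<in> V (m - 1)" and d_V: "x \<in> V m \<Longrightarrow> d x \<in> V (m + 1)"
    and bb: "b (b x) \<in> N" and dd: "d (d x) \<in> N"
    and d_exact: "x \<in> V m \<Longrightarrow> d x \<in> N \<Longrightarrow> \<exists>y\<in>V (m - 1). x - d y \<in> N"
    and karoubi_power: "x \<in> V m \<Longrightarrow>
      ((\<lambda>x. x - b (d x) - d (b x)) ^^ nat (m + 1)) x - (x - d (b x)) \<in> N"
    and B_eq: "x \<in> V m \<Longrightarrow> B x = (\<Sum>j<nat (m + 1). ((\<lambda>x. x - b (d x) - d (b x)) ^^ j) (d x))"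
    and \<iota>_eq: "x \<in> V m \<Longrightarrow> \<iota> x = b (\<Sum>j<nat m. ((\<lambda>x. x - b (d x) - d (b x)) ^^ j) x)"
    and K_iff: "x \<in> V m \<Longrightarrow> x \<in> K \<longleftrightarrow> (\<exists>y\<in>V (m + 1). \<exists>z\<in>V m. x - (b y + d (b z)) \<in> N)"
begin

sublocale b: module_hom s s b by (rule hom_b)
sublocale d: module_hom s s d by (rule hom_d)
sublocale B: module_hom s s B by (rule hom_B)
sublocale \<iota>: module_hom s s \<iota> by (rule hom_\<iota>)

lemmas hom_simps =
  b.zero b.add b.diff b.neg b.scale b.sum d.zero d.add d.diff d.neg d.scale d.sum
  B.zero B.add B.diff B.neg B.scale \<iota>.zero \<iota>.add \<iota>.diff \<iota>.neg \<iota>.scale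

section \<open>Congruence modulo \<open>N\<close>\<close>

definition cong :: "'v \<Rightarrow> 'v \<Rightarrow> bool" (infix "\<approx>" 50) where
  "x \<approx> y \<longleftrightarrow> x - y \<in> N"

lemma cong_refl [simp]: "x \<approx> x"
  using subspace_0[OF sub_N] by (simp add: cong_def)

lemma cong_sym: "x \<approx> y \<Longrightarrow> y \<approx> x"
  unfolding cong_def using subspace_neg[OF sub_N] by force

lemma cong_add: "x \<approx> x' \<Longrightarrow> y \<approx> y' \<Longrightarrow> x + y \<approx> x' + y'"
  unfolding cong_def using subspace_add[OF sub_N, of "x - x'" "y - y'"] by (simp add: algebra_simps)

lemma cong_diff: "x \<approx> x' \<Longrightarrow> y \<approx> y' \<Longrightarrow> x - y \<approx> x' - y'"
  unfolding cong_def using subspace_diff[OF sub_N, of "x - x'" "y - y'"] by (simp add: algebra_simps)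

lemma cong_scale: "x \<approx> x' \<Longrightarrow> s r x \<approx> s r x'"
  unfolding cong_def using subspace_scale[OF sub_N, of "x - x'" r] by (simp add: scale_right_diff_distrib)

lemma cong_trans [trans]: "x \<approx> y \<Longrightarrow> y \<approx> z \<Longrightarrow> x \<approx> z"
  using cong_add[of x y y z] unfolding cong_def by simp

lemma cong_sum: "(\<And>j. j \<in> J \<Longrightarrow> f j \<approx> g j) \<Longrightarrow> sum f J \<approx> sum g J"
  unfolding cong_def using subspace_sum[OF sub_N, of J "\<lambda>j. f j - g j"] by (simp add: sum_subtractf)

lemma cong_b: "x \<approx> y \<Longrightarrow> b x \<approx> b y"
  unfolding cong_def using b_N[of "x - y"] by (simp add: hom_simps)

lemma cong_d: "x \<approx> y \<Longrightarrow> d x \<approx> d y"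
  unfolding cong_def using d_N[of "x - y"] by (simp add: hom_simps)

lemma cong_B: "x \<approx> y \<Longrightarrow> B x \<approx> B y"
  unfolding cong_def using B_N[of "x - y"] by (simp add: hom_simps)

lemma cong_\<iota>: "x \<approx> y \<Longrightarrow> \<iota> x \<approx> \<iota> y"
  unfolding cong_def using \<iota>_N[of "x - y"] by (simp add: hom_simps)

lemma cong_0_iff: "x \<approx> 0 \<longleftrightarrow> x \<in> N"
  by (simp add: cong_def)

lemma bb_0 [simp]: "b (b x) \<approx> 0" and dd_0 [simp]: "d (d x) \<approx> 0"
  by (simp_all add: cong_def bb dd)

lemmas V_0 = subspace_0[OF sub_V]
  and V_add = subspace_add[OF sub_V]
  and V_diff = subspace_diff[OF sub_V]
  and V_scale = subspace_scale[OF sub_V]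
  and V_neg_closed = subspace_neg[OF sub_V]

section \<open>The Karoubi operator and its partial sums\<close>

definition kap :: "'v \<Rightarrow> 'v" where
  "kap x = x - b (d x) - d (b x)"

text \<open>The norm of a cyclic action when \<kappa> has order \<open>k\<close>. Applied to
  \<open>d x\<close> it gives \<open>B\<close>, and followed by \<open>b\<close> it gives the
  contraction; the number of summands depends on the degree, hence the parameter.\<close>

definition norm_op :: "nat \<Rightarrow> 'v \<Rightarrow> 'v" where
  "norm_op k x = (\<Sum>j<k. (kap ^^ j) x)"

lemma kap_fun: "(\<lambda>x. x - b (d x) - d (b x)) = kap"
  by (simp add: fun_eq_iff kap_def)

lemma B_norm: "x \<in> V m \<Longrightarrow> B x = norm_op (nat (m + 1)) (d x)"
  using B_eq by (simp add: kap_fun norm_op_def)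

lemma \<iota>_norm: "x \<in> V m \<Longrightarrow> \<iota> x = b (norm_op (nat m) x)"
  using \<iota>_eq by (simp add: kap_fun norm_op_def)

lemma kap_power: "x \<in> V m \<Longrightarrow> (kap ^^ nat (m + 1)) x \<approx> x - d (b x)"
  using karoubi_power by (simp add: kap_fun cong_def)

lemma hom_kap: "module_hom s s kap"
  by unfold_locales (simp_all add: kap_def hom_simps algebra_simps)

sublocale kap: module_hom s s kap by (rule hom_kap)

lemma hom_kap_pow: "module_hom s s (kap ^^ j)"
proof (induction j)
  case 0
  show ?case by unfold_locales simp_all
next
  case (Suc j)
  then interpret p: module_hom s s "kap ^^ j" .
  show ?case by unfold_locales (simp_all add: p.add p.scale kap.add kap.scale)
qed

lemma hom_norm: "module_hom s s (norm_op k)"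
proof -
  have a: "(kap ^^ j) (x + y) = (kap ^^ j) x + (kap ^^ j) y"
    and c: "(kap ^^ j) (s r x) = s r ((kap ^^ j) x)" for j x y r
    by (rule module_hom.add[OF hom_kap_pow], rule module_hom.scale[OF hom_kap_pow])
  show ?thesis
    by unfold_locales (simp_all add: norm_op_def a c sum.distrib scale_sum_right)
qed

sublocale norm_op: module_hom s s "norm_op k" for k by (rule hom_norm)

lemmas op_simps = hom_simps
  kap.zero kap.add kap.diff kap.neg kap.scale kap.sum
  norm_op.zero norm_op.add norm_op.diff norm_op.neg norm_op.scale norm_op.sum

lemma norm_Suc: "norm_op (Suc k) x = norm_op k x + (kap ^^ k) x"
  by (simp add: norm_op_def)

lemma norm_telescope: "norm_op k x - kap (norm_op k x) = x - (kap ^^ k) x"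
proof (induction k)
  case 0
  show ?case by (simp add: norm_op_def kap.zero)
next
  case (Suc k)
  have "norm_op (Suc k) x - kap (norm_op (Suc k) x)
      = norm_op k x - kap (norm_op k x) + (kap ^^ k) x - kap ((kap ^^ k) x)"
    by (simp add: norm_Suc kap.add)
  then show ?case using Suc by simp
qed

lemma norm_kap: "norm_op k (kap x) = kap (norm_op k x)"
  by (induction k) (simp_all add: norm_op_def kap.zero kap.add funpow_swap1)

lemma kap_V: "x \<in> V m \<Longrightarrow> kap x \<in> V m"
  using b_V[OF d_V, of x m] d_V[OF b_V, of x m] by (simp add: kap_def V_diff)

lemma kap_pow_V: "x \<in> V m \<Longrightarrow> (kap ^^ j) x \<in> V m"
  by (induction j) (auto intro: kap_V)

lemma norm_V: "x \<in> V m \<Longrightarrow> norm_op k x \<in> V m"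
  unfolding norm_op_def by (intro subspace_sum[OF sub_V] kap_pow_V)

lemma cong_kap: "x \<approx> y \<Longrightarrow> kap x \<approx> kap y"
  unfolding kap_def by (intro cong_diff cong_b cong_d)

lemma cong_kap_pow: "x \<approx> y \<Longrightarrow> (kap ^^ j) x \<approx> (kap ^^ j) y"
  by (induction j) (auto intro: cong_kap)

lemma cong_norm: "x \<approx> y \<Longrightarrow> norm_op k x \<approx> norm_op k y"
  unfolding norm_op_def by (intro cong_sum cong_kap_pow)

text \<open>With \<open>b b = 0\<close>, only \<open>b d\<close> survives from
  \<open>b d + d b\<close> on the image of \<open>b\<close>; on the image of \<open>d\<close> only
  \<open>d b\<close> does. These formulas turn non-invariance under \<kappa> into terms that can be
  subtracted.\<close>

lemma kap_b: "kap (b x) \<approx> b x - b (d (b x))" and b_kap: "b (kap x) \<approx> kap (b x)"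
proof -
  have "kap (b x) = b x - b (d (b x)) - d (b (b x))" by (simp add: kap_def)
  also have "\<dots> \<approx> b x - b (d (b x)) - d 0" by (intro cong_diff cong_d) auto
  finally show 1: "kap (b x) \<approx> b x - b (d (b x))" by (simp add: hom_simps)
  have "b (kap x) = b x - b (b (d x)) - b (d (b x))" by (simp add: kap_def hom_simps)
  also have "\<dots> \<approx> b x - 0 - b (d (b x))" by (intro cong_diff) auto
  finally show "b (kap x) \<approx> kap (b x)" using cong_trans[OF _ cong_sym[OF 1]] by simp
qed

lemma kap_d: "kap (d x) \<approx> d x - d (b (d x))" and d_kap: "d (kap x) \<approx> kap (d x)"
proof -
  have "kap (d x) = d x - b (d (d x)) - d (b (d x))" by (simp add: kap_def)
  also have "\<dots> \<approx> d x - b 0 - d (b (d x))" by (intro cong_diff cong_b) auto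
  finally show 1: "kap (d x) \<approx> d x - d (b (d x))" by (simp add: hom_simps)
  have "d (kap x) = d x - d (b (d x)) - d (d (b x))" by (simp add: kap_def hom_simps)
  also have "\<dots> \<approx> d x - d (b (d x)) - 0" by (intro cong_diff) auto
  finally show "d (kap x) \<approx> kap (d x)" using cong_trans[OF _ cong_sym[OF 1]] by simp
qed

lemma b_kap_pow: "b ((kap ^^ j) x) \<approx> (kap ^^ j) (b x)"
  by (induction j) (auto intro: cong_trans[OF b_kap] cong_kap)

lemma d_kap_pow: "d ((kap ^^ j) x) \<approx> (kap ^^ j) (d x)"
  by (induction j) (auto intro: cong_trans[OF d_kap] cong_kap)

lemma b_norm: "b (norm_op k x) \<approx> norm_op k (b x)"
  unfolding norm_op_def b.sum by (intro cong_sum b_kap_pow)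

lemma d_norm: "d (norm_op k x) \<approx> norm_op k (d x)"
  unfolding norm_op_def d.sum by (intro cong_sum d_kap_pow)

lemma norm_invariant:
  assumes "kap x \<approx> x"
  shows "norm_op k x \<approx> s (of_nat k) x"
proof -
  have "(kap ^^ j) x \<approx> x" for j
    by (induction j) (auto intro: cong_trans[OF cong_kap assms])
  then have "norm_op k x \<approx> (\<Sum>j<k. x)" unfolding norm_op_def by (intro cong_sum)
  moreover have "(\<Sum>j<k. x) = s (of_nat k) x"
    by (induction k) (simp_all add: scale_left_distrib)
  ultimately show ?thesis by simp
qed

section \<open>Division by integers and averages\<close>

definition nat_inv :: "nat \<Rightarrow> 'k" where
  "nat_inv k = (SOME q. q * of_nat k = 1)"

lemma nat_inv: "0 < k \<Longrightarrow> nat_inv k * of_nat k = 1"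
  unfolding nat_inv_def using nat_invertible by (rule someI_ex)

lemma scale_nat_inv: "0 < k \<Longrightarrow> s (nat_inv k) (s (of_nat k) x) = x"
  by (simp add: nat_inv)

text \<open>Not the average itself, which is \<open>s (nat_inv k) (norm_op k x)\<close>, but a
  \<open>w\<close> accounting for the rest: summing
  \<open>(1 - \<kappa>) (norm_op j x) = x - \<kappa>^j x\<close> over \<open>j < k\<close> and
  dividing by \<open>k\<close> shows that \<open>(1 - \<kappa>) w\<close> is \<open>x\<close> minus
  its average.\<close>

definition avg :: "nat \<Rightarrow> 'v \<Rightarrow> 'v" where
  "avg k x = s (nat_inv k) (\<Sum>j<k. norm_op j x)"

lemma avg_V: "x \<in> V m \<Longrightarrow> avg k x \<in> V m"
  unfolding avg_def by (intro V_scale subspace_sum[OF sub_V] norm_V)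

lemma avg_b: "avg k (b x) \<approx> b (avg k x)"
  unfolding avg_def b.scale b.sum by (intro cong_scale cong_sum cong_sym[OF b_norm])

lemma avg_decomp:
  assumes "0 < k"
  shows "x = s (nat_inv k) (norm_op k x) + (avg k x - kap (avg k x))"
proof -
  have "(\<Sum>j<k. x) = s (of_nat k) x"
    by (induction k) (simp_all add: scale_left_distrib)
  then have "avg k x - kap (avg k x) = s (nat_inv k) (s (of_nat k) x - norm_op k x)"
    unfolding avg_def op_simps scale_right_diff_distrib[symmetric] sum_subtractf[symmetric] norm_telescope
    by (simp add: sum_subtractf norm_op_def)
  then show ?thesis
    using assms by (simp add: scale_right_diff_distrib scale_nat_inv nat_inv)
qed

lemma one_minus_kap: "x - kap x = b (d x) + d (b x)"
  by (simp add: kap_def)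

lemma \<iota>_cong_norm_b: "x \<in> V m \<Longrightarrow> \<iota> x \<approx> norm_op (nat m) (b x)"
  by (simp add: \<iota>_norm b_norm)

lemma B_cong_d_norm: "x \<in> V m \<Longrightarrow> B x \<approx> d (norm_op (nat (m + 1)) x)"
  by (simp add: B_norm cong_sym[OF d_norm])

text \<open>\<open>b x\<close> has degree \<open>m - 1\<close>, so \<open>\<kappa>^m\<close> acts on
  it as \<open>1 - d b\<close>, and \<open>b b = 0\<close>.\<close>

lemma b_invariant: assumes "x \<in> V m" shows "(kap ^^ nat m) (b x) \<approx> b x"
proof -
  have "(kap ^^ nat m) (b x) \<approx> b x - d (b (b x))" using kap_power[OF b_V[OF assms]] by simp
  also have "\<dots> \<approx> b x - d 0" by (intro cong_diff cong_d) auto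
  finally show ?thesis by (simp add: d.zero)
qed

text \<open>With \<open>k\<close> the degree of \<open>x\<close>, \<open>B b\<close> is a sum of
  \<open>k\<close> powers on \<open>d (b x)\<close> and \<open>b B\<close> one of
  \<open>k + 1\<close> powers on \<open>b (d x)\<close>. Completing the former combines both into
  \<open>norm_op (Suc k)\<close> of \<open>x - \<kappa> x\<close>, which telescopes to
  \<open>d (b x)\<close>; the added summand is \<open>d (b x)\<close> too, as
  \<open>\<kappa>^k\<close> fixes it.\<close>

lemma bB_Bb:
  assumes x: "x \<in> V m"
  shows "B (b x) + b (B x) \<approx> 0"
proof (cases "m < 0")
  case True
  then have "x = 0" using V_neg x by blast
  then show ?thesis by (simp add: hom_simps)
next
  case False
  define k where "k = nat m"
  have k: "nat (m + 1) = Suc k" using False by (simp add: k_def)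
  have dbx: "(kap ^^ k) (d (b x)) \<approx> d (b x)"
    unfolding k_def using cong_trans[OF cong_sym[OF d_kap_pow] cong_d[OF b_invariant[OF x]]] .
  have Bb: "B (b x) = norm_op k (d (b x))" using B_norm[OF b_V[OF x]] by (simp add: k_def)
  have bB: "b (B x) \<approx> norm_op (Suc k) (b (d x))"
    using b_norm[of "Suc k" "d x"] B_norm[OF x] unfolding k by simp
  have "B (b x) + b (B x) \<approx> norm_op k (d (b x)) + norm_op (Suc k) (b (d x))"
    unfolding Bb by (rule cong_add[OF cong_refl bB])
  also have "\<dots> = norm_op (Suc k) (x - kap x) - (kap ^^ k) (d (b x))"
    unfolding one_minus_kap norm_op.add norm_Suc[of k "d (b x)"] by simp
  also have "norm_op (Suc k) (x - kap x) = x - (kap ^^ Suc k) x"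
    unfolding norm_op.diff norm_kap norm_telescope ..
  also have "x - (kap ^^ Suc k) x - (kap ^^ k) (d (b x)) \<approx> x - (x - d (b x)) - d (b x)"
    using kap_power[OF x] unfolding k by (intro cong_diff cong_refl dbx)
  finally show ?thesis by simp
qed

lemma Bb_cong: "x \<in> V m \<Longrightarrow> B (b x) \<approx> - b (B x)"
  using cong_diff[OF bB_Bb cong_refl, of x m "b (B x)"] by simp

lemma Bd_0: assumes "x \<in> V m" shows "B (d x) \<approx> 0"
proof -
  have "norm_op k (d (d x)) \<approx> norm_op k 0" for k by (intro cong_norm dd_0)
  then show ?thesis using B_norm[OF d_V[OF assms]] by (simp add: op_simps)
qed

text \<open>Another form of the anticommutation of \<open>b\<close> and \<open>B\<close>: by their
  numbers of summands \<open>\<iota> (d x)\<close> is literally \<open>b (B x)\<close>, and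
  \<open>B (b x)\<close> is \<open>d (\<iota> x)\<close> modulo \<open>N\<close>.\<close>

lemma \<iota>d: assumes "x \<in> V m" shows "\<iota> (d x) \<approx> - d (\<iota> x)"
proof -
  have "\<iota> (d x) = b (B x)" using \<iota>_norm[OF d_V[OF assms]] B_norm[OF assms] by simp
  also have "\<dots> \<approx> - B (b x)"
    using cong_diff[OF bB_Bb[OF assms] cong_refl, of "B (b x)"] by simp
  also have "B (b x) = norm_op (nat m) (d (b x))" using B_norm[OF b_V[OF assms]] by simp
  also have "- norm_op (nat m) (d (b x)) \<approx> - d (\<iota> x)"
  proof -
    have "norm_op (nat m) (d (b x)) \<approx> d (norm_op (nat m) (b x))" by (rule cong_sym[OF d_norm])
    also have "\<dots> \<approx> d (\<iota> x)" by (intro cong_d cong_sym[OF \<iota>_cong_norm_b[OF assms]])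
    finally show ?thesis using cong_diff[OF cong_refl[of 0]] by fastforce
  qed
  finally show ?thesis .
qed

lemma d_invariant: "d (b (d y)) \<approx> 0 \<Longrightarrow> kap (d y) \<approx> d y"
  using cong_trans[OF kap_d, of y "d y - 0"] cong_diff[OF cong_refl, of "d (b (d y))" 0 "d y"] by simp

lemma invariant_scale_norm:
  assumes "0 < k" "kap x \<approx> x"
  shows "s (nat_inv k) (norm_op k x) \<approx> x"
  using cong_scale[OF norm_invariant[OF assms(2)], of "nat_inv k" k] assms(1)
  by (simp add: nat_inv)

text \<open>On an invariant form the sum of \<open>m + 1\<close> powers in \<open>B\<close> is
  multiplication by \<open>m + 1\<close>, so \<open>g\<close> is \<open>y\<close> divided by
  \<open>m + 1\<close>.\<close>

lemma d_invariant_B: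
  assumes y: "y \<in> V m" and inv: "d (b (d y)) \<approx> 0"
  shows "\<exists>g\<in>V m. d y \<approx> B g"
proof (cases "m < 0")
  case True
  then have "y = 0" using V_neg y by blast
  then show ?thesis by (intro bexI[of _ 0]) (simp_all add: d.zero B.zero V_0)
next
  case False
  then have "d y \<approx> s (nat_inv (nat (m + 1))) (norm_op (nat (m + 1)) (d y))"
    using cong_sym[OF invariant_scale_norm[OF _ d_invariant[OF inv]]] by simp
  also have "\<dots> = B (s (nat_inv (nat (m + 1))) y)" by (simp add: B.scale B_norm[OF y])
  finally show ?thesis using V_scale[OF y] by blast
qed


section \<open>Commutators, and the comparison with Hochschild homology\<close>

lemma K_cong: "x \<approx> y \<Longrightarrow> y \<in> K \<Longrightarrow> x \<in> K"
  using subspace_add[OF sub_K, of "x - y" y] subsetD[OF N_K, of "x - y"] by (simp add: cong_def)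

lemma K_E:
  assumes "x \<in> V m" "x \<in> K"
  obtains y z where "y \<in> V (m + 1)" "z \<in> V m" "x \<approx> b y + d (b z)"
  using K_iff[OF assms(1)] assms(2) by (auto simp: cong_def)

lemma K_I:
  assumes "x \<in> V m" "y \<in> V (m + 1)" "z \<in> V m" "x \<approx> b y + d (b z)"
  shows "x \<in> K"
  using assms K_iff[OF assms(1)] by (auto simp: cong_def)

lemma b_K: assumes "x \<in> V m" shows "b x \<in> K"
  by (rule K_I[of _ "m - 1" x 0]) (use assms b_V V_0 in \<open>simp_all add: b.zero d.zero\<close>)

lemma db_K: assumes "x \<in> V m" shows "d (b x) \<in> K"
  by (rule K_I[of _ m 0 x]) (use assms d_V[OF b_V, of x m] V_0 in \<open>simp_all add: b.zero\<close>)

lemma \<iota>_V: assumes "x \<in> V m" shows "\<iota> x \<in> V (m - 1)"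
  unfolding \<iota>_norm[OF assms] by (intro b_V norm_V assms)

lemma B_V: assumes "x \<in> V m" shows "B x \<in> V (m + 1)"
  unfolding B_norm[OF assms] by (intro norm_V d_V assms)

lemma \<iota>_K: assumes "x \<in> V m" shows "\<iota> x \<in> K"
  unfolding \<iota>_norm[OF assms] by (rule b_K[OF norm_V[OF assms]])

lemma d_K:
  assumes "x \<in> V m" "x \<in> K"
  shows "d x \<in> K"
proof -
  obtain y z where yz: "y \<in> V (m + 1)" "z \<in> V m" "x \<approx> b y + d (b z)"
    using K_E[OF assms] .
  have "d x \<approx> d (b y) + d (d (b z))" using cong_d[OF yz(3)] by (simp add: hom_simps)
  also have "\<dots> \<approx> d (b y) + 0" by (intro cong_add cong_refl dd_0)
  finally have "d x \<approx> d (b y)" by simp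
  then show ?thesis using db_K[OF yz(1)] by (rule K_cong)
qed

lemma \<iota>_cong_0_of_b:
  assumes "x \<in> V m" "b x \<approx> 0"
  shows "\<iota> x \<approx> 0"
  using cong_trans[OF \<iota>_cong_norm_b[OF assms(1)] cong_norm[OF assms(2)]] by (simp add: op_simps)

text \<open>The average of \<open>b f\<close> vanishes, so \<open>b f\<close> is \<open>(1 - \<kappa>) (b y)\<close> for some \<open>y\<close>, which is \<open>b (d (b y))\<close>.\<close>

lemma HH_surj:
  assumes f: "f \<in> V m" and \<iota>f: "\<iota> f \<approx> 0"
  shows "\<exists>f'\<in>V m. b f' \<approx> 0 \<and> f' - f \<in> K"
proof (cases "0 < m")
  case False
  then have "b f = 0" using V_neg[OF _ b_V[OF f]] by simp
  then show ?thesis using f subspace_0[OF sub_K] by (intro bexI[of _ f]) auto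
next
  case True
  define k y where "k = nat m" and "y = avg k f"
  have k: "0 < k" using True by (simp add: k_def)
  have y: "y \<in> V m" unfolding y_def by (rule avg_V[OF f])
  have Nbf: "norm_op k (b f) \<approx> 0"
    using cong_trans[OF cong_sym[OF \<iota>_cong_norm_b[OF f]] \<iota>f] by (simp add: k_def)
  have w: "avg k (b f) \<approx> b y" unfolding y_def by (rule avg_b)
  have "b f = s (nat_inv k) (norm_op k (b f)) + (avg k (b f) - kap (avg k (b f)))"
    by (rule avg_decomp[OF k])
  also have "\<dots> \<approx> s (nat_inv k) 0 + (b y - kap (b y))"
    by (intro cong_add cong_scale Nbf cong_diff cong_kap w)
  also have "\<dots> \<approx> s (nat_inv k) 0 + (b y - (b y - b (d (b y))))"
    by (intro cong_add cong_diff cong_refl kap_b)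
  finally have bf: "b f \<approx> b (d (b y))" by simp
  have "b (f - d (b y)) \<approx> b (d (b y)) - b (d (b y))"
    unfolding b.diff by (intro cong_diff bf cong_refl)
  moreover have "f - d (b y) \<in> V m" using V_diff[OF f] d_V[OF b_V[OF y]] by simp
  moreover have "f - d (b y) - f \<in> K" using subspace_neg[OF sub_K db_K[OF y]] by simp
  ultimately show ?thesis by (intro bexI[of _ "f - d (b y)"]) auto
qed

text \<open>In \<open>f = b y + d (b z)\<close> the second term is \<kappa>-invariant, since
  \<open>d b\<close> kills both \<open>f\<close> and \<open>b y\<close>. Hence it equals its
  average, a multiple of \<open>B (b z) = - b (B z)\<close>, and is a boundary as well.\<close>

lemma HH_inj:
  assumes f: "f \<in> V m" and bf: "b f \<approx> 0" and fK: "f \<in> K"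
  shows "\<exists>x\<in>V (m + 1). f \<approx> b x"
proof -
  obtain y z where y: "y \<in> V (m + 1)" and z: "z \<in> V m" and fyz: "f \<approx> b y + d (b z)"
    using K_E[OF f fK] .
  show ?thesis
  proof (cases "0 < m")
    case False
    then have "b z = 0" using V_neg[OF _ b_V[OF z]] by simp
    then show ?thesis using y fyz by (auto simp: d.zero)
  next
    case True
    \<comment> \<open>\<open>b z\<close> has degree \<open>m - 1\<close>, so \<open>B (b z)\<close>
      has \<open>m\<close> summands; hence the divisor.\<close>
    define k x where "k = nat m" and "x = y - s (nat_inv k) (B z)"
    have k: "0 < k" using True by (simp add: k_def)
    have "d (b (d (b z))) \<approx> d (b (f - b y))"
      by (intro cong_d cong_b) (use cong_diff[OF cong_sym[OF fyz] cong_refl, of "b y"] in simp)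
    also have "\<dots> \<approx> d (0 - 0)" unfolding b.diff by (intro cong_d cong_diff bf bb_0)
    finally have "kap (d (b z)) \<approx> d (b z)" by (intro d_invariant) (simp add: d.zero)
    then have "d (b z) \<approx> s (nat_inv k) (norm_op k (d (b z)))"
      using cong_sym[OF invariant_scale_norm[OF k]] by blast
    also have "\<dots> = s (nat_inv k) (B (b z))" using B_norm[OF b_V[OF z]] by (simp add: k_def)
    also have "\<dots> \<approx> s (nat_inv k) (- b (B z))" by (intro cong_scale Bb_cong[OF z])
    finally have "b y + d (b z) \<approx> b y + s (nat_inv k) (- b (B z))" by (intro cong_add cong_refl)
    then have "f \<approx> b x" using cong_trans[OF fyz] by (simp add: x_def hom_simps)
    moreover have "x \<in> V (m + 1)" unfolding x_def by (intro V_diff V_scale y B_V z)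
    ultimately show ?thesis by blast
  qed
qed

text \<open>\<open>B f = 0\<close> says that the norm of \<open>f\<close> is closed, hence exact.
  The decomposition of \<open>f\<close> into its average and \<open>(1 - \<kappa>) w\<close> then
  reads \<open>b (d w) + d v\<close>, and exactness of \<open>b f\<close> makes \<open>d v\<close>
  invariant, hence a value of \<open>B\<close>.\<close>

lemma B_kernel:
  assumes f: "f \<in> V m" and Bf: "B f \<approx> 0" and bf: "b f \<approx> d e"
  shows "\<exists>w\<in>V m. \<exists>g\<in>V (m - 1). f \<approx> b (d w) + B g"
proof (cases "m < 0")
  case True
  then have "f = 0" using V_neg f by blast
  then show ?thesis
    by (intro bexI[of _ 0]) (simp_all add: hom_simps V_0)
next
  case False
  define k w where "k = nat (m + 1)" and "w = avg k f"
  have k: "0 < k" using False by (simp add: k_def)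
  have w: "w \<in> V m" unfolding w_def by (rule avg_V[OF f])
  have "d (norm_op k f) \<approx> 0"
    using cong_trans[OF d_norm Bf[unfolded B_norm[OF f]]] by (simp add: k_def)
  then obtain y where y: "y \<in> V (m - 1)" and Nf: "norm_op k f \<approx> d y"
    using d_exact[OF norm_V[OF f]] by (auto simp: cong_def)
  \<comment> \<open>\<open>v\<close> collects primitives of the two exact contributions: the
    average, and \<open>d (b w)\<close> from \<open>(1 - \<kappa>) w\<close>.\<close>
  define v where "v = s (nat_inv k) y + b w"
  have v: "v \<in> V (m - 1)" unfolding v_def by (intro V_add V_scale y b_V w)
  have "f = s (nat_inv k) (norm_op k f) + (w - kap w)"
    unfolding w_def by (rule avg_decomp[OF k])
  also have "\<dots> \<approx> s (nat_inv k) (d y) + (w - kap w)" by (intro cong_add cong_scale Nf cong_refl)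
  also have "\<dots> = b (d w) + d v" by (simp add: one_minus_kap v_def hom_simps)
  finally have fv: "f \<approx> b (d w) + d v" .
  have "d (b (d v)) \<approx> d (b (f - b (d w)))"
    by (intro cong_d cong_b) (use cong_diff[OF cong_sym[OF fv] cong_refl, of "b (d w)"] in simp)
  also have "\<dots> \<approx> d (d e - 0)" unfolding b.diff by (intro cong_d cong_diff bf bb_0)
  also have "\<dots> \<approx> 0" by simp
  finally obtain g where g: "g \<in> V (m - 1)" and "d v \<approx> B g"
    using d_invariant_B[OF v] by blast
  then have "b (d w) + d v \<approx> b (d w) + B g" by (intro cong_add cong_refl)
  then show ?thesis using cong_trans[OF fv] w g by blast
qed

section \<open>Cyclic chains\<close>

abbreviation coef :: "(nat \<Rightarrow>\<^sub>0 'v) \<Rightarrow> nat \<Rightarrow> 'v" where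
  "coef \<equiv> Poly_Mapping.lookup"

text \<open>The coefficient of \<open>u^(-k)\<close> in \<open>(b - uB) c\<close> is
  \<open>b c_k - B c_(k+1)\<close>, as \<open>u\<close> moves index \<open>k + 1\<close> to
  \<open>k\<close> and annihilates index \<open>0\<close>.\<close>

definition cycles :: "int \<Rightarrow> (nat \<Rightarrow>\<^sub>0 'v) set" where
  "cycles m = {c. (\<forall>k. coef c k \<in> V (m - 2 * int k)) \<and>
     (\<forall>k. b (coef c k) \<approx> B (coef c (Suc k)))}"

definition bounds :: "int \<Rightarrow> (nat \<Rightarrow>\<^sub>0 'v) \<Rightarrow> (nat \<Rightarrow>\<^sub>0 'v) \<Rightarrow> bool" where
  "bounds m e c \<longleftrightarrow> (\<forall>k. coef e k \<in> V (m + 1 - 2 * int k)) \<and>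
     (\<forall>k. coef c k \<approx> b (coef e k) - B (coef e (Suc k)))"

text \<open>Forms \<open>x + u^(-1) c'\<close>: the inductive step from chains of degree
  \<open>m - 2\<close> to chains of degree \<open>m\<close>.\<close>

lemma poly_mapping_cons:
  fixes x :: 'v
  shows "\<exists>c. coef c 0 = x \<and> (\<forall>k. coef c (Suc k) = coef c' k)"
proof -
  define f where "f = case_nat x (coef c')"
  have "{k. f k \<noteq> 0} \<subseteq> insert 0 (Suc ` Poly_Mapping.keys c')"
  proof
    fix k assume "k \<in> {k. f k \<noteq> 0}"
    then show "k \<in> insert 0 (Suc ` Poly_Mapping.keys c')"
      by (cases k) (simp_all add: f_def in_keys_iff)
  qed
  then have "finite {k. f k \<noteq> 0}" by (rule finite_subset) auto
  then have "coef (Abs_poly_mapping f) = f" by (rule Abs_poly_mapping_inverse[OF CollectI])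
  then show ?thesis by (intro exI[of _ "Abs_poly_mapping f"]) (simp add: f_def)
qed

text \<open>Correcting \<open>f\<close> by \<open>d (b y)\<close> leaves \<open>b f'\<close> equal
  to \<open>d e'\<close>, an invariant exact form, hence to some \<open>B g\<close> modulo
  \<open>N\<close>. So \<open>g\<close> serves as the next coefficient, and the induction applies to
  it because \<open>d (\<iota> g) = B (b g) = - b (B g) = - b (b f') = 0\<close> modulo
  \<open>N\<close> makes \<open>\<iota> g\<close> exact.\<close>

lemma HC_surj:
  assumes "f \<in> V m" "\<iota> f \<approx> d e" "e \<in> V (m - 2)"
  shows "\<exists>c\<in>cycles m. \<exists>y\<in>V (m - 1). coef c 0 \<approx> f + d y"
  using assms
proof (induction "nat (m + 1)" arbitrary: m f e rule: less_induct)
  case less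
  note f = less.prems(1) and \<iota>f = less.prems(2) and e = less.prems(3)
  show ?case
  proof (cases "0 < m")
    case False
    then have bf: "b f = 0" using V_neg[OF _ b_V[OF f]] by simp
    have "Poly_Mapping.single 0 f \<in> cycles m"
      using f bf by (auto simp: cycles_def lookup_single when_def hom_simps V_0)
    then show ?thesis by (intro bexI[of _ "Poly_Mapping.single 0 f"] bexI[of _ 0]) (auto simp: d.zero V_0)
  next
    case True
    define k y where "k = nat m" and "y = avg k f"
    define f' e' where "f' = f - d (b y)" and "e' = s (nat_inv k) e"
    have k: "0 < k" using True by (simp add: k_def)
    have y: "y \<in> V m" unfolding y_def by (rule avg_V[OF f])
    have f': "f' \<in> V m" unfolding f'_def using V_diff[OF f] d_V[OF b_V[OF y]] by simp
    have e': "e' \<in> V (m - 2)" unfolding e'_def by (rule V_scale[OF e])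
    have Nbf: "norm_op k (b f) \<approx> d e"
      using cong_trans[OF cong_sym[OF \<iota>_cong_norm_b[OF f]] \<iota>f] by (simp add: k_def)
    have w: "avg k (b f) \<approx> b y" unfolding y_def by (rule avg_b)
    have "b f = s (nat_inv k) (norm_op k (b f)) + (avg k (b f) - kap (avg k (b f)))"
      by (rule avg_decomp[OF k])
    also have "\<dots> \<approx> s (nat_inv k) (d e) + (b y - kap (b y))"
      by (intro cong_add cong_scale Nbf cong_diff cong_kap w)
    also have "\<dots> \<approx> s (nat_inv k) (d e) + (b y - (b y - b (d (b y))))"
      by (intro cong_add cong_diff cong_refl kap_b)
    finally have "b f \<approx> d e' + b (d (b y))" by (simp add: e'_def hom_simps)
    then have bf': "b f' \<approx> d e'"
      using cong_diff[OF _ cong_refl, of "b f" "d e' + b (d (b y))" "b (d (b y))"]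
      by (simp add: f'_def hom_simps)
    have "b (d e') \<approx> 0" using cong_trans[OF cong_b[OF cong_sym[OF bf']] bb_0] .
    then have "d (b (d e')) \<approx> 0" using cong_d[of "b (d e')" 0] by (simp add: d.zero)
    then obtain g where g: "g \<in> V (m - 2)" and "d e' \<approx> B g" using d_invariant_B[OF e'] by blast
    then have bf'g: "b f' \<approx> B g" using bf' cong_trans by blast
    have "d (\<iota> g) \<approx> d (norm_op (nat (m - 2)) (b g))" by (intro cong_d \<iota>_cong_norm_b g)
    also have "\<dots> \<approx> B (b g)" using cong_sym[OF B_cong_d_norm[OF b_V[OF g]]] by simp
    also have "\<dots> \<approx> - b (B g)" by (rule Bb_cong[OF g])
    also have "\<dots> \<approx> - b (b f')"
      using cong_diff[OF cong_refl cong_b[OF cong_sym[OF bf'g]], of 0] by simp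
    also have "\<dots> \<approx> 0" using cong_diff[OF cong_refl bb_0, of 0] by simp
    finally obtain e2 where "e2 \<in> V (m - 4)" "\<iota> g \<approx> d e2"
      using d_exact[OF \<iota>_V[OF g]] by (auto simp: cong_def)
    then obtain c' z where c': "c' \<in> cycles (m - 2)" "z \<in> V (m - 3)" "coef c' 0 \<approx> g + d z"
      using less.hyps[of "m - 2" g e2] g True by auto
    obtain c where c: "coef c 0 = f'" "\<And>k. coef c (Suc k) = coef c' k"
      using poly_mapping_cons[of f' c'] by blast
    \<comment> \<open>The induction hypothesis returns \<open>g\<close> only up to an exact form,
      which is harmless because \<open>B d = 0\<close>.\<close>
    have "B (coef c' 0) \<approx> B g + B (d z)" using cong_B[OF c'(3)] by (simp add: hom_simps)
    also have "\<dots> \<approx> B g + 0" by (intro cong_add cong_refl Bd_0[OF c'(2)])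
    finally have "b f' \<approx> B (coef c' 0)" using cong_trans[OF bf'g cong_sym] by simp
    then have "b (coef c j) \<approx> B (coef c (Suc j))" for j
      using c' c by (cases j) (auto simp: cycles_def)
    moreover have "coef c j \<in> V (m - 2 * int j)" for j
      using c' c f' by (cases j) (auto simp: cycles_def algebra_simps)
    ultimately have "c \<in> cycles m" by (simp add: cycles_def)
    moreover have "coef c 0 \<approx> f + d (- b y)" by (simp add: c f'_def hom_simps)
    ultimately show ?thesis using V_neg_closed[OF b_V[OF y]] by blast
  qed
qed

text \<open>The chain \<open>d w\<close> has boundary \<open>b (d w)\<close>, since \<open>B d = 0\<close>. Hence \<open>B_kernel\<close> allows to clear
  the leading coefficient.\<close>

lemma HC_bounds:
  assumes "c \<in> cycles m" "B (coef c 0) \<approx> 0"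
  shows "\<exists>e. bounds m e c \<and> B (coef e 0) \<approx> 0"
  using assms
\<comment> \<open>The shift by \<open>1\<close> lets the measure drop also from \<open>m = 0\<close>
  to \<open>m = -2\<close>, where all forms vanish.\<close>
proof (induction "nat (m + 1)" arbitrary: m c rule: less_induct)
  case less
  have cV: "coef c k \<in> V (m - 2 * int k)" and cB: "b (coef c k) \<approx> B (coef c (Suc k))" for k
    using less.prems by (auto simp: cycles_def)
  show ?case
  proof (cases "m < 0")
    case True
    then have "coef c k = 0" for k using V_neg[OF _ cV, of k] by simp
    then show ?thesis by (intro exI[of _ 0]) (simp add: bounds_def hom_simps V_0)
  next
    case False
    have c1: "coef c 1 \<in> V (m - 2)" using cV[of 1] by simp
    have bc0: "b (coef c 0) \<approx> d (norm_op (nat (m - 2 + 1)) (coef c 1))"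
      using cong_trans[OF cB[of 0]] B_cong_d_norm[OF c1] by simp
    have "coef c 0 \<in> V m" using cV[of 0] by simp
    then obtain w g where w: "w \<in> V m" and g: "g \<in> V (m - 1)"
      and c0: "coef c 0 \<approx> b (d w) + B g"
      using B_kernel[OF _ less.prems(2) bc0] by blast
    \<comment> \<open>The chain \<open>d w - u^(-1) g\<close> has boundary
      \<open>b (d w) + B g\<close> at index \<open>0\<close> and \<open>- b g\<close> at index
      \<open>1\<close>. Subtracting this boundary from \<open>c\<close> clears index
      \<open>0\<close>; \<open>c'\<close> is the rest with indices lowered by one.\<close>
    define c' where "c' = Poly_Mapping.map_key Suc c + Poly_Mapping.single 0 (b g)"
    have lc': "coef c' 0 = coef c 1 + b g" "\<And>k. coef c' (Suc k) = coef c (Suc (Suc k))"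
      by (simp_all add: c'_def lookup_add map_key.rep_eq lookup_single)
    have "b (coef c' k) \<approx> B (coef c' (Suc k))" for k
    proof (cases k)
      case 0
      have "b (coef c' 0) \<approx> b (coef c 1) + 0" unfolding lc' b.add by (intro cong_add bb_0) simp
      then show ?thesis using cong_trans[OF _ cB[of 1]] 0 by (simp add: lc')
    qed (use cB lc' in auto)
    moreover have "coef c' k \<in> V (m - 2 - 2 * int k)" for k
      using V_add[OF c1, of "b g"] b_V[OF g] cV[of "Suc k"]
      by (cases k) (auto simp: lc' algebra_simps)
    ultimately have cyc': "c' \<in> cycles (m - 2)" by (simp add: cycles_def)
    have "B (coef c' 0) \<approx> b (coef c 0) - b (B g)"
      using cong_add[OF cong_sym[OF cB[of 0]] Bb_cong[OF g]] by (simp add: lc' hom_simps)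
    also have "\<dots> = b (coef c 0 - B g)" by (simp add: hom_simps)
    also have "\<dots> \<approx> b (b (d w))"
      using cong_b[OF cong_diff[OF c0 cong_refl], of "B g"] by simp
    also have "\<dots> \<approx> 0" by simp
    finally obtain e' where e': "bounds (m - 2) e' c'" "B (coef e' 0) \<approx> 0"
      using less.hyps[OF _ cyc'] False by auto
    have e'V: "coef e' k \<in> V (m - 1 - 2 * int k)"
      and e'B: "coef c' k \<approx> b (coef e' k) - B (coef e' (Suc k))" for k
      using e'(1) by (auto simp: bounds_def)
    obtain e where e: "coef e 0 = d w"
      "\<And>k. coef e (Suc k) = coef (e' - Poly_Mapping.single 0 g) k"
      using poly_mapping_cons[of "d w" "e' - Poly_Mapping.single 0 g"] by blast
    have le: "coef e (Suc 0) = coef e' 0 - g" "coef e (Suc (Suc k)) = coef e' (Suc k)" for k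
      by (simp_all add: e lookup_minus lookup_single)
    have "coef e k \<in> V (m + 1 - 2 * int k)" for k
    proof (cases k)
      case 0
      then show ?thesis using d_V[OF w] by (simp add: e)
    next
      case (Suc j)
      show ?thesis
      proof (cases j)
        case 0
        then show ?thesis using V_diff[OF e'V[of 0], of g] g by (simp add: Suc le(1))
      next
        case (Suc i)
        then show ?thesis using e'V[of j] \<open>k = Suc j\<close> by (simp add: le(2) algebra_simps)
      qed
    qed
    moreover have "coef c k \<approx> b (coef e k) - B (coef e (Suc k))" for k
    proof (cases k)
      case 0
      \<comment> \<open>Here the second conclusion of the induction hypothesis enters: the entry
        \<open>coef e' 0 - g\<close> at index \<open>1\<close> must contribute just
        \<open>B g\<close> at index \<open>0\<close>.\<close>
      have "b (d w) + B g - 0 \<approx> b (d w) + B g - B (coef e' 0)"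
        by (intro cong_diff cong_refl cong_sym[OF e'(2)])
      then show ?thesis using cong_trans[OF c0] 0 by (simp add: e(1) le hom_simps algebra_simps)
    next
      case (Suc j)
      show ?thesis
      proof (cases j)
        case 0
        have "coef c 1 \<approx> b (coef e' 0) - B (coef e' (Suc 0)) - b g"
          using cong_diff[OF e'B[of 0] cong_refl, of "b g"] by (simp add: lc')
        then show ?thesis by (simp add: Suc 0 le hom_simps algebra_simps)
      next
        case (Suc i)
        then show ?thesis using e'B[of "Suc i"] \<open>k = Suc j\<close> by (simp add: lc' le)
      qed
    qed
    ultimately have "bounds m e c" by (simp add: bounds_def)
    moreover have "B (coef e 0) \<approx> 0" using Bd_0[OF w] by (simp add: e)
    ultimately show ?thesis by blast
  qed
qed

text \<open>The commutator part of the leading coefficient is \<open>b x + d (b z)\<close>.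
  Subtracting the boundary of \<open>x\<close>, placed at index \<open>0\<close>, leaves an exact
  leading coefficient, on which \<open>B\<close> vanishes.\<close>

lemma HC_inj:
  assumes c: "c \<in> cycles m" and y: "y \<in> V (m - 1)" and K: "coef c 0 - d y \<in> K"
  shows "\<exists>e. bounds m e c"
proof -
  have cV: "coef c k \<in> V (m - 2 * int k)" and cB: "b (coef c k) \<approx> B (coef c (Suc k))" for k
    using c by (auto simp: cycles_def)
  have "coef c 0 - d y \<in> V m" using V_diff[of "coef c 0" m "d y"] cV[of 0] d_V[OF y] by simp
  then obtain x z where x: "x \<in> V (m + 1)" and z: "z \<in> V m"
    and "coef c 0 - d y \<approx> b x + d (b z)"
    using K_E[OF _ K] by blast
  then have c0: "coef c 0 \<approx> b x + d (b z) + d y"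
    using cong_add[OF _ cong_refl, of "coef c 0 - d y" "b x + d (b z)" "d y"] by simp
  define c' where "c' = c - Poly_Mapping.single 0 (b x)"
  have lc': "coef c' 0 = coef c 0 - b x" "\<And>k. coef c' (Suc k) = coef c (Suc k)"
    by (simp_all add: c'_def lookup_minus lookup_single)
  have "coef c' k \<in> V (m - 2 * int k)" for k
    using V_diff[of "coef c 0" m "b x"] b_V[OF x] cV[of k] cV[of 0] by (cases k) (auto simp: lc')
  moreover have "b (coef c' k) \<approx> B (coef c' (Suc k))" for k
  proof (cases k)
    case 0
    have "b (coef c' 0) \<approx> b (coef c 0) - 0" unfolding lc' b.diff by (intro cong_diff bb_0) simp
    then show ?thesis using cong_trans[OF _ cB[of 0]] 0 by (simp add: lc')
  qed (use cB lc' in auto)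
  ultimately have "c' \<in> cycles m" by (simp add: cycles_def)
  moreover have "B (coef c' 0) \<approx> 0"
  proof -
    have "coef c' 0 \<approx> d (b z + y)"
      using cong_diff[OF c0 cong_refl, of "b x"] by (simp add: lc' hom_simps algebra_simps)
    then have "B (coef c' 0) \<approx> B (d (b z + y))" by (rule cong_B)
    also have "\<dots> \<approx> 0" using V_add[OF b_V[OF z] y] by (rule Bd_0)
    finally show ?thesis .
  qed
  ultimately obtain e where e: "bounds m e c'" using HC_bounds by blast
  define e' where "e' = e + Poly_Mapping.single 0 x"
  have le': "coef e' 0 = coef e 0 + x" "\<And>k. coef e' (Suc k) = coef e (Suc k)"
    by (simp_all add: e'_def lookup_add lookup_single)
  have "coef c k \<approx> b (coef e' k) - B (coef e' (Suc k))" for k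
  proof (cases k)
    case 0
    have "coef c' 0 \<approx> b (coef e 0) - B (coef e (Suc 0))" using e by (simp add: bounds_def)
    from cong_add[OF this cong_refl, of "b x"] show ?thesis
      by (simp add: 0 lc' le' hom_simps algebra_simps)
  next
    case (Suc j)
    have "coef c' k \<approx> b (coef e k) - B (coef e (Suc k))"
      using e by (simp add: bounds_def)
    then show ?thesis by (simp add: Suc lc' le')
  qed
  moreover have "coef e' k \<in> V (m + 1 - 2 * int k)" for k
    using e V_add[of "coef e 0" "m + 1" x] x
    unfolding bounds_def le'(2)[of "k - 1"] by (cases k) (auto simp: le' dest: spec[of _ k])
  ultimately show ?thesis unfolding bounds_def by blast
qed

text \<open>\<open>\<iota>\<close> is the norm of \<open>b\<close>, \<open>b\<close> of the leading
  coefficient is \<open>B\<close> of the next one, values of \<open>B\<close> are exact, and the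
  norm commutes with \<open>d\<close>.\<close>

lemma cycles_\<iota>:
  assumes "c \<in> cycles m"
  shows "\<exists>e\<in>V (m - 2). \<iota> (coef c 0) \<approx> d e"
proof -
  have c0: "coef c 0 \<in> V m" and c1: "coef c 1 \<in> V (m - 2)"
    and "b (coef c 0) \<approx> B (coef c (Suc 0))"
    using assms unfolding cycles_def by (auto dest: spec[of _ 0] spec[of _ 1])
  then have "b (coef c 0) \<approx> d (norm_op (nat (m - 1)) (coef c 1))" (is "_ \<approx> d ?y")
    using cong_trans B_cong_d_norm[OF c1] by auto
  then have "norm_op (nat m) (b (coef c 0)) \<approx> norm_op (nat m) (d ?y)" by (rule cong_norm)
  then have "\<iota> (coef c 0) \<approx> norm_op (nat m) (d ?y)"
    by (rule cong_trans[OF \<iota>_cong_norm_b[OF c0]])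
  then have "\<iota> (coef c 0) \<approx> d (norm_op (nat m) ?y)" by (rule cong_trans[OF _ cong_sym[OF d_norm]])
  then show ?thesis using norm_V[OF norm_V[OF c1]] by blast
qed

lemma bounds_K:
  assumes "bounds m e c"
  shows "\<exists>y\<in>V (m - 1). coef c 0 - d y \<in> K"
proof -
  have e: "coef e 0 \<in> V (m + 1)" "coef e 1 \<in> V (m - 1)"
    and c: "coef c 0 \<approx> b (coef e 0) - B (coef e (Suc 0))"
    using assms unfolding bounds_def by (auto dest: spec[of _ 0] spec[of _ 1])
  define y where "y = - norm_op (nat m) (coef e 1)"
  have y: "y \<in> V (m - 1)" unfolding y_def by (intro V_neg_closed norm_V e)
  have "B (coef e 1) \<approx> - d y" using B_cong_d_norm[OF e(2)] by (simp add: y_def hom_simps)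
  then have "b (coef e 0) - B (coef e 1) - d y \<approx> b (coef e 0) - (- d y) - d y"
    by (intro cong_diff cong_refl)
  then have "coef c 0 - d y \<approx> b (coef e 0)"
    using cong_trans[OF cong_diff[OF c cong_refl, of "d y"]] by simp
  then show ?thesis using K_cong b_K[OF e(1)] y by blast
qed

text \<open>After \<open>g\<close> is corrected by the commutators \<open>b y\<close>, the form
  \<open>d g' = b x\<close> is both exact and in the image of \<open>b\<close>, hence
  \<kappa>-invariant. The contraction of \<open>x\<close> is then \<open>m + 2\<close> times
  \<open>b x\<close>.\<close>

lemma S1_surj:
  assumes g: "g \<in> V m" and dg: "d g \<in> K"
  shows "\<exists>f\<in>V (m + 2). \<exists>g'\<in>V m. \<iota> f \<approx> d g' \<and> g' - g \<in> K"
proof (cases "m < 0")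
  case True
  then have "g = 0" using V_neg g by blast
  then show ?thesis
    using subspace_0[OF sub_K] by (intro bexI[of _ 0]) (simp_all add: hom_simps V_0)
next
  case False
  obtain x y where x: "x \<in> V (m + 2)" and y: "y \<in> V (m + 1)" and dgxy: "d g \<approx> b x + d (b y)"
    using K_E[OF d_V[OF g] dg] by (auto simp: add.assoc)
  define g' k f where "g' = g - b y" and "k = nat (m + 2)" and "f = s (nat_inv k) x"
  have g': "g' \<in> V m" unfolding g'_def using V_diff[OF g] b_V[OF y] by simp
  have dg': "d g' \<approx> b x"
    using cong_diff[OF dgxy cong_refl, of "d (b y)"] by (simp add: g'_def hom_simps)
  have "d (b (d g')) \<approx> d 0" using cong_trans[OF cong_b[OF dg'] bb_0] by (rule cong_d)
  then have "kap (d g') \<approx> d g'" by (intro d_invariant) (simp add: d.zero)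
  then have inv: "kap (b x) \<approx> b x"
    using cong_trans[OF cong_trans[OF cong_kap[OF cong_sym[OF dg']]] dg'] by blast
  have "\<iota> f \<approx> s (nat_inv k) (norm_op k (b x))"
    unfolding f_def \<iota>.scale k_def by (intro cong_scale \<iota>_cong_norm_b x)
  also have "\<dots> \<approx> b x" using False by (intro invariant_scale_norm inv) (simp add: k_def)
  also have "\<dots> \<approx> d g'" by (rule cong_sym[OF dg'])
  finally have "\<iota> f \<approx> d g'" .
  moreover have "g' - g \<in> K" using subspace_neg[OF sub_K b_K[OF y]] by (simp add: g'_def)
  moreover have "f \<in> V (m + 2)" unfolding f_def by (rule V_scale[OF x])
  ultimately show ?thesis using g' by blast
qed

text \<open>Modulo exact forms \<open>g\<close> is \<open>b x\<close>, so
  \<open>\<iota> f = d (b x)\<close>; this is killed by \<open>b\<close>, being a value of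
  \<open>\<iota>\<close>, hence invariant. As \<open>\<iota> d = - d \<iota>\<close>, the
  contraction of \<open>d x\<close> is \<open>- (m - 1)\<close> times it, which dictates
  \<open>h\<close>.\<close>

lemma S1_kernel:
  assumes f: "f \<in> V m" and g: "g \<in> V (m - 2)" and \<iota>f: "\<iota> f \<approx> d g"
    and z: "z \<in> V (m - 3)" and gK: "g - d z \<in> K"
  shows "\<exists>h\<in>V (m - 1). \<iota> (f - d h) \<approx> 0"
proof -
  have "g - d z \<in> V (m - 2)" using V_diff[OF g] d_V[OF z] by simp
  then obtain x y where x: "x \<in> V (m - 1)" and y: "y \<in> V (m - 2)"
    and "g - d z \<approx> b x + d (b y)"
    using K_E[OF _ gK, of "m - 2"] by auto
  then have "g \<approx> b x + d (b y) + d z"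
    using cong_add[OF _ cong_refl, of "g - d z" "b x + d (b y)" "d z"] by simp
  then have "d g \<approx> d (b x) + d (d (b y + z))" using cong_d by (force simp: hom_simps add.assoc)
  also have "\<dots> \<approx> d (b x) + 0" by (intro cong_add cong_refl dd_0)
  finally have \<iota>f': "\<iota> f \<approx> d (b x)" using cong_trans[OF \<iota>f] by simp
  show ?thesis
  proof (cases "m - 1 > 0")
    case False
    then have "b x = 0" using V_neg[OF _ b_V[OF x]] by simp
    then show ?thesis using \<iota>f' V_0 by (intro bexI[of _ 0]) (simp_all add: hom_simps)
  next
    case True
    define k h where "k = nat (m - 1)" and "h = - s (nat_inv k) x"
    have "b (d (b x)) \<approx> b (b (norm_op (nat m) f))"
      using cong_b[OF cong_sym[OF \<iota>f']] by (simp add: \<iota>_norm[OF f])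
    then have "b (d (b x)) \<approx> 0" using cong_trans bb_0 by blast
    then have "d (b (d (b x))) \<approx> 0" using cong_d[of "b (d (b x))" 0] by (simp add: d.zero)
    then have inv: "kap (d (b x)) \<approx> d (b x)" by (rule d_invariant)
    have h: "h \<in> V (m - 1)" unfolding h_def by (intro V_neg_closed V_scale x)
    have "- d (\<iota> h) = s (nat_inv k) (d (\<iota> x))" by (simp add: h_def hom_simps)
    also have "\<dots> \<approx> s (nat_inv k) (d (norm_op k (b x)))"
      unfolding k_def by (intro cong_scale cong_d \<iota>_cong_norm_b x)
    also have "\<dots> \<approx> s (nat_inv k) (norm_op k (d (b x)))" by (intro cong_scale d_norm)
    also have "\<dots> \<approx> d (b x)" using True by (intro invariant_scale_norm inv) (simp add: k_def)
    finally have "\<iota> (d h) \<approx> d (b x)" using cong_trans[OF \<iota>d[OF h]] by blast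
    then have "\<iota> (f - d h) \<approx> d (b x) - d (b x)" unfolding \<iota>.diff by (intro cong_diff \<iota>f')
    then show ?thesis using h by auto
  qed
qed

end

section \<open>Cyclic homology and the exact sequence\<close>

text \<open>The shape of \<open>cyc_d\<close> with the two operators as parameters, so that the
  chosen lifts and the explicit operators can be compared coefficient by coefficient.\<close>

definition total_d ::
  "('v \<Rightarrow> 'v) \<Rightarrow> ('v \<Rightarrow> 'v) \<Rightarrow> (nat \<Rightarrow>\<^sub>0 'v::ab_group_add) \<Rightarrow> (nat \<Rightarrow>\<^sub>0 'v)" where
  "total_d b B c = (\<Sum>k\<in>Poly_Mapping.keys c.
     Poly_Mapping.single k (b (Poly_Mapping.lookup c k)) -
     (if k = 0 then 0 else Poly_Mapping.single (k - 1) (B (Poly_Mapping.lookup c k))))"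

lemma lookup_total_d:
  fixes b B :: "'v::ab_group_add \<Rightarrow> 'v"
  assumes "b 0 = 0" "B 0 = 0"
  shows "Poly_Mapping.lookup (total_d b B c) j
    = b (Poly_Mapping.lookup c j) - B (Poly_Mapping.lookup c (Suc j))"
proof -
  have "Poly_Mapping.lookup (total_d b B c) j =
    (\<Sum>k\<in>Poly_Mapping.keys c. if k = j then b (Poly_Mapping.lookup c k) else 0) -
    (\<Sum>k\<in>Poly_Mapping.keys c. if k = Suc j then B (Poly_Mapping.lookup c k) else 0)"
    unfolding total_d_def lookup_sum sum_subtractf[symmetric]
    by (rule sum.cong) (auto simp: lookup_minus lookup_single when_def)
  also have "\<dots> = b (Poly_Mapping.lookup c j) - B (Poly_Mapping.lookup c (Suc j))"
    using assms by (auto simp: in_keys_iff)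
  finally show ?thesis .
qed

context mixed_forms
begin

section \<open>Homology of the abstract complexes\<close>

definition us :: "'k \<Rightarrow> (nat \<Rightarrow>\<^sub>0 'v) \<Rightarrow> (nat \<Rightarrow>\<^sub>0 'v)" where
  "us r = Poly_Mapping.map (s r)"

lemma lookup_us: "coef (us r c) k = s r (coef c k)"
  by (simp add: us_def map.rep_eq when_def)

definition uN :: "(nat \<Rightarrow>\<^sub>0 'v) set" where
  "uN = {c. \<forall>k. coef c k \<in> N}"

definition U :: "int \<Rightarrow> (nat \<Rightarrow>\<^sub>0 'v) set" where
  "U m = {c. \<forall>k. coef c k \<in> V (m - 2 * int k)}"

abbreviation D where "D \<equiv> total_d b B"

lemma lookup_D: "coef (D c) k
    = b (coef c k) - B (coef c (Suc k))"
  by (rule lookup_total_d) (simp_all add: b.zero B.zero)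

lemma module_us: "module us"
  by unfold_locales (auto intro!: poly_mapping_eqI simp: lookup_us lookup_add scale_right_distrib scale_left_distrib)

sublocale us: module us by (rule module_us)

lemma sub_uN: "us.subspace uN"
  using subspace_0[OF sub_N] subspace_add[OF sub_N] subspace_scale[OF sub_N]
  by (intro us.subspaceI) (auto simp: uN_def lookup_add lookup_us)

lemma sub_U: "us.subspace (U m)"
  using V_0 V_add V_scale
  by (intro us.subspaceI) (auto simp: U_def lookup_add lookup_us)

lemma hom_D: "module_hom us us D"
  by unfold_locales
    (auto intro!: poly_mapping_eqI simp: lookup_D lookup_add lookup_us hom_simps scale_right_diff_distrib)

lemma hom_lookup: "module_hom us s (\<lambda>c. coef c 0)"
  by unfold_locales (simp_all add: lookup_add lookup_us)

definition Kd :: "int \<Rightarrow> 'v set" where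
  "Kd m = K + d ` V (m - 1)"

definition HD_mod :: "int \<Rightarrow> ('k, 'v set) kmodule" where
  "HD_mod m = homology s d K (V m) (V (m - 1))"

definition HH_mod :: "int \<Rightarrow> ('k, 'v set) kmodule" where
  "HH_mod m = homology s b N (V m) (V (m + 1))"

definition HC_mod :: "int \<Rightarrow> ('k, (nat \<Rightarrow>\<^sub>0 'v) set) kmodule" where
  "HC_mod m = homology us D uN (U m) (U (m + 1))"

definition ker_K :: "int \<Rightarrow> ('k, 'v set) kmodule" where
  "ker_K m = subquot s {f \<in> V m. \<iota> f \<in> N} K"

definition ker_Kd :: "int \<Rightarrow> ('k, 'v set) kmodule" where
  "ker_Kd m = subquot s {f \<in> V m. \<iota> f \<in> N + d ` V (m - 2)} (Kd m)"

definition to_K :: "'v set \<Rightarrow> 'v set" where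
  "to_K C = C + K"

definition to_Kd :: "int \<Rightarrow> (nat \<Rightarrow>\<^sub>0 'v) set \<Rightarrow> 'v set" where
  "to_Kd m C = (\<lambda>c. coef c 0) ` C + Kd m"

definition ZD :: "int \<Rightarrow> 'v set" where
  "ZD m = {f \<in> V m. d f \<in> K}"

definition ZH :: "int \<Rightarrow> 'v set" where
  "ZH m = {f \<in> V m. b f \<approx> 0}"

definition NH :: "int \<Rightarrow> 'v set" where
  "NH m = N + b ` V (m + 1)"

definition NC :: "int \<Rightarrow> (nat \<Rightarrow>\<^sub>0 'v) set" where
  "NC m = uN + D ` U (m + 1)"

lemma HD_mod_eq: "HD_mod m = subquot s (ZD m) (Kd m)"
  by (simp add: HD_mod_def homology_def ZD_def Kd_def)

lemma HH_mod_eq: "HH_mod m = subquot s (ZH m) (NH m)"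
  by (simp add: HH_mod_def homology_def ZH_def NH_def cong_0_iff)

lemma HC_mod_eq: "HC_mod m = subquot us (cycles m) (NC m)"
proof -
  have "cycles m = {c \<in> U m. D c \<in> uN}"
    by (simp add: cycles_def U_def uN_def lookup_D cong_def)
  then show ?thesis by (simp add: HC_mod_def homology_def NC_def)
qed

lemma sub_Kd: "subspace (Kd m)"
  unfolding Kd_def by (intro subspace_set_plus module_axioms sub_K d.subspace_image sub_V)

lemma sub_NH: "subspace (NH m)"
  unfolding NH_def by (intro subspace_set_plus module_axioms sub_N b.subspace_image sub_V)

lemma sub_NC: "us.subspace (NC m)"
proof -
  interpret D: module_hom us us D by (rule hom_D)
  show ?thesis
    unfolding NC_def by (intro subspace_set_plus module_us sub_uN D.subspace_image sub_U)
qed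

lemma Kd_iff: "x \<in> Kd m \<longleftrightarrow> (\<exists>y\<in>V (m - 1). x - d y \<in> K)"
proof
  assume "\<exists>y\<in>V (m - 1). x - d y \<in> K"
  then obtain y where "y \<in> V (m - 1)" "x - d y \<in> K" by blast
  then have "(x - d y) + d y \<in> Kd m" unfolding Kd_def by (intro set_plus_intro imageI)
  then show "x \<in> Kd m" by simp
qed (force simp: Kd_def elim!: set_plus_elim)

lemma NH_iff: "x \<in> NH m \<longleftrightarrow> (\<exists>y\<in>V (m + 1). x \<approx> b y)"
proof
  assume "\<exists>y\<in>V (m + 1). x \<approx> b y"
  then obtain y where "y \<in> V (m + 1)" "x - b y \<in> N" by (auto simp: cong_def)
  then have "(x - b y) + b y \<in> NH m" unfolding NH_def by (intro set_plus_intro imageI)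
  then show "x \<in> NH m" by simp
qed (force simp: NH_def cong_def elim!: set_plus_elim)

lemma NC_iff: "c \<in> NC m \<longleftrightarrow> (\<exists>e. bounds m e c)"
proof
  assume "\<exists>e. bounds m e c"
  then obtain e where e: "bounds m e c" by blast
  then have "c - D e \<in> uN" by (simp add: uN_def bounds_def lookup_minus lookup_D cong_def)
  moreover have "e \<in> U (m + 1)" using e by (simp add: U_def bounds_def)
  ultimately have "(c - D e) + D e \<in> NC m" unfolding NC_def by (intro set_plus_intro imageI)
  then show "c \<in> NC m" by simp
next
  assume "c \<in> NC m"
  then obtain c' e where "c' \<in> uN" "e \<in> U (m + 1)" "c = c' + D e"
    unfolding NC_def by (auto elim!: set_plus_elim)
  then have "bounds m e c" by (simp add: bounds_def uN_def U_def lookup_add lookup_D cong_def)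
  then show "\<exists>e. bounds m e c" by blast
qed

lemma K_Kd: "x \<in> K \<Longrightarrow> x \<in> Kd m"
  unfolding Kd_iff by (intro bexI[of _ 0]) (simp_all add: d.zero V_0)

lemma cong_K: "x \<approx> y \<Longrightarrow> x - y \<in> K"
  using N_K by (auto simp: cong_def)

lemma NH_K: "NH m \<subseteq> K"
  using K_cong b_K by (auto simp: NH_iff)

lemma NC_Kd: "c \<in> NC m \<Longrightarrow> coef c 0 \<in> Kd m"
  unfolding NC_iff Kd_iff using bounds_K by blast

lemma sub_ZD: "subspace (ZD m)"
  using subspace_0[OF sub_K] subspace_add[OF sub_K] subspace_scale[OF sub_K] V_0 V_add V_scale
  by (intro subspaceI) (auto simp: ZD_def hom_simps)

lemma sub_ZH: "subspace (ZH m)"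
  using subspace_0[OF sub_N] subspace_add[OF sub_N] subspace_scale[OF sub_N] V_0 V_add V_scale
  by (intro subspaceI) (auto simp: ZH_def cong_0_iff hom_simps)

lemma sub_cycles: "us.subspace (cycles m)"
proof (rule us.subspaceI)
  show "0 \<in> cycles m" by (simp add: cycles_def hom_simps V_0)
next
  fix x y assume "x \<in> cycles m" "y \<in> cycles m"
  then show "x + y \<in> cycles m"
    by (auto simp: cycles_def lookup_add hom_simps intro: V_add cong_add)
next
  fix r x assume "x \<in> cycles m"
  then show "us r x \<in> cycles m"
    by (auto simp: cycles_def lookup_us hom_simps intro: V_scale cong_scale)
qed

lemma cycles_V: "c \<in> cycles m \<Longrightarrow> coef c 0 \<in> V m"
  by (auto simp: cycles_def dest: spec[of _ 0])

theorem to_K_iso: "to_K \<in> lin_iso (HH_mod m) (ker_K m)"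
proof -
  have "(\<lambda>C. (\<lambda>x. x) ` C + K) \<in> lin_iso (subquot s (ZH m) (NH m)) (subquot s {f \<in> V m. \<iota> f \<in> N} K)"
  proof (rule induced_lin_iso[OF module_axioms module_axioms _ sub_NH sub_K sub_ZH])
    show "module_hom s s (\<lambda>x. x)" by unfold_locales simp_all
    show "(\<lambda>x. x) ` ZH m \<subseteq> {f \<in> V m. \<iota> f \<in> N}"
      using \<iota>_cong_0_of_b by (auto simp: ZH_def cong_0_iff)
    show "(\<lambda>x. x) ` NH m \<subseteq> K" using NH_K by simp
    show "z \<in> NH m" if "z \<in> ZH m" "z \<in> K" for z
      using that HH_inj by (auto simp: ZH_def NH_iff)
    show "\<exists>z\<in>ZH m. z - z' \<in> K" if "z' \<in> {f \<in> V m. \<iota> f \<in> N}" for z'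
      using that HH_surj[of z' m] by (auto simp: ZH_def cong_0_iff)
  qed
  then show ?thesis by (simp add: HH_mod_eq ker_K_def to_K_def[abs_def])
qed

lemma HC_surj_Kd:
  assumes "f \<in> V m" "\<iota> f \<approx> d e" "e \<in> V (m - 2)"
  shows "\<exists>c\<in>cycles m. coef c 0 - f \<in> Kd m"
proof -
  obtain c y where c: "c \<in> cycles m" and y: "y \<in> V (m - 1)" "coef c 0 \<approx> f + d y"
    using HC_surj[OF assms] by blast
  have "coef c 0 - f - d y \<in> K" using cong_K[OF y(2)] by (simp add: algebra_simps)
  then show ?thesis using c y(1) Kd_iff by blast
qed

lemma \<iota>_Nd_iff: "\<iota> f \<in> N + d ` V m \<longleftrightarrow> (\<exists>e\<in>V m. \<iota> f \<approx> d e)"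
proof
  assume "\<exists>e\<in>V m. \<iota> f \<approx> d e"
  then obtain e where "e \<in> V m" "\<iota> f - d e \<in> N" by (auto simp: cong_def)
  then have "(\<iota> f - d e) + d e \<in> N + d ` V m" by (intro set_plus_intro imageI)
  then show "\<iota> f \<in> N + d ` V m" by simp
next
  assume "\<iota> f \<in> N + d ` V m"
  then obtain x e where "x \<in> N" "e \<in> V m" "\<iota> f = x + d e" by (auto elim!: set_plus_elim)
  then show "\<exists>e\<in>V m. \<iota> f \<approx> d e" by (intro bexI[of _ e]) (simp_all add: cong_def)
qed

theorem to_Kd_iso: "to_Kd m \<in> lin_iso (HC_mod m) (ker_Kd m)"
proof -
  have "(\<lambda>C. (\<lambda>c. coef c 0) ` C + Kd m)
      \<in> lin_iso (subquot us (cycles m) (NC m)) (subquot s {f \<in> V m. \<iota> f \<in> N + d ` V (m - 2)} (Kd m))"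
  proof (rule induced_lin_iso[OF module_us module_axioms hom_lookup sub_NC sub_Kd sub_cycles])
    show "(\<lambda>c. coef c 0) ` cycles m \<subseteq> {f \<in> V m. \<iota> f \<in> N + d ` V (m - 2)}"
      using cycles_V cycles_\<iota> by (auto simp: \<iota>_Nd_iff)
    show "(\<lambda>c. coef c 0) ` NC m \<subseteq> Kd m" using NC_Kd by blast
    show "c \<in> NC m" if "c \<in> cycles m" "coef c 0 \<in> Kd m" for c
      using that HC_inj unfolding NC_iff Kd_iff by blast
    show "\<exists>c\<in>cycles m. coef c 0 - f \<in> Kd m"
      if "f \<in> {f \<in> V m. \<iota> f \<in> N + d ` V (m - 2)}" for f
      using that HC_surj_Kd by (auto simp: \<iota>_Nd_iff)
  qed
  then show ?thesis by (simp add: HC_mod_eq ker_Kd_def to_Kd_def[abs_def])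
qed

lemma to_K_coset: "to_K (f +o NH m) = f +o K"
  using elt_set_plus_plus_subspace[OF module_axioms sub_K NH_K subspace_0[OF sub_NH]]
  by (simp add: to_K_def)

lemma to_Kd_coset: "to_Kd m (c +o NC m) = coef c 0 +o Kd m"
  unfolding to_Kd_def
  by (rule induced_lin_hom(1)[OF module_us module_axioms hom_lookup sub_NC sub_Kd
        order_refl]) (use NC_Kd in blast)

text \<open>\<open>f\<close> itself need not extend to a cycle, so it is paired with every cycle
  whose leading coefficient agrees with it modulo commutators and exact forms.\<close>

definition S\<^sub>2_rel :: "int \<Rightarrow> ('v \<times> (nat \<Rightarrow>\<^sub>0 'v)) set" where
  "S\<^sub>2_rel n = {(f, c). f \<in> ZD n \<and> c \<in> cycles n \<and> coef c 0 - f \<in> Kd n}"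

text \<open>\<open>d\<close> of the leading coefficient need not be a \<open>b\<close>-cycle;
  \<open>f'\<close> is any \<open>b\<close>-cycle in its Karoubi-de Rham class.\<close>

definition B_rel :: "int \<Rightarrow> ((nat \<Rightarrow>\<^sub>0 'v) \<times> 'v) set" where
  "B_rel n = {(c, f'). c \<in> cycles n \<and> f' \<in> ZH (n + 1) \<and> f' - d (coef c 0) \<in> K}"

definition I_rel :: "int \<Rightarrow> ('v \<times> (nat \<Rightarrow>\<^sub>0 'v)) set" where
  "I_rel n = {(f, c). f \<in> ZH n \<and> c \<in> cycles n \<and> coef c 0 - f \<in> Kd n}"

text \<open>\<open>g\<close> is any primitive of the contraction, so it represents the value of the
  inverse of \<open>d\<close>. The degree falls by two: the exact sequence uses this relation at
  \<open>n + 1\<close> to reach degree \<open>n - 1\<close>.\<close>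

definition S\<^sub>1_rel :: "int \<Rightarrow> ((nat \<Rightarrow>\<^sub>0 'v) \<times> 'v) set" where
  "S\<^sub>1_rel n = {(c, g). c \<in> cycles n \<and> g \<in> ZD (n - 2) \<and> \<iota> (coef c 0) \<approx> d g}"

section \<open>The contraction on commutators and modulo exact forms\<close>

lemma d_Kd_K: assumes "x \<in> V m" "x \<in> Kd m" shows "d x \<in> K"
proof -
  obtain y where y: "y \<in> V (m - 1)" "x - d y \<in> K" using assms(2) Kd_iff by blast
  have "x - d y \<in> V m" using V_diff[OF assms(1)] d_V[OF y(1)] by simp
  then have "d (x - d y) \<in> K" using y(2) by (rule d_K)
  moreover have "d (d y) \<in> K" using N_K dd by blast
  ultimately show ?thesis using subspace_add[OF sub_K, of "d x - d (d y)" "d (d y)"]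
    by (simp add: hom_simps)
qed

lemma cong_neg: "x \<approx> y \<Longrightarrow> - x \<approx> - y"
  using cong_diff[OF cong_refl, of x y 0] by simp

text \<open>Values of the contraction are sums of commutators, so a primitive \<open>g\<close> is
  closed in the Karoubi-de Rham quotient.\<close>

lemma ZD_of_\<iota>:
  assumes "x \<in> V m" "\<iota> x \<approx> d g" "g \<in> V (m - 2)"
  shows "g \<in> ZD (m - 2)"
  using assms K_cong[OF cong_sym[OF assms(2)] \<iota>_K[OF assms(1)]] by (simp add: ZD_def)

text \<open>On \<open>b y\<close> the contraction is the norm of \<open>b (b y)\<close>; on
  \<open>d (b z)\<close> anticommutation with \<open>d\<close> reduces to the same.\<close>

lemma \<iota>_of_K:
  assumes x: "x \<in> V m" "x \<in> K"
  shows "\<iota> x \<approx> 0"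
proof -
  obtain y z where yz: "y \<in> V (m + 1)" "z \<in> V m" "x \<approx> b y + d (b z)" using K_E[OF x] .
  have "\<iota> x \<approx> \<iota> (b y) + \<iota> (d (b z))" using cong_\<iota>[OF yz(3)] by (simp add: \<iota>.add)
  also have "\<dots> \<approx> 0 + - d (\<iota> (b z))"
    using yz by (intro cong_add \<iota>d[OF b_V[OF yz(2)]] \<iota>_cong_0_of_b[OF b_V bb_0])
  also have "0 + - d (\<iota> (b z)) \<approx> 0 + - d 0"
    by (intro cong_add cong_refl cong_neg cong_d \<iota>_cong_0_of_b[OF b_V[OF yz(2)] bb_0])
  finally show ?thesis by (simp add: d.zero)
qed

lemma \<iota>_exact:
  assumes x: "x \<in> V m" and "\<iota> (d x) \<approx> 0"
  shows "\<exists>e\<in>V (m - 2). \<iota> x \<approx> d e"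
proof -
  have "- d (\<iota> x) \<approx> 0" using cong_trans[OF cong_sym[OF \<iota>d[OF x]] assms(2)] .
  then have "d (\<iota> x) \<in> N" using cong_neg[of "- d (\<iota> x)" 0] by (simp add: cong_0_iff)
  then show ?thesis using d_exact[OF \<iota>_V[OF x]] by (auto simp: cong_def)
qed

text \<open>Two preimages of \<open>\<iota> f\<close> under \<open>d\<close> differ by an exact form, and \<open>\<iota> d h = - d \<iota> h\<close> with \<open>\<iota> h\<close> a sum
  of commutators.\<close>

lemma \<iota>_Kd:
  assumes x: "x \<in> V m" "x \<in> Kd m" and \<iota>x: "\<iota> x \<approx> d g" and g: "g \<in> V (m - 2)"
  shows "g \<in> Kd (m - 2)"
proof -
  obtain h where h: "h \<in> V (m - 1)" "x - d h \<in> K" using x(2) Kd_iff by blast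
  have "x - d h \<in> V m" using V_diff[OF x(1)] d_V[OF h(1)] by simp
  then have "\<iota> (x - d h) \<approx> 0" using h(2) by (rule \<iota>_of_K)
  then have "d g - - d (\<iota> h) \<approx> 0"
    using cong_trans[OF cong_diff[OF cong_sym[OF \<iota>x] cong_sym[OF \<iota>d[OF h(1)]]]]
    by (simp add: \<iota>.diff)
  then have "d (g + \<iota> h) \<in> N" by (simp add: hom_simps cong_0_iff)
  moreover have \<iota>h: "\<iota> h \<in> V (m - 2)" using \<iota>_V[OF h(1)] by simp
  ultimately obtain w where w: "w \<in> V (m - 3)" "g + \<iota> h \<approx> d w"
    using d_exact[OF V_add[OF g]] by (auto simp: cong_def)
  have "g - d w \<approx> - \<iota> h"
    using cong_diff[OF w(2) cong_refl, of "d w + \<iota> h"] by (simp add: algebra_simps)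
  then have "g - d w \<in> K" using K_cong subspace_neg[OF sub_K \<iota>_K[OF h(1)]] by blast
  then show ?thesis using w(1) by (auto simp: Kd_iff)
qed

lemma S\<^sub>2_rel_sub: "S\<^sub>2_rel n \<subseteq> ZD n \<times> cycles n"
  and B_rel_sub: "B_rel n \<subseteq> cycles n \<times> ZH (n + 1)"
  and I_rel_sub: "I_rel n \<subseteq> ZH n \<times> cycles n"
  and S\<^sub>1_rel_sub: "S\<^sub>1_rel n \<subseteq> cycles n \<times> ZD (n - 2)"
  by (auto simp: S\<^sub>2_rel_def B_rel_def I_rel_def S\<^sub>1_rel_def)

text \<open>Closedness of \<open>f\<close> modulo commutators gives
  \<open>\<iota> (d f) = 0\<close>, so \<open>\<iota> f\<close> is exact, which is the condition for
  lifting \<open>f\<close> to a cycle.\<close>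

lemma S\<^sub>2_rel_total:
  assumes "f \<in> ZD n"
  shows "\<exists>c. (f, c) \<in> S\<^sub>2_rel n"
proof -
  have f: "f \<in> V n" "d f \<in> K" using assms by (auto simp: ZD_def)
  then obtain e where "e \<in> V (n - 2)" "\<iota> f \<approx> d e"
    using \<iota>_exact[OF f(1) \<iota>_of_K[OF d_V[OF f(1)] f(2)]] by blast
  then show ?thesis using HC_surj_Kd[OF f(1)] assms by (auto simp: S\<^sub>2_rel_def)
qed

lemma B_rel_total:
  assumes c: "c \<in> cycles n"
  shows "\<exists>f'. (c, f') \<in> B_rel n"
proof -
  obtain e where "\<iota> (coef c 0) \<approx> d e" using cycles_\<iota>[OF c] by blast
  then have "- d (\<iota> (coef c 0)) \<approx> - d (d e)" by (intro cong_neg cong_d)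
  also have "\<dots> \<approx> - 0" by (intro cong_neg dd_0)
  finally have "\<iota> (d (coef c 0)) \<approx> 0"
    using cong_trans[OF \<iota>d[OF cycles_V[OF c]]] by simp
  then show ?thesis
    using HH_surj[OF d_V[OF cycles_V[OF c]]] c by (auto simp: B_rel_def ZH_def)
qed

lemma I_rel_total:
  assumes f: "f \<in> ZH n"
  shows "\<exists>c. (f, c) \<in> I_rel n"
proof -
  have "f \<in> V n" "\<iota> f \<approx> d 0" using f \<iota>_cong_0_of_b by (auto simp: ZH_def d.zero)
  then show ?thesis using HC_surj_Kd[of f n 0] V_0 f by (auto simp: I_rel_def)
qed

lemma S\<^sub>1_rel_total:
  assumes c: "c \<in> cycles n"
  shows "\<exists>g. (c, g) \<in> S\<^sub>1_rel n"
  using cycles_\<iota>[OF c] ZD_of_\<iota>[OF cycles_V[OF c]] c by (auto simp: S\<^sub>1_rel_def)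

text \<open>Well-definedness is injectivity of the identification: a cycle with leading coefficient
  in \<open>Kd n\<close> is a boundary.\<close>

lemma S\<^sub>2_hom: "\<exists>h. h \<in> lin_hom (HD_mod n) (HC_mod n) \<and>
    (\<forall>f c. (f, c) \<in> S\<^sub>2_rel n \<longrightarrow> h (f +o Kd n) = c +o NC n)"
  unfolding HD_mod_eq HC_mod_eq
proof (rule relation_lin_hom[OF module_axioms module_us sub_ZD sub_Kd sub_NC S\<^sub>2_rel_sub S\<^sub>2_rel_total])
  fix f f' c c' r
  assume R: "(f, c) \<in> S\<^sub>2_rel n"
  show "(s r f, us r c) \<in> S\<^sub>2_rel n"
    using R subspace_scale[OF sub_Kd, of "coef c 0 - f" n r]
      subspace_scale[OF sub_ZD] us.subspace_scale[OF sub_cycles]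
    by (auto simp: S\<^sub>2_rel_def lookup_us scale_right_diff_distrib)
  show "c \<in> NC n" if "f \<in> Kd n"
    using R subspace_add[OF sub_Kd _ that, of "coef c 0 - f"] HC_inj
    by (auto simp: S\<^sub>2_rel_def NC_iff Kd_iff)
  show "(f + f', c + c') \<in> S\<^sub>2_rel n" if "(f', c') \<in> S\<^sub>2_rel n"
    using R that subspace_add[OF sub_Kd, of "coef c 0 - f" n "coef c' 0 - f'"]
      subspace_add[OF sub_ZD] us.subspace_add[OF sub_cycles]
    by (auto simp: S\<^sub>2_rel_def lookup_add algebra_simps)
qed

lemma B_hom: "\<exists>h. h \<in> lin_hom (HC_mod n) (HH_mod (n + 1)) \<and>
    (\<forall>c f. (c, f) \<in> B_rel n \<longrightarrow> h (c +o NC n) = f +o NH (n + 1))"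
  unfolding HH_mod_eq HC_mod_eq
proof (rule relation_lin_hom[OF module_us module_axioms sub_cycles sub_NC sub_NH B_rel_sub B_rel_total])
  fix f f' c c' r
  assume R: "(c, f) \<in> B_rel n"
  show "(us r c, s r f) \<in> B_rel n"
    using R subspace_scale[OF sub_K, of "f - d (coef c 0)" r]
      subspace_scale[OF sub_ZH] us.subspace_scale[OF sub_cycles]
    by (auto simp: B_rel_def lookup_us scale_right_diff_distrib hom_simps)
  show "f \<in> NH (n + 1)" if "c \<in> NC n"
  proof -
    have "f \<in> K"
      using subspace_add[OF sub_K, of "f - d (coef c 0)" "d (coef c 0)"]
        R d_Kd_K[OF cycles_V NC_Kd[OF that]] by (auto simp: B_rel_def)
    then show ?thesis using R HH_inj[of f "n + 1"] by (auto simp: B_rel_def ZH_def NH_iff)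
  qed
  show "(c + c', f + f') \<in> B_rel n" if "(c', f') \<in> B_rel n"
    using R that subspace_add[OF sub_K, of "f - d (coef c 0)" "f' - d (coef c' 0)"]
      subspace_add[OF sub_ZH] us.subspace_add[OF sub_cycles]
    by (auto simp: B_rel_def lookup_add algebra_simps hom_simps)
qed

lemma I_hom: "\<exists>h. h \<in> lin_hom (HH_mod n) (HC_mod n) \<and>
    (\<forall>f c. (f, c) \<in> I_rel n \<longrightarrow> h (f +o NH n) = c +o NC n)"
  unfolding HH_mod_eq HC_mod_eq
proof (rule relation_lin_hom[OF module_axioms module_us sub_ZH sub_NH sub_NC I_rel_sub I_rel_total])
  fix f f' c c' r
  assume R: "(f, c) \<in> I_rel n"
  show "(s r f, us r c) \<in> I_rel n"
    using R subspace_scale[OF sub_Kd, of "coef c 0 - f" n r]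
      subspace_scale[OF sub_ZH] us.subspace_scale[OF sub_cycles]
    by (auto simp: I_rel_def lookup_us scale_right_diff_distrib)
  show "c \<in> NC n" if "f \<in> NH n"
  proof -
    have "f \<in> Kd n" using that NH_K K_Kd by blast
    then show ?thesis
      using R subspace_add[OF sub_Kd, of "coef c 0 - f" n f] HC_inj
      by (auto simp: I_rel_def NC_iff Kd_iff)
  qed
  show "(f + f', c + c') \<in> I_rel n" if "(f', c') \<in> I_rel n"
    using R that subspace_add[OF sub_Kd, of "coef c 0 - f" n "coef c' 0 - f'"]
      subspace_add[OF sub_ZH] us.subspace_add[OF sub_cycles]
    by (auto simp: I_rel_def lookup_add algebra_simps)
qed

lemma S\<^sub>1_hom: "\<exists>h. h \<in> lin_hom (HC_mod n) (HD_mod (n - 2)) \<and>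
    (\<forall>c g. (c, g) \<in> S\<^sub>1_rel n \<longrightarrow> h (c +o NC n) = g +o Kd (n - 2))"
  unfolding HD_mod_eq HC_mod_eq
proof (rule relation_lin_hom[OF module_us module_axioms sub_cycles sub_NC sub_Kd S\<^sub>1_rel_sub S\<^sub>1_rel_total])
  fix g g' c c' r
  assume R: "(c, g) \<in> S\<^sub>1_rel n"
  show "(us r c, s r g) \<in> S\<^sub>1_rel n"
    using R cong_scale subspace_scale[OF sub_ZD] us.subspace_scale[OF sub_cycles]
    by (auto simp: S\<^sub>1_rel_def lookup_us hom_simps)
  show "g \<in> Kd (n - 2)" if "c \<in> NC n"
    using R \<iota>_Kd[OF cycles_V NC_Kd[OF that]] by (auto simp: S\<^sub>1_rel_def ZD_def)
  show "(c + c', g + g') \<in> S\<^sub>1_rel n" if "(c', g') \<in> S\<^sub>1_rel n"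
    using R that cong_add subspace_add[OF sub_ZD] us.subspace_add[OF sub_cycles]
    by (auto simp: S\<^sub>1_rel_def lookup_add hom_simps)
qed

section \<open>Exactness on representatives\<close>

lemma Kd_diff_iff: "x - y \<in> Kd m \<Longrightarrow> x \<in> Kd m \<longleftrightarrow> y \<in> Kd m"
  using subspace_add[OF sub_Kd, of "x - y" m y] subspace_diff[OF sub_Kd, of x m "x - y"] by auto

lemma K_diff_iff: "x - y \<in> K \<Longrightarrow> x \<in> K \<longleftrightarrow> y \<in> K"
  using subspace_add[OF sub_K, of "x - y" y] subspace_diff[OF sub_K, of x "x - y"] by auto

text \<open>If \<open>f\<close> represents zero, then \<open>d\<close> of the leading coefficient of
  \<open>c\<close> lies in \<open>K\<close>, so that coefficient itself defines a preimage.
  Conversely \<open>0\<close> is an admissible value of \<open>B_rel\<close>, because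
  \<open>d\<close> maps forms in \<open>Kd n\<close> into \<open>K\<close>.\<close>

lemma S\<^sub>2_B_exact:
  shows "(c, f) \<in> B_rel n \<Longrightarrow> f \<in> NH (n + 1) \<Longrightarrow> \<exists>x c'. (x, c') \<in> S\<^sub>2_rel n \<and> c' - c \<in> NC n"
    and "(x, c) \<in> S\<^sub>2_rel n \<Longrightarrow> \<exists>f\<in>NH (n + 1). (c, f) \<in> B_rel n"
proof -
  assume R: "(c, f) \<in> B_rel n" and "f \<in> NH (n + 1)"
  then have "f \<in> K" "f - d (coef c 0) \<in> K" using NH_K by (auto simp: B_rel_def)
  then have "d (coef c 0) \<in> K" using K_diff_iff by blast
  then have "(coef c 0, c) \<in> S\<^sub>2_rel n"
    using R cycles_V subspace_0[OF sub_Kd] by (auto simp: S\<^sub>2_rel_def B_rel_def ZD_def)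
  then show "\<exists>x c'. (x, c') \<in> S\<^sub>2_rel n \<and> c' - c \<in> NC n"
    using us.subspace_0[OF sub_NC] by force
next
  assume R: "(x, c) \<in> S\<^sub>2_rel n"
  then have "d (coef c 0 - x) \<in> K"
    using d_Kd_K[OF V_diff[OF cycles_V[of c n]]] by (auto simp: S\<^sub>2_rel_def ZD_def)
  then have "d (coef c 0) \<in> K"
    using R K_diff_iff by (auto simp: S\<^sub>2_rel_def ZD_def d.diff)
  then have "(c, 0) \<in> B_rel n"
    using R subspace_0[OF sub_ZH] subspace_neg[OF sub_K] by (auto simp: S\<^sub>2_rel_def B_rel_def)
  then show "\<exists>f\<in>NH (n + 1). (c, f) \<in> B_rel n" using subspace_0[OF sub_NH] by blast
qed

text \<open>If \<open>f - d g\<close> is in \<open>K\<close>, then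
  \<open>\<iota> (d g) = \<iota> f = 0\<close>, so \<open>\<iota> g\<close> is exact and
  \<open>g\<close> extends to a cycle up to \<open>Kd n\<close>; this cycle is sent to the class of
  \<open>f\<close>.\<close>

lemma B_I_exact:
  shows "(f, c) \<in> I_rel (n + 1) \<Longrightarrow> c \<in> NC (n + 1) \<Longrightarrow>
      \<exists>x f'. (x, f') \<in> B_rel n \<and> f' - f \<in> NH (n + 1)"
    and "(x, f) \<in> B_rel n \<Longrightarrow> \<exists>c\<in>NC (n + 1). (f, c) \<in> I_rel (n + 1)"
proof -
  assume R: "(f, c) \<in> I_rel (n + 1)" and "c \<in> NC (n + 1)"
  then have f: "f \<in> ZH (n + 1)" and "f \<in> Kd (n + 1)"
    using NC_Kd[of c "n + 1"] Kd_diff_iff[of "coef c 0" f "n + 1"]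
    by (auto simp: I_rel_def)
  then obtain g where g: "g \<in> V n" and fg: "f - d g \<in> K" using Kd_iff by fastforce
  have fV: "f \<in> V (n + 1)" "\<iota> f \<approx> 0" using f \<iota>_cong_0_of_b by (auto simp: ZH_def)
  have "\<iota> f - \<iota> (f - d g) \<approx> 0 - 0"
    by (rule cong_diff[OF fV(2) \<iota>_of_K[OF V_diff[OF fV(1) d_V[OF g]] fg]])
  then have "\<iota> (d g) \<approx> 0" by (simp add: \<iota>.diff)
  then obtain e where "e \<in> V (n - 2)" "\<iota> g \<approx> d e" using \<iota>_exact[OF g] by blast
  then obtain x where x: "x \<in> cycles n" "coef x 0 - g \<in> Kd n"
    using HC_surj_Kd[OF g] by blast
  then have "d (coef x 0 - g) \<in> K" using d_Kd_K V_diff[OF cycles_V g] by blast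
  then have "f - d (coef x 0) \<in> K"
    using subspace_diff[OF sub_K fg, of "d (coef x 0 - g)"]
    by (simp add: d.diff algebra_simps)
  then have "(x, f) \<in> B_rel n" using x f by (simp add: B_rel_def)
  then show "\<exists>x f'. (x, f') \<in> B_rel n \<and> f' - f \<in> NH (n + 1)" using subspace_0[OF sub_NH] by force
next
  assume R: "(x, f) \<in> B_rel n"
  then have "f \<in> Kd (n + 1)" using Kd_iff cycles_V by (force simp: B_rel_def)
  then have "(f, 0) \<in> I_rel (n + 1)"
    using R us.subspace_0[OF sub_cycles] subspace_neg[OF sub_Kd] by (auto simp: B_rel_def I_rel_def)
  then show "\<exists>c\<in>NC (n + 1). (f, c) \<in> I_rel (n + 1)" using us.subspace_0[OF sub_NC] by blast
qed

text \<open>Compares the value at a cycle with a primitive computed from any other representative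
  \<open>f\<close>. It serves for the formula of \<open>S\<^sub>1\<close>, for its surjectivity and
  for its vanishing on the image of \<open>I\<close>.\<close>

lemma S\<^sub>1_rel_diff:
  assumes "(c, g) \<in> S\<^sub>1_rel n" "f \<in> V n" "coef c 0 - f \<in> Kd n"
    "\<iota> f \<approx> d g'" "g' \<in> V (n - 2)"
  shows "g - g' \<in> Kd (n - 2)"
proof (rule \<iota>_Kd[OF _ assms(3)])
  have c: "c \<in> cycles n" "g \<in> V (n - 2)" "\<iota> (coef c 0) \<approx> d g"
    using assms(1) by (auto simp: S\<^sub>1_rel_def ZD_def)
  show "coef c 0 - f \<in> V n" by (rule V_diff[OF cycles_V[OF c(1)] assms(2)])
  show "g - g' \<in> V (n - 2)" by (rule V_diff[OF c(2) assms(5)])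
  show "\<iota> (coef c 0 - f) \<approx> d (g - g')"
    unfolding \<iota>.diff d.diff by (rule cong_diff[OF c(3) assms(4)])
qed

text \<open>Changing the leading coefficient by an exact form makes its contraction vanish, and a
  further change by commutators makes it a \<open>b\<close>-cycle. Conversely \<open>\<iota>\<close>
  vanishes on \<open>b\<close>-cycles, so \<open>0\<close> is a primitive.\<close>

lemma I_S\<^sub>1_exact:
  shows "(c, g) \<in> S\<^sub>1_rel n \<Longrightarrow> g \<in> Kd (n - 2) \<Longrightarrow> \<exists>f c'. (f, c') \<in> I_rel n \<and> c' - c \<in> NC n"
    and "(f, c) \<in> I_rel n \<Longrightarrow> \<exists>g\<in>Kd (n - 2). (c, g) \<in> S\<^sub>1_rel n"
proof -
  assume R: "(c, g) \<in> S\<^sub>1_rel n" and g: "g \<in> Kd (n - 2)"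
  then have c: "c \<in> cycles n" "g \<in> V (n - 2)" "\<iota> (coef c 0) \<approx> d g"
    by (auto simp: S\<^sub>1_rel_def ZD_def)
  obtain z where "z \<in> V (n - 3)" "g - d z \<in> K" using g Kd_iff[of g "n - 2"] by auto
  then obtain h where h: "h \<in> V (n - 1)" "\<iota> (coef c 0 - d h) \<approx> 0"
    using S1_kernel[OF cycles_V[OF c(1)] c(2,3)] by blast
  have "coef c 0 - d h \<in> V n"
    using V_diff[OF cycles_V[OF c(1)], of "d h"] d_V[OF h(1)] by simp
  then obtain f where f: "f \<in> ZH n" "f - (coef c 0 - d h) \<in> K"
    using HH_surj h(2) by (auto simp: ZH_def)
  have "coef c 0 - f \<in> Kd n"
    using h(1) subspace_neg[OF sub_K f(2)] unfolding Kd_iff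
    by (intro bexI[of _ h]) (simp_all add: algebra_simps)
  then have "(f, c) \<in> I_rel n" using f c by (simp add: I_rel_def)
  then show "\<exists>f c'. (f, c') \<in> I_rel n \<and> c' - c \<in> NC n" using us.subspace_0[OF sub_NC] by force
next
  assume R: "(f, c) \<in> I_rel n"
  then obtain g where g: "(c, g) \<in> S\<^sub>1_rel n" using S\<^sub>1_rel_total by (auto simp: I_rel_def)
  have "f \<in> V n" "\<iota> f \<approx> d 0" using R \<iota>_cong_0_of_b by (auto simp: I_rel_def ZH_def d.zero)
  then have "g - 0 \<in> Kd (n - 2)" using R V_0 by (intro S\<^sub>1_rel_diff[OF g]) (auto simp: I_rel_def)
  then show "\<exists>g\<in>Kd (n - 2). (c, g) \<in> S\<^sub>1_rel n" using g by auto
qed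

theorem exact_sequence:
  "\<exists>S\<^sub>2 B' I S\<^sub>1.
    S\<^sub>2 \<in> lin_hom (HD_mod n) (HC_mod n) \<and>
    B' \<in> lin_hom (HC_mod n) (HH_mod (n + 1)) \<and>
    I \<in> lin_hom (HH_mod (n + 1)) (HC_mod (n + 1)) \<and>
    S\<^sub>1 \<in> lin_hom (HC_mod (n + 1)) (HD_mod (n - 1)) \<and>
    (\<forall>f\<in>V n. d f \<in> K \<longrightarrow> to_Kd n (S\<^sub>2 (f +o Kd n)) = f +o Kd n) \<and>
    (\<forall>x\<in>carrier (HC_mod n). \<forall>f\<in>V n.
       to_Kd n x = f +o Kd n \<longrightarrow> to_K (B' x) = d f +o K) \<and>
    (\<forall>x\<in>carrier (HH_mod (n + 1)). \<forall>f\<in>V (n + 1).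
       to_K x = f +o K \<longrightarrow> to_Kd (n + 1) (I x) = f +o Kd (n + 1)) \<and>
    (\<forall>x\<in>carrier (HC_mod (n + 1)). \<forall>f\<in>V (n + 1). \<forall>g\<in>V (n - 1).
       to_Kd (n + 1) x = f +o Kd (n + 1) \<and> \<iota> f - d g \<in> N \<longrightarrow> S\<^sub>1 x = g +o Kd (n - 1)) \<and>
    inj_on S\<^sub>2 (carrier (HD_mod n)) \<and>
    kernel (HC_mod n) (HH_mod (n + 1)) B' = S\<^sub>2 ` carrier (HD_mod n) \<and>
    kernel (HH_mod (n + 1)) (HC_mod (n + 1)) I = B' ` carrier (HC_mod n) \<and>
    kernel (HC_mod (n + 1)) (HD_mod (n - 1)) S\<^sub>1 = I ` carrier (HH_mod (n + 1)) \<and>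
    S\<^sub>1 ` carrier (HC_mod (n + 1)) = carrier (HD_mod (n - 1))"
proof -
  obtain S\<^sub>2 where S\<^sub>2: "S\<^sub>2 \<in> lin_hom (HD_mod n) (HC_mod n)"
    and S\<^sub>2_eq: "\<And>f c. (f, c) \<in> S\<^sub>2_rel n \<Longrightarrow> S\<^sub>2 (f +o Kd n) = c +o NC n"
    using S\<^sub>2_hom by blast
  obtain B' where B': "B' \<in> lin_hom (HC_mod n) (HH_mod (n + 1))"
    and B'_eq: "\<And>c f. (c, f) \<in> B_rel n \<Longrightarrow> B' (c +o NC n) = f +o NH (n + 1)"
    using B_hom by blast
  obtain I where I: "I \<in> lin_hom (HH_mod (n + 1)) (HC_mod (n + 1))"
    and I_eq: "\<And>f c. (f, c) \<in> I_rel (n + 1) \<Longrightarrow> I (f +o NH (n + 1)) = c +o NC (n + 1)"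
    using I_hom by blast
  have n: "n + 1 - 2 = n - 1" by simp
  obtain S\<^sub>1 where S\<^sub>1: "S\<^sub>1 \<in> lin_hom (HC_mod (n + 1)) (HD_mod (n - 1))"
    and S\<^sub>1_eq: "\<And>c g. (c, g) \<in> S\<^sub>1_rel (n + 1) \<Longrightarrow> S\<^sub>1 (c +o NC (n + 1)) = g +o Kd (n - 1)"
    using S\<^sub>1_hom[of "n + 1"] unfolding n by blast
  have Kd_eq: "x +o Kd m = y +o Kd m \<longleftrightarrow> x - y \<in> Kd m" for x y m
    by (rule elt_set_plus_eq_iff[OF module_axioms sub_Kd])
  have K_eq: "x +o K = y +o K \<longleftrightarrow> x - y \<in> K" for x y
    by (rule elt_set_plus_eq_iff[OF module_axioms sub_K])
  have NC_eq: "x +o NC m = y +o NC m \<longleftrightarrow> x - y \<in> NC m" for x y m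
    by (rule elt_set_plus_eq_iff[OF module_us sub_NC])
  have f1: "to_Kd n (S\<^sub>2 (f +o Kd n)) = f +o Kd n" if f: "f \<in> V n" "d f \<in> K" for f
  proof -
    obtain c where c: "(f, c) \<in> S\<^sub>2_rel n" using S\<^sub>2_rel_total[of f n] f by (auto simp: ZD_def)
    then show ?thesis by (simp add: S\<^sub>2_eq to_Kd_coset Kd_eq) (simp add: S\<^sub>2_rel_def)
  qed
  have f2: "to_K (B' x) = d f +o K"
    if x: "x \<in> carrier (HC_mod n)" and f: "f \<in> V n" and xf: "to_Kd n x = f +o Kd n" for x f
  proof -
    obtain c where c: "c \<in> cycles n" "x = c +o NC n" using x by (auto simp: HC_mod_eq)
    obtain f' where f': "(c, f') \<in> B_rel n" using B_rel_total c by blast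
    have "coef c 0 - f \<in> Kd n" using xf c by (simp add: to_Kd_coset Kd_eq)
    then have "d (coef c 0 - f) \<in> K"
      by (rule d_Kd_K[OF V_diff[OF cycles_V[OF c(1)] f]])
    then have "f' - d f \<in> K"
      using f' subspace_add[OF sub_K, of "f' - d (coef c 0)" "d (coef c 0 - f)"]
      by (simp add: B_rel_def d.diff)
    then show ?thesis by (simp add: c B'_eq[OF f'] to_K_coset K_eq)
  qed
  have f3: "to_Kd (n + 1) (I x) = f +o Kd (n + 1)"
    if x: "x \<in> carrier (HH_mod (n + 1))" and f: "f \<in> V (n + 1)" and xf: "to_K x = f +o K" for x f
  proof -
    obtain z where z: "z \<in> ZH (n + 1)" "x = z +o NH (n + 1)" using x by (auto simp: HH_mod_eq)
    obtain c where c: "(z, c) \<in> I_rel (n + 1)" using I_rel_total z by blast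
    have "z - f \<in> Kd (n + 1)" using xf z by (simp add: to_K_coset K_eq K_Kd)
    then have "coef c 0 - f \<in> Kd (n + 1)"
      using c subspace_add[OF sub_Kd, of "coef c 0 - z" "n + 1" "z - f"]
      by (simp add: I_rel_def)
    then show ?thesis by (simp add: z I_eq[OF c] to_Kd_coset Kd_eq)
  qed
  have f4: "S\<^sub>1 x = g +o Kd (n - 1)"
    if x: "x \<in> carrier (HC_mod (n + 1))" and f: "f \<in> V (n + 1)" and g: "g \<in> V (n - 1)"
      and xf: "to_Kd (n + 1) x = f +o Kd (n + 1) \<and> \<iota> f - d g \<in> N" for x f g
  proof -
    obtain c where c: "c \<in> cycles (n + 1)" "x = c +o NC (n + 1)" using x by (auto simp: HC_mod_eq)
    obtain g' where g': "(c, g') \<in> S\<^sub>1_rel (n + 1)" using S\<^sub>1_rel_total c by blast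
    have "coef c 0 - f \<in> Kd (n + 1)" using xf c by (simp add: to_Kd_coset Kd_eq)
    then have "g' - g \<in> Kd (n - 1)" using S\<^sub>1_rel_diff[OF g' f] xf g by (simp add: cong_def)
    then show ?thesis by (simp add: c S\<^sub>1_eq[OF g'] Kd_eq)
  qed
  have f5: "inj_on S\<^sub>2 (carrier (HD_mod n))"
  proof (rule inj_onI, clarsimp simp: HD_mod_eq)
    fix x y assume "x \<in> ZD n" "y \<in> ZD n" and eq: "S\<^sub>2 (x +o Kd n) = S\<^sub>2 (y +o Kd n)"
    then obtain c c' where c: "(x, c) \<in> S\<^sub>2_rel n" "(y, c') \<in> S\<^sub>2_rel n" using S\<^sub>2_rel_total by blast
    have "c - c' \<in> NC n" using eq by (simp add: S\<^sub>2_eq[OF c(1)] S\<^sub>2_eq[OF c(2)] NC_eq)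
    then have "coef c 0 - coef c' 0 \<in> Kd n"
      using NC_Kd by (force simp: lookup_minus)
    moreover have "coef c 0 - x \<in> Kd n" "coef c' 0 - y \<in> Kd n"
      using c by (auto simp: S\<^sub>2_rel_def)
    ultimately have "coef c 0 - coef c' 0 - (coef c 0 - x)
        + (coef c' 0 - y) \<in> Kd n"
      by (meson subspace_add[OF sub_Kd] subspace_diff[OF sub_Kd])
    then show "x +o Kd n = y +o Kd n" by (simp add: Kd_eq)
  qed
  have f6: "kernel (HC_mod n) (HH_mod (n + 1)) B' = S\<^sub>2 ` carrier (HD_mod n)"
    unfolding HC_mod_eq HH_mod_eq HD_mod_eq
    by (rule relation_exact[OF module_us module_axioms sub_NC sub_NH S\<^sub>2_rel_sub S\<^sub>2_rel_total
          B_rel_sub B_rel_total]) (assumption | (rule S\<^sub>2_eq B'_eq S\<^sub>2_B_exact; assumption))+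
  have f7: "kernel (HH_mod (n + 1)) (HC_mod (n + 1)) I = B' ` carrier (HC_mod n)"
    unfolding HC_mod_eq HH_mod_eq HD_mod_eq
    by (rule relation_exact[OF module_axioms module_us sub_NH sub_NC B_rel_sub B_rel_total
          I_rel_sub I_rel_total]) (assumption | (rule B'_eq I_eq B_I_exact; assumption))+
  have f8: "kernel (HC_mod (n + 1)) (HD_mod (n - 1)) S\<^sub>1 = I ` carrier (HH_mod (n + 1))"
    unfolding HC_mod_eq HH_mod_eq HD_mod_eq
    by (rule relation_exact[OF module_us module_axioms sub_NC sub_Kd I_rel_sub I_rel_total
          S\<^sub>1_rel_sub[of "n + 1", unfolded n] S\<^sub>1_rel_total])
      (assumption | (rule I_eq S\<^sub>1_eq I_S\<^sub>1_exact[of _ _ "n + 1", unfolded n]; assumption))+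
  have f9: "S\<^sub>1 ` carrier (HC_mod (n + 1)) = carrier (HD_mod (n - 1))"
  proof (intro equalityI subsetI)
    fix y assume "y \<in> S\<^sub>1 ` carrier (HC_mod (n + 1))"
    then show "y \<in> carrier (HD_mod (n - 1))" using S\<^sub>1 by (auto simp: lin_hom_def hom_def)
  next
    fix y assume "y \<in> carrier (HD_mod (n - 1))"
    then obtain g where g: "g \<in> ZD (n - 1)" "y = g +o Kd (n - 1)" by (auto simp: HD_mod_eq)
    have "n - 1 + 2 = n + 1" by simp
    from S1_surj[of g "n - 1", unfolded this] g
    obtain f g' where f: "f \<in> V (n + 1)" "g' \<in> V (n - 1)" "\<iota> f \<approx> d g'" "g' - g \<in> K"
      by (auto simp: ZD_def)
    obtain c where c: "c \<in> cycles (n + 1)" "coef c 0 - f \<in> Kd (n + 1)"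
      using HC_surj_Kd[of f "n + 1" g'] f by auto
    \<comment> \<open>The relation may return another primitive than \<open>g'\<close>, and
      \<open>c\<close> starts with \<open>f\<close> only modulo \<open>Kd (n + 1)\<close>; both
      changes are invisible in \<open>HD_mod (n - 1)\<close>.\<close>
    obtain g'' where g'': "(c, g'') \<in> S\<^sub>1_rel (n + 1)" using S\<^sub>1_rel_total c by blast
    have "g'' - g' \<in> Kd (n - 1)" using S\<^sub>1_rel_diff[OF g'' f(1) c(2) f(3)] f(2) by simp
    then have "(g'' - g') + (g' - g) \<in> Kd (n - 1)" using K_Kd[OF f(4)] by (rule subspace_add[OF sub_Kd])
    then have "g'' +o Kd (n - 1) = g +o Kd (n - 1)" unfolding Kd_eq by simp
    then have "y = S\<^sub>1 (c +o NC (n + 1))" using g S\<^sub>1_eq[OF g''] by simp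
    then show "y \<in> S\<^sub>1 ` carrier (HC_mod (n + 1))" using c(1) by (auto simp: HC_mod_eq)
  qed
  show ?thesis
    by (intro exI[of _ S\<^sub>2] exI[of _ B'] exI[of _ I] exI[of _ S\<^sub>1] conjI ballI allI impI
        S\<^sub>2 B' I S\<^sub>1 f1 f2 f3 f4 f5 f6 f7 f8 f9)
      (assumption | erule conjunct1 | erule conjunct2)+
qed

end

section \<open>Linear maps on the free graded algebra\<close>

interpretation falg: module "fscale :: 'k::comm_ring_1 \<Rightarrow> ('a, 'k) falg \<Rightarrow> ('a, 'k) falg"
  by (rule module_fscale)

abbreviation mon :: "'a gen list \<Rightarrow> ('a, 'k::comm_ring_1) falg" where
  "mon w \<equiv> Poly_Mapping.single (FWord w) 1"

lemma mon_mult: "mon u * mon v = mon (u @ v)"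
  by (simp add: mult_single plus_fword_def)

lemma mon_Nil: "mon [] = 1"
  by (simp add: zero_fword_def[symmetric] one_poly_mapping_def[symmetric] single_one)

lemma mon_Elt: "mon (Elt a # w) = el a * mon w" and mon_Dif: "mon (Dif a # w) = df a * mon w"
  by (simp_all add: el_def df_def mon_mult)

lemma fscale_single: "fscale r (Poly_Mapping.single w c) = Poly_Mapping.single w (r * c)"
  by (simp add: fscale_def const_def mult_single)

lemma fscale_mult_left: "fscale r x * y = fscale r (x * y)"
  by (simp add: fscale_def mult.assoc)

lemma sum_monomials:
  fixes x :: "'b \<Rightarrow>\<^sub>0 'c::comm_monoid_add"
  shows "(\<Sum>w\<in>Poly_Mapping.keys x. Poly_Mapping.single w (Poly_Mapping.lookup x w)) = x"
  by (rule poly_mapping_eqI) (auto simp: lookup_sum lookup_single when_def in_keys_iff)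

lemma poly_mapping_single_induct [case_names zero single sum]:
  fixes x :: "'b \<Rightarrow>\<^sub>0 'c::comm_monoid_add"
  assumes "P 0" "\<And>w c. P (Poly_Mapping.single w c)" "\<And>f g. P f \<Longrightarrow> P g \<Longrightarrow> P (f + g)"
  shows "P x"
proof -
  have "P (\<Sum>w\<in>S. Poly_Mapping.single w (Poly_Mapping.lookup x w))" for S
    using assms by (induction S rule: infinite_finite_induct) auto
  then show ?thesis using sum_monomials by metis
qed

lemma const_comm: "const r * x = x * const r"
  for x :: "('a, 'k::comm_ring_1) falg"
proof (induction x rule: poly_mapping_single_induct)
  case zero
  then show ?case by simp
next
  case (single w c)
  then show ?case by (simp add: const_def mult_single mult.commute)
next
  case (sum f g)
  then show ?case by (simp add: distrib_left distrib_right)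
qed

lemma fscale_mult_right: "x * fscale r y = fscale r (x * y)"
  by (metis const_comm fscale_def mult.assoc)

lemma neg_one_power_fscale: "(-1) ^ n * x = fscale ((-1) ^ n) x"
  for x :: "('a, 'k::comm_ring_1) falg"
proof (induction n)
  case (Suc n)
  then show ?case by (simp add: mult.assoc falg.scale_minus_left)
qed simp

lemma falg_induct [case_names zero add scale mon]:
  fixes x :: "('a, 'k::comm_ring_1) falg"
  assumes "P 0" "\<And>x y. P x \<Longrightarrow> P y \<Longrightarrow> P (x + y)" "\<And>r x. P x \<Longrightarrow> P (fscale r x)" "\<And>w. P (mon w)"
  shows "P x"
proof (induction x rule: poly_mapping_single_induct)
  case zero
  then show ?case using assms by simp
next
  case (single w c)
  obtain l where "w = FWord l" by (cases w)
  then have "Poly_Mapping.single w c = fscale c (mon l)" by (simp add: fscale_single)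
  then show ?case using assms by metis
next
  case (sum f g)
  then show ?case using assms by blast
qed

abbreviation linear_op :: "(('a, 'k::comm_ring_1) falg \<Rightarrow> ('a, 'k) falg) \<Rightarrow> bool" where
  "linear_op \<equiv> module_hom fscale fscale"

lemma linear_opI:
  assumes "\<And>x y. \<phi> (x + y) = \<phi> x + \<phi> y" "\<And>r x. \<phi> (fscale r x) = fscale r (\<phi> x)"
  shows "linear_op \<phi>"
  using assms by unfold_locales

lemma linear_op_compose: "linear_op \<phi> \<Longrightarrow> linear_op \<psi> \<Longrightarrow> linear_op (\<lambda>x. \<phi> (\<psi> x))"
  by (intro linear_opI) (simp_all add: module_hom.add module_hom.scale)

lemma linear_op_id: "linear_op (\<lambda>x. x)"
  by (intro linear_opI) simp_all

lemma lin_ext_eq_sum: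
  assumes "finite S" "Poly_Mapping.keys f \<subseteq> S"
  shows "lin_ext g f = (\<Sum>w\<in>S. fscale (Poly_Mapping.lookup f w) (g w))"
  unfolding lin_ext_def
  by (rule sum.mono_neutral_left[OF assms]) (auto simp: in_keys_iff)

lemma lin_ext_linear:
  fixes g :: "'a fword \<Rightarrow> ('a, 'b::comm_ring_1) falg"
  shows "linear_op (lin_ext g)"
proof (rule linear_opI)
  fix x y :: "('a, 'b) falg"
  let ?S = "Poly_Mapping.keys x \<union> Poly_Mapping.keys y"
  have "lin_ext g z = (\<Sum>w\<in>?S. fscale (Poly_Mapping.lookup z w) (g w))"
    if "Poly_Mapping.keys z \<subseteq> ?S" for z
    by (rule lin_ext_eq_sum) (use that in auto)
  then show "lin_ext g (x + y) = lin_ext g x + lin_ext g y"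
    using keys_add[of x y] by (simp add: lookup_add falg.scale_left_distrib sum.distrib)
next
  fix r :: "'b" and x :: "('a, 'b::comm_ring_1) falg"
  have lk: "Poly_Mapping.lookup (fscale r x) w = r * Poly_Mapping.lookup x w" for w
  proof (induction x rule: poly_mapping_single_induct)
    case zero
    then show ?case by simp
  next
    case (single v c)
    then show ?case by (simp add: fscale_single lookup_single when_def)
  next
    case (sum f g)
    then show ?case by (simp add: falg.scale_right_distrib lookup_add distrib_left)
  qed
  then have "Poly_Mapping.keys (fscale r x) \<subseteq> Poly_Mapping.keys x" by (auto simp: in_keys_iff)
  then have "lin_ext g (fscale r x)
      = (\<Sum>w\<in>Poly_Mapping.keys x. fscale (Poly_Mapping.lookup (fscale r x) w) (g w))"
    by (intro lin_ext_eq_sum) auto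
  then show "lin_ext g (fscale r x) = fscale r (lin_ext g x)"
    by (simp add: lk lin_ext_def falg.scale_sum_right)
qed

lemma lin_ext_mon: "lin_ext g (mon w) = g (FWord w)"
  by (simp add: lin_ext_def)

subsection \<open>Degrees\<close>

lemma wdeg_simps [simp]:
  "wdeg (FWord []) = 0" "wdeg (FWord (Elt a # w)) = wdeg (FWord w)"
  "wdeg (FWord (Dif a # w)) = Suc (wdeg (FWord w))"
  "wdeg (FWord (u @ v)) = wdeg (FWord u) + wdeg (FWord v)"
  by (simp_all add: wdeg_def)

lemma subspace_degpart: "falg.subspace (degpart m :: ('a, 'b::comm_ring_1) falg set)"
proof (rule falg.subspaceI)
  show "0 \<in> degpart m" by (simp add: degpart_def)
next
  fix x y :: "('a, 'b::comm_ring_1) falg" assume "x \<in> degpart m" "y \<in> degpart m"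
  then show "x + y \<in> degpart m" using keys_add[of x y] by (auto simp: degpart_def)
next
  fix r :: "'b" and x :: "('a, 'b::comm_ring_1) falg" assume x: "x \<in> degpart m"
  have "x = (\<Sum>w\<in>Poly_Mapping.keys x. Poly_Mapping.single w (Poly_Mapping.lookup x w))"
    by (simp add: sum_monomials)
  then have "fscale r x = (\<Sum>w\<in>Poly_Mapping.keys x. Poly_Mapping.single w (r * Poly_Mapping.lookup x w))"
    by (metis (no_types, lifting) falg.scale_sum_right fscale_single sum.cong)
  also have "Poly_Mapping.keys \<dots> \<subseteq> Poly_Mapping.keys x"
    by (rule order_trans[OF keys_sum]) auto
  finally show "fscale r x \<in> degpart m" using x by (auto simp: degpart_def)
qed

lemma mon_degpart: "mon w \<in> degpart (int (wdeg (FWord w)))"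
  by (simp add: degpart_def)

lemma degpart_induct [consumes 1, case_names zero add scale mon]:
  fixes x :: "('a, 'k::comm_ring_1) falg"
  assumes x: "x \<in> degpart m"
    and "P 0" "\<And>x y. P x \<Longrightarrow> P y \<Longrightarrow> P (x + y)" "\<And>r x. P x \<Longrightarrow> P (fscale r x)"
    and mon: "\<And>w. int (wdeg (FWord w)) = m \<Longrightarrow> P (mon w)"
  shows "P x"
proof -
  have P: "P (\<Sum>w\<in>S. Poly_Mapping.single w (Poly_Mapping.lookup x w))"
    if "S \<subseteq> Poly_Mapping.keys x" for S
    using finite_subset[OF that finite_keys] that
  proof (induction S rule: finite_induct)
    case empty
    then show ?case using assms by simp
  next
    case (insert w S)
    then have "int (wdeg w) = m" using x by (auto simp: degpart_def)
    moreover obtain l where "w = FWord l" by (cases w)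
    ultimately have "P (fscale (Poly_Mapping.lookup x w) (mon l))" using assms by blast
    then show ?case using insert assms \<open>w = FWord l\<close> by (simp add: fscale_single)
  qed
  then show ?thesis using P[OF order_refl] by (simp add: sum_monomials)
qed

lemma degpart_neg: "m < 0 \<Longrightarrow> x \<in> degpart m \<Longrightarrow> x = 0"
  by (force simp: degpart_def)

lemma linear_degpart:
  assumes "linear_op \<phi>" "\<And>w. int (wdeg (FWord w)) = m \<Longrightarrow> \<phi> (mon w) \<in> degpart m'" "x \<in> degpart m"
  shows "\<phi> x \<in> degpart m'"
  using assms(3)
proof (induction x rule: degpart_induct)
  case zero
  then show ?case by (simp add: module_hom.zero[OF assms(1)] falg.subspace_0[OF subspace_degpart])
qed (use assms in \<open>simp_all add: module_hom.add module_hom.scale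
      falg.subspace_add[OF subspace_degpart] falg.subspace_scale[OF subspace_degpart]\<close>)

lemma degpart_mult:
  fixes x y :: "('a, 'b::comm_ring_1) falg"
  assumes x: "x \<in> degpart m" and y: "y \<in> degpart n"
  shows "x * y \<in> degpart (m + n)"
  using x
proof (induction x rule: degpart_induct)
  case (mon u)
  then have u: "int (wdeg (FWord u)) = m" .
  show ?case
    using y
  proof (induction y rule: degpart_induct)
    case (mon v)
    then show ?case using u mon_degpart[of "u @ v"] by (simp add: mon_mult)
  qed (simp_all add: distrib_left fscale_mult_right falg.subspace_0[OF subspace_degpart]
      falg.subspace_add[OF subspace_degpart] falg.subspace_scale[OF subspace_degpart])
qed (simp_all add: distrib_right fscale_mult_left falg.subspace_0[OF subspace_degpart]
      falg.subspace_add[OF subspace_degpart] falg.subspace_scale[OF subspace_degpart])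

lemma el_degpart [simp]: "el a \<in> degpart 0" and df_degpart [simp]: "df a \<in> degpart 1"
  and one_degpart [simp]: "1 \<in> degpart 0" and const_degpart [simp]: "const r \<in> degpart 0"
  by (auto simp: degpart_def el_def df_def const_def wdeg_def zero_fword_def simp flip: single_one)

lemma const_eq_fscale: "const r = fscale r 1"
  by (simp add: fscale_def)

subsection \<open>The differential\<close>

lemma form_d_linear: "linear_op form_d"
  unfolding form_d_def by (rule lin_ext_linear)

interpretation form_d: module_hom fscale fscale form_d by (rule form_d_linear)

lemma form_d_one [simp]: "form_d 1 = 0"
  using lin_ext_mon[of "\<lambda>w. d_letters (letters w)" "[]"] by (simp add: form_d_def mon_Nil)

lemma form_d_const [simp]: "form_d (const r) = 0"
  by (simp add: const_eq_fscale form_d.scale)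

lemma form_d_el_mult: "form_d (el a * x) = df a * x + el a * form_d x"
proof (induction x rule: falg_induct)
  case (mon w)
  show ?case by (simp add: mon_Elt[symmetric] form_d_def lin_ext_mon)
qed (simp_all add: distrib_left form_d.add form_d.scale fscale_mult_right falg.scale_right_distrib)

lemma form_d_df_mult: "form_d (df a * x) = - (df a * form_d x)"
proof (induction x rule: falg_induct)
  case (mon w)
  show ?case by (simp add: mon_Dif[symmetric] form_d_def lin_ext_mon)
qed (simp_all add: distrib_left form_d.add form_d.scale fscale_mult_right falg.scale_right_distrib)

lemma form_d_el [simp]: "form_d (el a) = df a" and form_d_df [simp]: "form_d (df a) = 0"
  using form_d_el_mult[of a 1] form_d_df_mult[of a 1] by simp_all

lemma form_d_mult:
  assumes "x \<in> degpart (int p)"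
  shows "form_d (x * y) = form_d x * y + fscale ((-1) ^ p) (x * form_d y)"
  using assms
proof (induction x rule: degpart_induct)
  case (mon w)
  then show ?case
  proof (induction w arbitrary: p)
    case Nil
    then show ?case by (simp add: mon_Nil)
  next
    case (Cons g w)
    show ?case
    proof (cases g)
      case (Elt a)
      then show ?thesis using Cons
        by (simp add: mon_Elt form_d_el_mult mult.assoc distrib_left distrib_right fscale_mult_right)
    next
      case (Dif a)
      then obtain q where "p = Suc q" using Cons.prems by (cases p) auto
      then show ?thesis using Cons Dif
        by (simp add: mon_Dif form_d_df_mult mult.assoc distrib_left distrib_right fscale_mult_right)
    qed
  qed
qed (simp_all add: distrib_right form_d.add form_d.scale fscale_mult_left falg.scale_right_distrib mult.commute)

lemma form_d_degpart:
  fixes x :: "('a, 'b::comm_ring_1) falg"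
  shows "x \<in> degpart m \<Longrightarrow> form_d x \<in> degpart (m + 1)"
proof (rule linear_degpart[OF form_d_linear])
  fix w :: "'a gen list" assume "int (wdeg (FWord w)) = m"
  then show "(form_d (mon w) :: ('a, 'b) falg) \<in> degpart (m + 1)"
  proof (induction w arbitrary: m)
    case Nil
    then show ?case by (simp add: mon_Nil falg.subspace_0[OF subspace_degpart])
  next
    case (Cons g w)
    show ?case
    proof (cases g)
      case (Elt a)
      have dw: "(form_d (mon w) :: ('a, 'b) falg) \<in> degpart (m + 1)" using Cons Elt by simp
      have w: "(mon w :: ('a, 'b) falg) \<in> degpart m" using mon_degpart[of w] Cons.prems Elt by simp
      show ?thesis
        using degpart_mult[OF el_degpart dw, of a] degpart_mult[OF df_degpart w, of a] Elt
        by (simp add: mon_Elt form_d_el_mult falg.subspace_add[OF subspace_degpart] add.commute)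
    next
      case (Dif a)
      have dw: "(form_d (mon w) :: ('a, 'b) falg) \<in> degpart (m - 1 + 1)"
        using Cons.IH[of "m - 1"] Cons.prems Dif by simp
      show ?thesis
        using degpart_mult[OF df_degpart dw, of a] Dif
        by (simp add: mon_Dif form_d_df_mult falg.subspace_neg[OF subspace_degpart] add.commute)
    qed
  qed
qed

lemma form_d_form_d [simp]: "form_d (form_d x) = 0"
proof (induction x rule: falg_induct)
  case (mon w)
  show ?case
  proof (induction w)
    case Nil
    then show ?case by (simp add: mon_Nil)
  next
    case (Cons g w)
    then show ?case
      by (cases g) (simp_all add: mon_Elt mon_Dif form_d_el_mult form_d_df_mult form_d.add form_d.neg)
  qed
qed (simp_all add: form_d.add form_d.scale)

section \<open>The Hochschild boundary and the Karoubi operator on words\<close>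

text \<open>On \<open>u dc v\<close> with \<open>v\<close> of degree \<open>0\<close>, moving \<open>v\<close> to the left of \<open>dc\<close> by the Leibniz rule shows that
  the boundary is \<open>(-1)\<^bsup>|u|\<^esup> (v u c - c v u)\<close>. The first argument of \<open>bw\<close> is the reversed word.\<close>

fun bw :: "'a gen list \<Rightarrow> 'a gen list \<Rightarrow> ('a, 'k::comm_ring_1) falg" where
  "bw [] v = 0"
| "bw (Elt a # u) v = bw u (Elt a # v)"
| "bw (Dif c # u) v =
     fscale ((-1) ^ wdeg (FWord u)) (mon (v @ rev u) * el c - el c * mon (v @ rev u))"

definition b_op :: "('a, 'k::comm_ring_1) falg \<Rightarrow> ('a, 'k) falg" where
  "b_op = lin_ext (\<lambda>w. bw (rev (letters w)) [])"

lemma b_op_linear: "linear_op b_op"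
  unfolding b_op_def by (rule lin_ext_linear)

interpretation b_op: module_hom fscale fscale b_op by (rule b_op_linear)

lemma bw_append: "wdeg (FWord v) = 0 \<Longrightarrow> bw (rev v @ u) v' = bw u (v @ v')"
proof (induction v arbitrary: u)
  case (Cons g v)
  then show ?case by (cases g) auto
qed simp

lemma wdeg_rev: "wdeg (FWord (rev u)) = wdeg (FWord u)"
  by (simp add: wdeg_def rev_filter[symmetric])

lemma b_op_mon:
  assumes "wdeg (FWord v) = 0"
  shows "b_op (mon (u @ Dif c # v)) =
    fscale ((-1) ^ wdeg (FWord u)) (mon v * mon u * el c - el c * mon v * mon u)"
  using bw_append[OF assms, of "Dif c # rev u" "[]"]
  by (simp add: b_op_def lin_ext_mon wdeg_rev mon_mult mult.assoc)

lemma b_op_degree_0: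
  assumes "x \<in> degpart 0"
  shows "b_op x = 0"
  using assms
proof (induction x rule: degpart_induct)
  case (mon w)
  then show ?case using bw_append[of w "[]" "[]"] by (simp add: b_op_def lin_ext_mon)
qed (simp_all add: b_op.add b_op.scale)

lemma mon_degpartI: "int (wdeg (FWord w)) = m \<Longrightarrow> mon w \<in> degpart m"
  using mon_degpart by force

lemma mon_split: "mon (u @ Dif c # v) = mon u * df c * mon v"
  by (simp add: df_def mon_mult)

text \<open>Bilinear extension of the formula on words. The factor \<open>z\<close> after the last
  differential lets \<open>b\<close> be iterated without rewriting words; \<open>z = 1\<close> gives
  the usual boundary.\<close>

lemma b_op_form:
  assumes "x \<in> degpart (int n)" "z \<in> degpart 0"
  shows "b_op (x * df c * z) = fscale ((-1) ^ n) (z * x * el c - el c * z * x)"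
  using assms(1)
proof (induction x rule: degpart_induct)
  case (mon u)
  then have u: "wdeg (FWord u) = n" by simp
  show ?case
    using assms(2)
  proof (induction z rule: degpart_induct)
    case (mon v)
    then show ?case using b_op_mon[of v u c] u unfolding mon_split by simp
  qed (simp_all add: b_op.add b_op.scale distrib_left distrib_right fscale_mult_left fscale_mult_right
      falg.scale_right_distrib falg.scale_right_diff_distrib mult.commute)
qed (simp_all add: b_op.add b_op.scale distrib_left distrib_right fscale_mult_left fscale_mult_right
      falg.scale_right_distrib falg.scale_right_diff_distrib mult.commute)

lemma b_op_mult_df:
  "x \<in> degpart (int n) \<Longrightarrow> b_op (x * df c) = fscale ((-1) ^ n) (x * el c - el c * x)"
  using b_op_form[of x n 1 c] by simp

text \<open>The splitting is at the last differential, the letter that \<open>bw\<close> searches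
  for.\<close>

lemma word_cases:
  obtains (zero) "wdeg (FWord w) = 0"
  | (dif) u c v where "w = u @ Dif c # v" "wdeg (FWord v) = 0"
proof (induction w arbitrary: thesis rule: rev_induct)
  case Nil
  then show ?case by simp
next
  case (snoc g w)
  show ?case
  proof (cases g)
    case (Dif c)
    then show ?thesis using snoc.prems(2)[of w c "[]"] by simp
  next
    case (Elt a)
    show ?thesis
    proof (rule snoc.IH)
      assume "wdeg (FWord w) = 0"
      then show ?thesis using snoc.prems(1) Elt by simp
    next
      fix u c v assume "w = u @ Dif c # v" "wdeg (FWord v) = 0"
      then show ?thesis using snoc.prems(2)[of u c "v @ [Elt a]"] Elt by simp
    qed
  qed
qed

text \<open>This holds in the free algebra already. With \<open>de\<close> the last differential of
  \<open>u\<close>, both terms of the boundary of \<open>u dc v\<close> have \<open>de\<close> as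
  their last differential, and rotating what follows \<open>de\<close> to the front gives the same
  result in both, so their boundaries cancel.\<close>

lemma b_op_b_op [simp]:
  fixes x :: "('a, 'k::comm_ring_1) falg"
  shows "b_op (b_op x) = 0"
proof (induction x rule: falg_induct)
  case (mon w)
  let ?m = "mon :: 'a gen list \<Rightarrow> ('a, 'k) falg"
  show ?case
  proof (cases w rule: word_cases)
    case zero
    then show ?thesis by (simp add: b_op_degree_0 mon_degpartI b_op.zero)
  next
    case (dif u c v)
    have v: "?m v \<in> degpart 0" using dif by (intro mon_degpartI) simp
    show ?thesis
    proof (cases u rule: word_cases)
      case zero
      then have "?m u \<in> degpart 0" by (intro mon_degpartI) simp
      then have "?m v * ?m u * el c \<in> degpart (0 + 0 + 0)" "el c * ?m v * ?m u \<in> degpart (0 + 0 + 0)"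
        using v by (intro degpart_mult el_degpart; simp)+
      then show ?thesis
        using dif by (simp add: b_op_mon b_op.scale b_op.diff b_op_degree_0)
    next
      case u: (dif u' e v')
      define n where "n = wdeg (FWord u')"
      have v': "?m v' \<in> degpart 0" using u by (intro mon_degpartI) simp
      have u': "?m u' \<in> degpart (int n)" by (simp add: n_def mon_degpartI)
      have d: "?m v * ?m u' \<in> degpart (int n)" "el c * ?m v * ?m u' \<in> degpart (int n)"
          "?m v' * el c \<in> degpart 0"
        using degpart_mult[OF v u'] degpart_mult[OF degpart_mult[OF el_degpart v] u']
          degpart_mult[OF v' el_degpart] by simp_all
      have "b_op (?m v * ?m u * el c) = b_op ((?m v * ?m u') * df e * (?m v' * el c))"
        using u by (simp add: mon_split mult.assoc)
      also have "\<dots> = fscale ((-1) ^ n) (?m v' * el c * ?m v * ?m u' * el e - el e * ?m v' * el c * ?m v * ?m u')"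
        using b_op_form[OF d(1) d(3)] by (simp add: mult.assoc)
      also have "\<dots> = b_op ((el c * ?m v * ?m u') * df e * ?m v')"
        using b_op_form[OF d(2) v'] by (simp add: mult.assoc)
      also have "\<dots> = b_op (el c * ?m v * ?m u)"
        using u by (simp add: mon_split mult.assoc)
      finally show ?thesis
        using dif by (simp add: b_op_mon b_op.scale b_op.diff)
    qed
  qed
qed (simp_all add: b_op.add b_op.scale)

lemma b_op_degpart:
  fixes x :: "('a, 'b::comm_ring_1) falg"
  assumes "x \<in> degpart m"
  shows "b_op x \<in> degpart (m - 1)"
proof (rule linear_degpart[OF b_op_linear _ assms])
  fix w :: "'a gen list" assume w: "int (wdeg (FWord w)) = m"
  show "(b_op (mon w) :: ('a, 'b) falg) \<in> degpart (m - 1)"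
  proof (cases w rule: word_cases)
    case zero
    then show ?thesis
      by (simp add: b_op_degree_0 mon_degpartI falg.subspace_0[OF subspace_degpart])
  next
    case (dif u c v)
    have "(mon v :: ('a, 'b) falg) \<in> degpart 0" using dif by (intro mon_degpartI) simp
    moreover have "(mon u :: ('a, 'b) falg) \<in> degpart (m - 1)" using dif w by (intro mon_degpartI) simp
    ultimately have "(mon v * mon u * el c :: ('a, 'b) falg) \<in> degpart (0 + (m - 1) + 0) \<and>
        (el c * mon v * mon u :: ('a, 'b) falg) \<in> degpart (0 + 0 + (m - 1))"
      by (intro conjI degpart_mult el_degpart)
    then show ?thesis
      using dif by (simp add: b_op_mon falg.subspace_scale[OF subspace_degpart] falg.subspace_diff[OF subspace_degpart])
  qed
qed

text \<open>Taking \<open>b d + d b = 1 - \<kappa>\<close> as the definition makes \<kappa> commute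
  with \<open>b\<close> and \<open>d\<close> at once, as both square to zero on the free algebra;
  the rotation formula is then a computation.\<close>

definition k_op :: "('a, 'k::comm_ring_1) falg \<Rightarrow> ('a, 'k) falg" where
  "k_op x = x - b_op (form_d x) - form_d (b_op x)"

lemma k_op_linear: "linear_op k_op"
  by (intro linear_opI)
    (simp_all add: k_op_def b_op.add b_op.scale form_d.add form_d.scale falg.scale_right_diff_distrib)

interpretation k_op: module_hom fscale fscale k_op by (rule k_op_linear)

lemma b_op_k_op: "b_op (k_op x) = k_op (b_op x)"
  by (simp add: k_op_def b_op.diff form_d.zero)

text \<open>In \<open>b d + d b\<close> the commutators of \<open>form_d x\<close> with
  \<open>c\<close> have opposite signs and cancel; the Leibniz terms \<open>x dc\<close> and
  \<open>dc x\<close> of \<open>d b\<close> remain.\<close>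

lemma k_op_mult_df:
  fixes x :: "('a, 'k::comm_ring_1) falg"
  assumes x: "x \<in> degpart (int n)"
  shows "k_op (x * df c) = fscale ((-1) ^ n) (df c * x)"
proof -
  have dx: "form_d x \<in> degpart (int (Suc n))" using form_d_degpart[OF x] by (simp add: add.commute)
  have "form_d (x * df c) = form_d x * df c" using form_d_mult[OF x, of "df c"] by simp
  then have "b_op (form_d (x * df c)) = fscale ((-1) ^ Suc n) (form_d x * el c - el c * form_d x)"
    using b_op_mult_df[OF dx] by simp
  moreover have "form_d (b_op (x * df c)) =
      fscale ((-1) ^ n) (form_d x * el c + fscale ((-1) ^ n) (x * df c) - (df c * x + el c * form_d x))"
    by (simp add: b_op_mult_df[OF x] form_d.scale form_d.diff form_d_mult[OF x] form_d_el_mult)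
  moreover have "((-1) ^ n * (-1) ^ n :: 'k) = 1" by (simp flip: power_add mult_2)
  ultimately show ?thesis
    by (simp add: k_op_def falg.scale_right_diff_distrib falg.scale_right_distrib)
qed

section \<open>Rotation of forms\<close>

lemma dfs_Nil [simp]: "dfs [] = 1" and dfs_Cons: "dfs (a # as) = df a * dfs as"
  and dfs_append: "dfs (as @ bs) = dfs as * dfs bs"
  by (simp_all add: dfs_def)

lemma dfs_degpart: "dfs as \<in> degpart (int (length as))"
  by (induction as) (auto simp: dfs_Cons dest: degpart_mult[OF df_degpart])

lemma form_d_dfs [simp]: "form_d (dfs as) = 0"
  by (induction as) (simp_all add: dfs_Cons form_d_df_mult)

text \<open>Each application moves the last differential to the front, past a form of degree one
  less than \<open>length as\<close>, which gives the exponent.\<close>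

lemma k_op_rotate:
  fixes as :: "'a list" and a0 :: 'a
  assumes "j \<le> length as"
  shows "(k_op ^^ j) (el a0 * dfs as :: ('a, 'k::comm_ring_1) falg) =
    fscale ((-1) ^ (j * (length as - 1)))
      (dfs (drop (length as - j) as) * el a0 * dfs (take (length as - j) as))"
  using assms
proof (induction j)
  case 0
  show ?case by simp
next
  case (Suc j)
  let ?n = "length as"
  define i where "i = ?n - Suc j"
  have i: "?n - j = Suc i" "?n - Suc j = i" "i < ?n" using Suc.prems by (auto simp: i_def)
  define x :: "('a, 'k) falg" where "x = dfs (drop (Suc i) as) * el a0 * dfs (take i as)"
  have "x \<in> degpart (int (?n - Suc i) + 0 + int i)"
    using dfs_degpart[of "drop (Suc i) as"] dfs_degpart[of "take i as"] i
    unfolding x_def by (intro degpart_mult el_degpart) (simp_all add: min_def)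
  then have x: "x \<in> degpart (int (?n - 1))" using i by (simp add: of_nat_diff)
  have "(dfs (take (Suc i) as) :: ('a, 'k) falg) = dfs (take i as) * df (as ! i)"
    using i by (simp add: take_Suc_conv_app_nth dfs_append dfs_Cons)
  then have "(k_op ^^ j) (el a0 * dfs as) = fscale ((-1) ^ (j * (?n - 1))) (x * df (as ! i))"
    using Suc i by (simp add: x_def mult.assoc)
  then have "(k_op ^^ Suc j) (el a0 * dfs as) = k_op (fscale ((-1) ^ (j * (?n - 1))) (x * df (as ! i)))"
    by simp
  also have "\<dots> = fscale ((-1) ^ (j * (?n - 1)) * (-1) ^ (?n - 1)) (df (as ! i) * x)"
    by (simp only: k_op.scale k_op_mult_df[OF x] falg.scale_scale)
  also have "df (as ! i) * x = dfs (drop i as) * el a0 * dfs (take i as)"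
    using i by (simp add: x_def mult.assoc dfs_Cons flip: Cons_nth_drop_Suc)
  finally show ?case using i(2) by (simp only: mult_Suc power_add mult.commute)
qed

text \<open>After \<open>n\<close> steps \<open>a\<^sub>0\<close> has moved to the right end; commuting it back costs a boundary.\<close>

lemma k_op_power_form:
  fixes as :: "'a list" and a0 :: 'a
  defines "x \<equiv> (el a0 * dfs as :: ('a, 'k::comm_ring_1) falg)"
  shows "(k_op ^^ Suc (length as)) x = x - form_d (b_op x)"
proof -
  let ?n = "length as" and ?y = "dfs as :: ('a, 'k) falg"
  have y: "?y \<in> degpart (int ?n)" by (rule dfs_degpart)
  have sgn: "((-1) ^ ?n * (-1) ^ ?n :: 'k) = 1" by (simp flip: power_add mult_2)
  have "even (?n * (?n - 1))" by (cases ?n) auto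
  then have "(k_op ^^ ?n) x = ?y * el a0"
    unfolding x_def by (simp add: k_op_rotate)
  also have "\<dots> = x + fscale ((-1) ^ ?n) (b_op (?y * df a0))"
    using sgn by (simp add: b_op_mult_df[OF y] x_def)
  finally have "(k_op ^^ Suc ?n) x = k_op x + fscale ((-1) ^ ?n) (b_op (k_op (?y * df a0)))"
    by (simp add: k_op.add k_op.scale b_op_k_op)
  \<comment> \<open>\<open>form_d x\<close> is \<open>df a0 * dfs as\<close>, so the cost of the
    commutation becomes \<open>b (d x)\<close>, which cancels that term of \<open>k_op x\<close> and
    leaves \<open>x - d (b x)\<close>.\<close>
  also have "k_op (?y * df a0) = fscale ((-1) ^ ?n) (form_d x)"
    by (simp add: k_op_mult_df[OF y] x_def form_d_el_mult)
  finally have "(k_op ^^ Suc ?n) x = k_op x + b_op (form_d x)" using sgn by (simp add: b_op.scale)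
  then show ?thesis by (simp only: k_op_def) simp
qed

section \<open>The ideal of relations\<close>

context unital_algebra
begin

lemma subspace_rel_ideal: "falg.subspace (rel_ideal scale)"
  by (simp add: rel_ideal_def)

lemma rel_ideal_mult: "x \<in> rel_ideal scale \<Longrightarrow> y * x * z \<in> rel_ideal scale"
  unfolding rel_ideal_def
proof (induction x rule: falg.span_induct_alt)
  case base
  then show ?case by (simp add: falg.span_zero)
next
  case (step c x u)
  then obtain v \<rho> w where "x = v * \<rho> * w" "\<rho> \<in> relators scale" by blast
  then have "y * x * z = (y * v) * \<rho> * (w * z)" by (simp add: mult.assoc)
  then have "y * x * z \<in> falg.span {x * \<rho> * y |x \<rho> y. \<rho> \<in> relators scale}"
    using \<open>\<rho> \<in> relators scale\<close> by (intro falg.span_base) blast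
  then show ?case
    using step by (simp add: distrib_left distrib_right fscale_mult_left fscale_mult_right
        falg.span_add falg.span_scale)
qed

lemma rel_ideal_mult_left: "x \<in> rel_ideal scale \<Longrightarrow> y * x \<in> rel_ideal scale"
  and rel_ideal_mult_right: "x \<in> rel_ideal scale \<Longrightarrow> x * y \<in> rel_ideal scale"
  using rel_ideal_mult[of x y 1] rel_ideal_mult[of x 1 y] by simp_all

lemma relators_rel_ideal: "\<rho> \<in> relators scale \<Longrightarrow> \<rho> \<in> rel_ideal scale"
  unfolding rel_ideal_def by (rule falg.span_base) (metis (mono_tags, lifting) mem_Collect_eq mult_1 mult_1_right)

lemma rel_ideal_preserved:
  fixes \<phi> :: "('a, 'k) falg \<Rightarrow> ('a, 'k) falg"
  assumes \<phi>: "linear_op \<phi>"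
    and mon: "\<And>u \<rho> v. \<rho> \<in> relators scale \<Longrightarrow> \<phi> (mon u * \<rho> * mon v) \<in> J"
    and J: "falg.subspace J"
    and x: "x \<in> rel_ideal scale"
  shows "\<phi> x \<in> J"
proof -
  have "\<phi> (y * \<rho> * z) \<in> J" if \<rho>: "\<rho> \<in> relators scale" for y \<rho> z
  proof (induction y rule: falg_induct)
    case (mon u)
    show ?case
    proof (induction z rule: falg_induct)
      case (mon v)
      show ?case by (rule assms(2)[OF \<rho>])
    qed (simp_all add: distrib_left fscale_mult_right module_hom.zero[OF \<phi>] module_hom.add[OF \<phi>]
        module_hom.scale[OF \<phi>] falg.subspace_0[OF J] falg.subspace_add[OF J] falg.subspace_scale[OF J])
  qed (simp_all add: distrib_right fscale_mult_left module_hom.zero[OF \<phi>] module_hom.add[OF \<phi>]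
        module_hom.scale[OF \<phi>] falg.subspace_0[OF J] falg.subspace_add[OF J] falg.subspace_scale[OF J])
  then have gen: "\<phi> g \<in> J" if "g \<in> {x * \<rho> * y |x \<rho> y. \<rho> \<in> relators scale}" for g
    using that by blast
  show ?thesis
    using x unfolding rel_ideal_def
  proof (induction x rule: falg.span_induct_alt)
    case base
    then show ?case by (simp add: module_hom.zero[OF \<phi>] falg.subspace_0[OF J])
  next
    case (step c x y)
    then show ?case
      by (simp add: module_hom.add[OF \<phi>] module_hom.scale[OF \<phi>] gen
          falg.subspace_add[OF J] falg.subspace_scale[OF J])
  qed
qed

section \<open>Congruence modulo the relations\<close>

definition eqv :: "('a, 'k) falg \<Rightarrow> ('a, 'k) falg \<Rightarrow> bool" (infix "\<simeq>" 50) where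
  "x \<simeq> y \<longleftrightarrow> x - y \<in> rel_ideal scale"

lemma eqv_refl [simp]: "x \<simeq> x"
  by (simp add: eqv_def falg.subspace_0[OF subspace_rel_ideal])

lemma eqv_sym: "x \<simeq> y \<Longrightarrow> y \<simeq> x"
  unfolding eqv_def using falg.subspace_neg[OF subspace_rel_ideal] by force

lemma eqv_add: "x \<simeq> x' \<Longrightarrow> y \<simeq> y' \<Longrightarrow> x + y \<simeq> x' + y'"
  unfolding eqv_def using falg.subspace_add[OF subspace_rel_ideal, of "x - x'" "y - y'"]
  by (simp add: algebra_simps)

lemma eqv_diff: "x \<simeq> x' \<Longrightarrow> y \<simeq> y' \<Longrightarrow> x - y \<simeq> x' - y'"
  unfolding eqv_def using falg.subspace_diff[OF subspace_rel_ideal, of "x - x'" "y - y'"]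
  by (simp add: algebra_simps)

lemma eqv_scale: "x \<simeq> x' \<Longrightarrow> fscale r x \<simeq> fscale r x'"
  unfolding eqv_def using falg.subspace_scale[OF subspace_rel_ideal, of "x - x'" r]
  by (simp add: falg.scale_right_diff_distrib)

lemma eqv_trans [trans]: "x \<simeq> y \<Longrightarrow> y \<simeq> z \<Longrightarrow> x \<simeq> z"
  using eqv_add[of x y y z] unfolding eqv_def by simp

lemma eqv_mult: "x \<simeq> x' \<Longrightarrow> y \<simeq> y' \<Longrightarrow> x * y \<simeq> x' * y'"
proof -
  assume "x \<simeq> x'" "y \<simeq> y'"
  then have "(x - x') * y + x' * (y - y') \<in> rel_ideal scale"
    unfolding eqv_def by (intro falg.subspace_add[OF subspace_rel_ideal] rel_ideal_mult_left rel_ideal_mult_right)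
  then show ?thesis by (simp add: eqv_def algebra_simps)
qed

lemma eqv_sum: "(\<And>j. j \<in> S \<Longrightarrow> f j \<simeq> g j) \<Longrightarrow> sum f S \<simeq> sum g S"
  unfolding eqv_def using falg.subspace_sum[OF subspace_rel_ideal, of S "\<lambda>j. f j - g j"]
  by (simp add: sum_subtractf)

lemma eqv_0_iff: "x \<simeq> 0 \<longleftrightarrow> x \<in> rel_ideal scale"
  by (simp add: eqv_def)

lemma eqv_map:
  assumes "linear_op \<phi>" "\<phi> ` rel_ideal scale \<subseteq> rel_ideal scale" "x \<simeq> y"
  shows "\<phi> x \<simeq> \<phi> y"
  using assms(2,3) module_hom.diff[OF assms(1), of x y] by (auto simp: eqv_def)

lemma relatorsI:
  "el (a * b) - el a * el b \<in> relators scale" "el 1 - 1 \<in> relators scale"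
  "el (a + b) - el a - el b \<in> relators scale" "el (scale r a) - fscale r (el a) \<in> relators scale"
  "df (a + b) - df a - df b \<in> relators scale" "df (scale r a) - fscale r (df a) \<in> relators scale"
  "df (scale r 1) \<in> relators scale" "df (a * b) - (df a * el b + el a * df b) \<in> relators scale"
  unfolding relators_def by blast+

lemma eqv_relators:
  shows el_mult: "el (a * b) \<simeq> el a * el b" and el_one: "el 1 \<simeq> 1"
    and el_add: "el (a + b) \<simeq> el a + el b" and el_scale: "el (scale r a) \<simeq> fscale r (el a)"
    and df_add: "df (a + b) \<simeq> df a + df b" and df_scale: "df (scale r a) \<simeq> fscale r (df a)"
    and df_scale_one: "df (scale r 1) \<simeq> 0"
    and df_mult: "df (a * b) \<simeq> df a * el b + el a * df b"
  unfolding eqv_def using relatorsI[THEN relators_rel_ideal] by (simp_all add: diff_diff_eq)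

lemma relators_cases [consumes 1]:
  assumes "\<rho> \<in> relators scale"
  obtains (el_mult) a b where "\<rho> = el (a * b) - el a * el b"
  | (el_one) "\<rho> = el 1 - 1"
  | (el_add) a b where "\<rho> = el (a + b) - el a - el b"
  | (el_scale) r a where "\<rho> = el (scale r a) - fscale r (el a)"
  | (df_add) a b where "\<rho> = df (a + b) - df a - df b"
  | (df_scale) r a where "\<rho> = df (scale r a) - fscale r (df a)"
  | (df_one) r where "\<rho> = df (scale r 1)"
  | (df_mult) a b where "\<rho> = df (a * b) - (df a * el b + el a * df b)"
  using assms unfolding relators_def by blast

text \<open>The relators are arranged compatibly with \<open>d\<close>: it sends each one of degree
  \<open>0\<close> to one of degree \<open>1\<close>, and each one of degree \<open>1\<close> to
  zero.\<close>

lemma relators_degpart: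
  assumes "\<rho> \<in> relators scale"
  shows "(\<rho> \<in> degpart 0 \<and> form_d \<rho> \<in> rel_ideal scale) \<or> (\<rho> \<in> degpart 1 \<and> form_d \<rho> \<in> rel_ideal scale)"
proof -
  note deg = falg.subspace_diff[OF subspace_degpart] falg.subspace_add[OF subspace_degpart]
    falg.subspace_scale[OF subspace_degpart] falg.subspace_0[OF subspace_degpart]
  have m: "el a * el b \<in> degpart 0" "df a * el b \<in> degpart 1" "el a * df b \<in> degpart 1" for a b
    using degpart_mult[OF el_degpart el_degpart, of a b] degpart_mult[OF df_degpart el_degpart, of a b]
      degpart_mult[OF el_degpart df_degpart, of a b] by simp_all
  have r: "x - (y + z) \<in> rel_ideal scale \<Longrightarrow> x - y - z \<in> rel_ideal scale" for x y z :: "('a, 'k) falg"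
    by (simp add: diff_diff_eq)
  note rel = eqv_relators[unfolded eqv_def]
  have df1: "df 1 \<in> rel_ideal scale" using df_scale_one[of 1] by (simp add: eqv_0_iff)
  show ?thesis
    using assms
  proof (cases rule: relators_cases)
    case (df_add a b)
    then show ?thesis
      by (auto simp: form_d.diff falg.subspace_0[OF subspace_rel_ideal] intro!: deg)
  qed (auto simp: form_d.diff form_d.scale form_d.add form_d_el_mult form_d_df_mult
      falg.subspace_0[OF subspace_rel_ideal] intro!: deg m r rel df1)
qed

lemma form_d_rel_ideal:
  assumes "x \<in> rel_ideal scale"
  shows "form_d x \<in> rel_ideal scale"
proof (rule rel_ideal_preserved[OF form_d_linear _ subspace_rel_ideal assms])
  fix u v and \<rho> :: "('a, 'k) falg" assume \<rho>: "\<rho> \<in> relators scale"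
  then obtain p where p: "\<rho> \<in> degpart (int p)" and d\<rho>: "form_d \<rho> \<in> rel_ideal scale"
    using relators_degpart[OF \<rho>] by (metis of_nat_0 of_nat_1)
  have \<rho>I: "\<rho> \<in> rel_ideal scale" by (rule relators_rel_ideal[OF \<rho>])
  have "form_d (mon u * (\<rho> * mon v)) = form_d (mon u) * \<rho> * mon v
     + fscale ((-1) ^ wdeg (FWord u))
        (mon u * form_d \<rho> * mon v + fscale ((-1) ^ p) (mon u * \<rho> * form_d (mon v)))"
    by (simp add: form_d_mult[OF mon_degpart] form_d_mult[OF p] distrib_left fscale_mult_right mult.assoc)
  also have "\<dots> \<in> rel_ideal scale"
    by (intro falg.subspace_add[OF subspace_rel_ideal] falg.subspace_scale[OF subspace_rel_ideal]
        rel_ideal_mult d\<rho> \<rho>I)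
  finally show "form_d (mon u * \<rho> * mon v) \<in> rel_ideal scale" by (simp add: mult.assoc)
qed

lemma degpart_relator: "\<rho> \<in> relators scale \<Longrightarrow> \<exists>p. \<rho> \<in> degpart (int p)"
  using relators_degpart by (metis of_nat_0 of_nat_1)

text \<open>The boundary acts on the last differential of \<open>u \<rho> v\<close>. If that lies in
  \<open>v\<close>, or if \<open>\<rho>\<close> has degree \<open>0\<close>, the relator is carried
  along as a factor or the boundary is zero. If it lies in \<open>\<rho>\<close>, the relator of
  degree \<open>1\<close> is replaced by a commutator with the matching relation of degree
  \<open>0\<close>.\<close>

lemma b_op_rel_ideal:
  assumes "x \<in> rel_ideal scale"
  shows "b_op x \<in> rel_ideal scale"
proof (rule rel_ideal_preserved[OF b_op_linear _ subspace_rel_ideal assms])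
  fix u v and \<rho> :: "('a, 'k) falg" assume \<rho>: "\<rho> \<in> relators scale"
  have \<rho>I: "\<rho> \<in> rel_ideal scale" by (rule relators_rel_ideal[OF \<rho>])
  note I = falg.subspace_scale[OF subspace_rel_ideal] falg.subspace_diff[OF subspace_rel_ideal]
  let ?m = "mon :: 'a gen list \<Rightarrow> ('a, 'k) falg"
  show "b_op (?m u * \<rho> * ?m v) \<in> rel_ideal scale"
  proof (cases v rule: word_cases)
    case (dif v1 c v2)
    obtain p where "\<rho> \<in> degpart (int p)" using degpart_relator[OF \<rho>] by blast
    then have x: "?m u * \<rho> * ?m v1 \<in> degpart (int (wdeg (FWord u) + p + wdeg (FWord v1)))"
      using degpart_mult[OF degpart_mult[OF mon_degpart] mon_degpart] by simp
    have z: "?m v2 \<in> degpart 0" using dif by (intro mon_degpartI) simp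
    have "b_op (?m u * \<rho> * ?m v1 * df c * ?m v2) =
        fscale ((-1) ^ (wdeg (FWord u) + p + wdeg (FWord v1)))
          ((?m v2 * ?m u) * \<rho> * (?m v1 * el c) - (el c * ?m v2 * ?m u) * \<rho> * ?m v1)"
      unfolding b_op_form[OF x z] by (simp only: mult.assoc)
    also have "\<dots> \<in> rel_ideal scale" by (intro I rel_ideal_mult \<rho>I)
    finally show ?thesis using dif by (simp add: mon_split mult.assoc)
  next
    case zero
    then have v: "?m v \<in> degpart 0" by (intro mon_degpartI) simp
    define n where "n = wdeg (FWord u)"
    have u: "?m u \<in> degpart (int n)" by (simp add: n_def mon_degpartI)
    have deg1: "b_op (?m u * \<rho> * ?m v) \<in> rel_ideal scale" if \<rho>0: "\<rho> \<in> degpart 0"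
    proof (cases u rule: word_cases)
      case zero
      then have "?m u \<in> degpart 0" by (intro mon_degpartI) simp
      then have "?m u * \<rho> * ?m v \<in> degpart (0 + 0 + 0)" using \<rho>0 v by (intro degpart_mult)
      then show ?thesis by (simp add: b_op_degree_0 falg.subspace_0[OF subspace_rel_ideal])
    next
      case (dif u1 c u2)
      have "?m u2 \<in> degpart 0" using dif by (intro mon_degpartI) simp
      then have "?m u2 * \<rho> * ?m v \<in> degpart (0 + 0 + 0)" using \<rho>0 v by (intro degpart_mult)
      then have "b_op (?m u1 * df c * (?m u2 * \<rho> * ?m v)) =
          fscale ((-1) ^ wdeg (FWord u1))
            (?m u2 * \<rho> * (?m v * ?m u1 * el c) - (el c * ?m u2) * \<rho> * (?m v * ?m u1))"
        using b_op_form[OF mon_degpart[of u1], of "?m u2 * \<rho> * ?m v" c] by (simp add: mult.assoc)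
      also have "\<dots> \<in> rel_ideal scale" by (intro I rel_ideal_mult \<rho>I)
      finally show ?thesis using dif by (simp add: mon_split mult.assoc)
    qed
    \<comment> \<open>What stands around the relator, read cyclically.\<close>
    define y where "y = ?m v * ?m u"
    have b1: "b_op (?m u * df a * ?m v) = fscale ((-1) ^ n) (y * el a - el a * y)" for a
      using b_op_form[OF u v] by (simp add: y_def mult.assoc)
    have el0: "el a * ?m v \<in> degpart 0" for a using degpart_mult[OF el_degpart v] by simp
    have b2: "b_op (?m u * (df a * el b) * ?m v) = fscale ((-1) ^ n) (el b * y * el a - el a * el b * y)" for a b
      using b_op_form[OF u el0[of b], of a] by (simp add: y_def mult.assoc)
    have uel: "?m u * el a \<in> degpart (int n)" for a using degpart_mult[OF u el_degpart] by simp
    have b3: "b_op (?m u * (el a * df b) * ?m v) = fscale ((-1) ^ n) (y * el a * el b - el b * y * el a)" for a b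
      using b_op_form[OF uel[of a] v, of b] by (simp add: y_def mult.assoc)
    have comm: "y * x - x * y \<in> rel_ideal scale" if "x \<in> rel_ideal scale" for x
      using that by (intro I rel_ideal_mult_left rel_ideal_mult_right)
    \<comment> \<open>For \<open>df (scale r 1)\<close> the matching element is
      \<open>el (scale r 1)\<close>, a scalar modulo the relations, and scalars commute with
      \<open>y\<close>.\<close>
    have comm': "y * x - x * y \<in> rel_ideal scale" if "x \<simeq> fscale r 1" for x r
    proof -
      have "y * x - x * y \<simeq> y * fscale r 1 - fscale r 1 * y"
        using that by (intro eqv_diff eqv_mult eqv_refl)
      then show ?thesis by (simp add: fscale_mult_left fscale_mult_right eqv_0_iff)
    qed
    note deg = falg.subspace_diff[OF subspace_degpart] falg.subspace_add[OF subspace_degpart]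
      falg.subspace_scale[OF subspace_degpart] el_degpart one_degpart
    have el_el: "el a * el b \<in> degpart 0" for a b
      using degpart_mult[OF el_degpart el_degpart, of a b] by simp
    have \<phi>_diff: "b_op (?m u * (x - y) * ?m v) = b_op (?m u * x * ?m v) - b_op (?m u * y * ?m v)"
      and \<phi>_add: "b_op (?m u * (x + y) * ?m v) = b_op (?m u * x * ?m v) + b_op (?m u * y * ?m v)"
      and \<phi>_scale: "b_op (?m u * fscale r x * ?m v) = fscale r (b_op (?m u * x * ?m v))" for x y r
      by (simp_all only: left_diff_distrib right_diff_distrib distrib_left distrib_right b_op.diff
          b_op.add b_op.scale fscale_mult_left fscale_mult_right)
    show ?thesis using \<rho>
    proof (cases rule: relators_cases)
      case (el_mult a b)
      show ?thesis by (rule deg1) (unfold el_mult, intro deg el_el)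
    next
      case el_one
      show ?thesis by (rule deg1) (unfold el_one, intro deg)
    next
      case (el_add a b)
      show ?thesis by (rule deg1) (unfold el_add, intro deg)
    next
      case (el_scale r a)
      show ?thesis by (rule deg1) (unfold el_scale, intro deg)
    next
      case (df_add a b)
      have "b_op (?m u * \<rho> * ?m v) = fscale ((-1) ^ n)
          (y * (el (a + b) - (el a + el b)) - (el (a + b) - (el a + el b)) * y)"
        unfolding df_add \<phi>_diff b1
        by (simp only: falg.scale_right_diff_distrib falg.scale_right_distrib left_diff_distrib
            right_diff_distrib distrib_left distrib_right) simp
      also have "\<dots> \<in> rel_ideal scale"
        by (rule I(1), rule comm, rule eqv_relators(3)[unfolded eqv_def])
      finally show ?thesis .
    next
      case (df_scale r a)
      have "b_op (?m u * \<rho> * ?m v) = fscale ((-1) ^ n)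
          (y * (el (scale r a) - fscale r (el a)) - (el (scale r a) - fscale r (el a)) * y)"
        unfolding df_scale \<phi>_diff \<phi>_scale b1
        by (simp only: falg.scale_right_diff_distrib fscale_mult_left fscale_mult_right
            left_diff_distrib right_diff_distrib falg.scale_scale mult.commute) simp
      also have "\<dots> \<in> rel_ideal scale"
        by (rule I(1), rule comm, rule eqv_relators(4)[unfolded eqv_def])
      finally show ?thesis .
    next
      case (df_one r)
      have "el (scale r 1) \<simeq> fscale r 1" by (rule eqv_trans[OF eqv_relators(4) eqv_scale[OF eqv_relators(2)]])
      then show ?thesis unfolding df_one b1 by (rule I(1)[OF comm'])
    next
      case (df_mult a b)
      have "b_op (?m u * \<rho> * ?m v) = fscale ((-1) ^ n)
          (y * (el (a * b) - el a * el b) - (el (a * b) - el a * el b) * y)"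
        unfolding df_mult \<phi>_diff \<phi>_add b1 b2 b3
        by (simp only: falg.scale_right_diff_distrib left_diff_distrib
            right_diff_distrib mult.assoc) simp
      also have "\<dots> \<in> rel_ideal scale"
        by (rule I(1), rule comm, rule eqv_relators(1)[unfolded eqv_def])
      finally show ?thesis .
    qed
  qed
qed

lemma eqv_b_op: "x \<simeq> y \<Longrightarrow> b_op x \<simeq> b_op y"
  using b_op_rel_ideal by (auto intro: eqv_map[OF b_op_linear])

lemma eqv_form_d: "x \<simeq> y \<Longrightarrow> form_d x \<simeq> form_d y"
  using form_d_rel_ideal by (auto intro: eqv_map[OF form_d_linear])

lemma k_op_rel_ideal: "x \<in> rel_ideal scale \<Longrightarrow> k_op x \<in> rel_ideal scale"
  unfolding k_op_def
  by (intro falg.subspace_diff[OF subspace_rel_ideal] b_op_rel_ideal form_d_rel_ideal)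

end

section \<open>Acyclicity of reduced forms\<close>

locale split_algebra = unital_algebra scale
  for scale :: "'k::comm_ring_1 \<Rightarrow> 'a::ring_1 \<Rightarrow> 'a" +
  fixes p :: "'a \<Rightarrow> 'k"
  assumes p_hom: "module_hom scale (*) p" and p_unit: "p (scale r 1) = r"
begin

lemma p_add: "p (a + b) = p a + p b" and p_scale: "p (scale r a) = r * p a" and p_one: "p 1 = 1"
  using module_hom.add[OF p_hom] module_hom.scale[OF p_hom] p_unit[of 1] by simp_all

text \<open>
  On \<open>\<Omega> = A \<otimes> \<Lambda>\<close>, with \<open>\<Lambda>\<close> spanned by the \<open>da\<^sub>1 \<dots> da\<^sub>n\<close>, the projection \<open>P\<close> and the contraction \<open>h\<close> are
  \<open>a\<^sub>0 \<lambda> \<mapsto> p a\<^sub>0 \<lambda>\<close> and \<open>a\<^sub>0 da\<^sub>1 \<lambda> \<mapsto> p a\<^sub>0 (a\<^sub>1 - p a\<^sub>1) \<lambda>\<close>. In order to define them on words, an accumulator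
  \<open>c\<close> records the letters already read: \<open>P_op c x\<close> and \<open>h_op c x\<close> are \<open>P (c x)\<close> and \<open>h (c x)\<close>.
\<close>

fun Pw :: "'a \<Rightarrow> 'a gen list \<Rightarrow> ('a, 'k) falg" where
  "Pw c [] = const (p c)"
| "Pw c (Elt a # w) = Pw (c * a) w"
| "Pw c (Dif a # w) = fscale (p c) (form_d (el a * mon w)) - fscale (p (c * a)) (form_d (mon w))"

definition P_op :: "'a \<Rightarrow> ('a, 'k) falg \<Rightarrow> ('a, 'k) falg" where
  "P_op c = lin_ext (\<lambda>w. Pw c (letters w))"

fun hw :: "'a \<Rightarrow> 'a gen list \<Rightarrow> ('a, 'k) falg" where
  "hw c [] = 0"
| "hw c (Elt a # w) = hw (c * a) w"
| "hw c (Dif a # w) = fscale (p c) (el a * mon w - P_op a (mon w)) - fscale (p (c * a)) (mon w - P_op 1 (mon w))"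

definition h_op :: "'a \<Rightarrow> ('a, 'k) falg \<Rightarrow> ('a, 'k) falg" where
  "h_op c = lin_ext (\<lambda>w. hw c (letters w))"

lemma P_op_linear: "linear_op (P_op c)" and h_op_linear: "linear_op (h_op c)"
  unfolding P_op_def h_op_def by (rule lin_ext_linear)+

sublocale P_op: module_hom fscale fscale "P_op c" for c by (rule P_op_linear)
sublocale h_op: module_hom fscale fscale "h_op c" for c by (rule h_op_linear)

lemma P_op_mon: "P_op c (mon w) = Pw c w" and h_op_mon: "h_op c (mon w) = hw c w"
  by (simp_all add: P_op_def h_op_def lin_ext_mon)

lemmas lin_simps = distrib_left distrib_right right_diff_distrib left_diff_distrib
  fscale_mult_left fscale_mult_right falg.scale_right_distrib falg.scale_right_diff_distrib
  form_d.add form_d.scale form_d.diff P_op.add P_op.scale P_op.diff h_op.add h_op.scale h_op.diff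

lemma P_op_one: "P_op c 1 = const (p c)" and h_op_one: "h_op c 1 = 0"
  using P_op_mon[of c "[]"] h_op_mon[of c "[]"] by (simp_all add: mon_Nil)

lemma P_op_el_mult: "P_op c (el a * x) = P_op (c * a) x"
proof (induction x rule: falg_induct)
  case (mon w)
  show ?case by (simp add: mon_Elt[symmetric] P_op_mon)
qed (simp_all add: lin_simps P_op.zero)

lemma h_op_el_mult: "h_op c (el a * x) = h_op (c * a) x"
proof (induction x rule: falg_induct)
  case (mon w)
  show ?case by (simp add: mon_Elt[symmetric] h_op_mon)
qed (simp_all add: lin_simps h_op.zero)

text \<open>From \<open>c da x = c d(a x) - c a d(x)\<close>: exact forms lie in \<Lambda>, where
  the projection applies \<open>p\<close> to the coefficient in front.\<close>

lemma P_op_df_mult: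
  "P_op c (df a * x) = fscale (p c) (form_d (el a * x)) - fscale (p (c * a)) (form_d x)"
proof (induction x rule: falg_induct)
  case (mon w)
  show ?case by (simp add: mon_Dif[symmetric] P_op_mon)
next
  case (scale r x)
  then show ?case by (simp add: lin_simps mult.commute)
next
  case (add x y)
  then show ?case by (simp add: lin_simps)
qed (simp_all add: P_op.zero form_d.zero)

text \<open>The same rewriting of \<open>c da x\<close>, combined with
  \<open>h (d y) = y - P y\<close>, the homotopy formula that is proved afterwards.\<close>

lemma h_op_df_mult:
  "h_op c (df a * x) = fscale (p c) (el a * x - P_op a x) - fscale (p (c * a)) (x - P_op 1 x)"
proof (induction x rule: falg_induct)
  case (mon w)
  show ?case by (simp add: mon_Dif[symmetric] h_op_mon)
next
  case (scale r x)
  then show ?case by (simp add: lin_simps mult.commute)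
next
  case (add x y)
  then show ?case by (simp add: lin_simps)
qed (simp_all add: P_op.zero h_op.zero)

text \<open>The sum and scalar relators of degree \<open>0\<close> are absorbed into the
  accumulator, so linearity in it makes the operators respect them.\<close>

lemma P_op_add_acc: "P_op (c + c') x = P_op c x + P_op c' x"
  and h_op_add_acc: "h_op (c + c') x = h_op c x + h_op c' x"
  and P_op_scale_acc: "P_op (scale r c) x = fscale r (P_op c x)"
  and h_op_scale_acc: "h_op (scale r c) x = fscale r (h_op c x)"
proof -
  have ca: "const (r + r') = const r + const r'" and cs: "const (r * r') = fscale r (const r')" for r r' :: 'k
    by (simp_all add: const_def single_add fscale_single)
  have P: "Pw (c + c') w = Pw c w + Pw c' w" "Pw (scale r c) w = fscale r (Pw c w)"
    and h: "hw (c + c') w = hw c w + hw c' w" "hw (scale r c) w = fscale r (hw c w)"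
    for r c c' and w :: "'a gen list"
  proof (induction w arbitrary: c c')
    case (Cons g w)
    { case 1 show ?case using Cons by (cases g) (simp_all add: distrib_right p_add falg.scale_left_distrib) }
    { case 2 show ?case using Cons
        by (cases g) (simp_all add: p_scale scale_mult_left falg.scale_right_diff_distrib) }
    { case 3 show ?case using Cons by (cases g) (simp_all add: distrib_right p_add falg.scale_left_distrib) }
    { case 4 show ?case using Cons
        by (cases g) (simp_all add: p_scale scale_mult_left falg.scale_right_diff_distrib) }
  qed (simp_all add: p_add p_scale ca cs)
  show "P_op (c + c') x = P_op c x + P_op c' x"
    by (induction x rule: falg_induct) (simp_all add: P_op.zero P_op.add P_op.scale P_op_mon P falg.scale_right_distrib)
  show "h_op (c + c') x = h_op c x + h_op c' x"
    by (induction x rule: falg_induct) (simp_all add: h_op.zero h_op.add h_op.scale h_op_mon h falg.scale_right_distrib)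
  show "P_op (scale r c) x = fscale r (P_op c x)"
    by (induction x rule: falg_induct)
      (simp_all add: P_op.zero P_op.add P_op.scale P_op_mon P falg.scale_right_distrib mult.commute)
  show "h_op (scale r c) x = fscale r (h_op c x)"
    by (induction x rule: falg_induct)
      (simp_all add: h_op.zero h_op.add h_op.scale h_op_mon h falg.scale_right_distrib mult.commute)
qed

lemmas I_intros = falg.subspace_0[OF subspace_rel_ideal] falg.subspace_add[OF subspace_rel_ideal]
  falg.subspace_diff[OF subspace_rel_ideal] falg.subspace_scale[OF subspace_rel_ideal]
  form_d_rel_ideal rel_ideal_mult_left rel_ideal_mult_right

text \<open>A relator of degree \<open>0\<close> disappears in the accumulator without remainder.
  For one of degree \<open>1\<close> the terms with \<open>p\<close> of a product cancel, and
  \<open>p c\<close> times \<open>d\<close> of the matching relation of degree \<open>0\<close>,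
  multiplied by \<open>x\<close>, is left.\<close>

lemma P_op_relator:
  assumes "\<rho> \<in> relators scale"
  shows "P_op c (\<rho> * x) \<in> rel_ideal scale"
proof -
  have d: "form_d x \<in> rel_ideal scale" if "x \<in> rel_ideal scale" for x :: "('a, 'k) falg"
    by (rule form_d_rel_ideal[OF that])
  have m: "form_d (y * x) \<in> rel_ideal scale" if "y \<in> rel_ideal scale" for y :: "('a, 'k) falg"
    by (rule form_d_rel_ideal[OF rel_ideal_mult_right[OF that]])
  note R = eqv_relators[unfolded eqv_def]
  show ?thesis
    using assms
  proof (cases rule: relators_cases)
    case (el_mult a b)
    then show ?thesis
      by (simp add: left_diff_distrib P_op.diff P_op_el_mult mult.assoc I_intros)
  next
    case el_one
    then show ?thesis by (simp add: left_diff_distrib P_op.diff P_op_el_mult I_intros)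
  next
    case (el_add a b)
    then show ?thesis
      by (simp add: left_diff_distrib P_op.diff P_op_el_mult distrib_left P_op_add_acc I_intros)
  next
    case (el_scale r a)
    then show ?thesis
      by (simp add: left_diff_distrib P_op.diff P_op_el_mult fscale_mult_left P_op.scale
          scale_mult_right P_op_scale_acc I_intros)
  next
    case (df_add a b)
    have "P_op c (\<rho> * x) = fscale (p c) (form_d ((el (a + b) - (el a + el b)) * x))"
      by (simp add: df_add lin_simps P_op_df_mult p_add falg.scale_left_distrib)
    then show ?thesis using m[OF R(3)] by (simp add: I_intros)
  next
    case (df_scale r a)
    have "P_op c (\<rho> * x) = fscale (p c) (form_d ((el (scale r a) - fscale r (el a)) * x))"
      by (simp add: df_scale lin_simps P_op_df_mult p_scale scale_mult_right mult.commute)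
    then show ?thesis using m[OF R(4)] by (simp add: I_intros)
  next
    case (df_one r)
    have "el (scale r 1) - fscale r 1 \<in> rel_ideal scale"
      using eqv_trans[OF eqv_relators(4) eqv_scale[OF eqv_relators(2)]] by (simp add: eqv_def)
    moreover have "P_op c (\<rho> * x) = fscale (p c) (form_d ((el (scale r 1) - fscale r 1) * x))"
      by (simp add: df_one lin_simps P_op_df_mult p_scale scale_mult_right mult.commute)
    ultimately show ?thesis using m by (simp add: I_intros)
  next
    case (df_mult a b)
    have "P_op c (\<rho> * x) = fscale (p c) (form_d ((el (a * b) - el a * el b) * x))"
      by (simp add: df_mult lin_simps P_op_df_mult P_op_el_mult mult.assoc)
    then show ?thesis using m[OF R(1)] by (simp add: I_intros)
  qed
qed

lemma P_op_rel_ideal: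
  assumes "x \<in> rel_ideal scale"
  shows "P_op c x \<in> rel_ideal scale"
proof (rule rel_ideal_preserved[OF P_op_linear _ subspace_rel_ideal assms])
  fix u v and \<rho> :: "('a, 'k) falg" assume \<rho>: "\<rho> \<in> relators scale"
  have \<rho>I: "\<rho> \<in> rel_ideal scale" by (rule relators_rel_ideal[OF \<rho>])
  have "P_op c (mon u * (\<rho> * mon v)) \<in> rel_ideal scale"
  proof (induction u arbitrary: c)
    case Nil
    then show ?case using P_op_relator[OF \<rho>] by (simp add: mon_Nil)
  next
    case (Cons g u)
    then show ?case
      by (cases g) (simp_all add: mon_Elt mon_Dif mult.assoc P_op_el_mult P_op_df_mult I_intros \<rho>I)
  qed
  then show "P_op c (mon u * \<rho> * mon v) \<in> rel_ideal scale" by (simp add: mult.assoc)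
qed

lemma h_op_relator:
  assumes "\<rho> \<in> relators scale"
  shows "h_op c (\<rho> * x) \<in> rel_ideal scale"
proof -
  note R = eqv_relators[unfolded eqv_def]
  have m: "y * x \<in> rel_ideal scale" if "y \<in> rel_ideal scale" for y :: "('a, 'k) falg"
    by (rule rel_ideal_mult_right[OF that])
  show ?thesis
    using assms
  proof (cases rule: relators_cases)
    case (el_mult a b)
    then show ?thesis
      by (simp add: left_diff_distrib h_op.diff h_op_el_mult mult.assoc I_intros)
  next
    case el_one
    then show ?thesis by (simp add: left_diff_distrib h_op.diff h_op_el_mult I_intros)
  next
    case (el_add a b)
    then show ?thesis
      by (simp add: left_diff_distrib h_op.diff h_op_el_mult distrib_left h_op_add_acc I_intros)
  next
    case (el_scale r a)
    then show ?thesis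
      by (simp add: left_diff_distrib h_op.diff h_op_el_mult fscale_mult_left h_op.scale
          scale_mult_right h_op_scale_acc I_intros)
  next
    case (df_add a b)
    have "h_op c (\<rho> * x) = fscale (p c) ((el (a + b) - (el a + el b)) * x)"
      by (simp add: df_add lin_simps h_op_df_mult p_add falg.scale_left_distrib P_op_add_acc)
    then show ?thesis using m[OF R(3)] by (simp add: I_intros)
  next
    case (df_scale r a)
    have "h_op c (\<rho> * x) = fscale (p c) ((el (scale r a) - fscale r (el a)) * x)"
      by (simp add: df_scale lin_simps h_op_df_mult p_scale scale_mult_right mult.commute P_op_scale_acc)
    then show ?thesis using m[OF R(4)] by (simp add: I_intros)
  next
    case (df_one r)
    have "el (scale r 1) - fscale r 1 \<in> rel_ideal scale"
      using eqv_trans[OF eqv_relators(4) eqv_scale[OF eqv_relators(2)]] by (simp add: eqv_def)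
    moreover have "h_op c (\<rho> * x) = fscale (p c) ((el (scale r 1) - fscale r 1) * x)"
      by (simp add: df_one lin_simps h_op_df_mult p_scale scale_mult_right mult.commute P_op_scale_acc)
    ultimately show ?thesis using m by (simp add: I_intros)
  next
    case (df_mult a b)
    have "h_op c (\<rho> * x) = fscale (p c) ((el (a * b) - el a * el b) * x)"
      by (simp add: df_mult lin_simps h_op_df_mult h_op_el_mult P_op_el_mult mult.assoc)
    then show ?thesis using m[OF R(1)] by (simp add: I_intros)
  qed
qed

lemma h_op_rel_ideal:
  assumes "x \<in> rel_ideal scale"
  shows "h_op c x \<in> rel_ideal scale"
proof (rule rel_ideal_preserved[OF h_op_linear _ subspace_rel_ideal assms])
  fix u v and \<rho> :: "('a, 'k) falg" assume \<rho>: "\<rho> \<in> relators scale"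
  have \<rho>I: "\<rho> \<in> rel_ideal scale" by (rule relators_rel_ideal[OF \<rho>])
  have "h_op c (mon u * (\<rho> * mon v)) \<in> rel_ideal scale"
  proof (induction u arbitrary: c)
    case Nil
    then show ?case using h_op_relator[OF \<rho>] by (simp add: mon_Nil)
  next
    case (Cons g u)
    then show ?case
      by (cases g) (simp_all add: mon_Elt mon_Dif mult.assoc h_op_el_mult h_op_df_mult I_intros \<rho>I
          P_op_rel_ideal)
  qed
  then show "h_op c (mon u * \<rho> * mon v) \<in> rel_ideal scale" by (simp add: mult.assoc)
qed

lemma P_op_form_d: "P_op c (form_d x) = fscale (p c) (form_d x)"
proof (induction x arbitrary: c rule: falg_induct)
  case (mon w)
  show ?case
  proof (induction w arbitrary: c)
    case Nil
    then show ?case by (simp add: mon_Nil P_op.zero)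
  next
    case (Cons g w)
    show ?case
    proof (cases g)
      case (Elt a)
      then show ?thesis
        using Cons by (simp add: mon_Elt form_d_el_mult P_op.add P_op_df_mult P_op_el_mult lin_simps)
    next
      case (Dif a)
      then show ?thesis
        by (simp add: mon_Dif form_d_df_mult P_op.neg P_op_df_mult form_d_el_mult)
    qed
  qed
qed (simp_all add: form_d.zero P_op.zero lin_simps mult.commute)

text \<open>On \<open>a0 \<lambda>\<close> with \<lambda> in \<Lambda> the reason is that
  \<open>d (a0 \<lambda>) = da0 \<lambda>\<close>, from which the contraction returns
  \<open>(a0 - p a0) \<lambda>\<close>. Congruence replaces equality because
  \<open>el c * el a\<close> has to be merged into \<open>el (c * a)\<close>.\<close>

lemma h_op_form_d: "h_op 1 (form_d (el c * x)) \<simeq> el c * x - P_op c x"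
proof (induction x arbitrary: c rule: falg_induct)
  case (mon w)
  show ?case
  proof (induction w arbitrary: c)
    case Nil
    have "h_op 1 (form_d (el c * mon [])) = el c - const (p c)"
      using h_op_df_mult[of 1 c 1]
      by (simp add: mon_Nil p_one P_op_one h_op.zero const_eq_fscale)
    then show ?case by (simp add: mon_Nil P_op_one)
  next
    case (Cons g w)
    show ?case
    proof (cases g)
      case (Elt a)
      have "el c * (el a * mon w) \<simeq> el (c * a) * mon w"
        unfolding mult.assoc[symmetric] by (intro eqv_mult eqv_refl eqv_sym[OF eqv_relators(1)])
      then have "h_op 1 (form_d (el c * (el a * mon w))) \<simeq> h_op 1 (form_d (el (c * a) * mon w))"
        by (intro eqv_map[OF h_op_linear] eqv_form_d) (auto intro: h_op_rel_ideal)
      also have "\<dots> \<simeq> el (c * a) * mon w - P_op (c * a) (mon w)" by (rule Cons)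
      also have "\<dots> \<simeq> el c * (el a * mon w) - P_op (c * a) (mon w)"
        unfolding mult.assoc[symmetric] by (intro eqv_diff eqv_mult eqv_refl eqv_relators(1))
      finally show ?thesis using Elt by (simp add: mon_Elt P_op_el_mult)
    next
      case (Dif a)
      let ?w = "mon w :: ('a, 'k) falg"
      \<comment> \<open>The Leibniz rule read backwards makes everything after the first
        coefficients exact, so that \<open>P_op_form_d\<close> applies.\<close>
      have eq: "el c * (df a * ?w) = el c * form_d (el a * ?w) - el c * el a * form_d ?w"
        by (simp add: form_d_el_mult distrib_left mult.assoc)
      have "form_d (el c * (df a * ?w))
          = df c * form_d (el a * ?w) - form_d ((el c * el a) * form_d ?w)"
        unfolding eq by (simp add: form_d.diff form_d_el_mult form_d_df_mult mult.assoc distrib_left)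
      also have "\<dots> \<simeq> df c * form_d (el a * ?w) - form_d (el (c * a) * form_d ?w)"
        by (intro eqv_diff eqv_refl eqv_form_d eqv_mult eqv_sym[OF eqv_relators(1)])
      also have "\<dots> = df c * form_d (el a * ?w) - df (c * a) * form_d ?w"
        by (simp add: form_d_el_mult)
      finally have "h_op 1 (form_d (el c * (df a * ?w)))
          \<simeq> h_op 1 (df c * form_d (el a * ?w) - df (c * a) * form_d ?w)"
        by (intro eqv_map[OF h_op_linear]) (auto intro: h_op_rel_ideal)
      also have "\<dots> = el c * form_d (el a * ?w) - fscale (p c) (form_d (el a * ?w))
          - (el (c * a) * form_d ?w - fscale (p (c * a)) (form_d ?w))"
        by (simp add: h_op.diff h_op_df_mult P_op_form_d p_one)
      also have "\<dots> \<simeq> el c * form_d (el a * ?w) - fscale (p c) (form_d (el a * ?w))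
          - (el c * el a * form_d ?w - fscale (p (c * a)) (form_d ?w))"
        by (intro eqv_diff eqv_mult eqv_refl eqv_relators(1))
      also have "\<dots> = el c * (df a * ?w) - P_op c (df a * ?w)"
        unfolding eq by (simp add: P_op_df_mult)
      finally show ?thesis using Dif by (simp add: mon_Dif)
    qed
  qed
next
  case zero
  then show ?case by (simp add: form_d.zero h_op.zero P_op.zero)
next
  case (add x y)
  then show ?case
    using eqv_add[OF add(1)[of c] add(2)[of c]] by (simp add: lin_simps algebra_simps)
next
  case (scale r x)
  then show ?case using eqv_scale[OF scale[of c], of r] by (simp add: lin_simps)
qed

text \<open>The projection has values in \<Lambda>, and a product of differentials is
  \<open>1\<close> or exact. The degree of the primitive is recorded, since exactness is wanted
  degree by degree.\<close>

lemma P_op_closed: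
  assumes "x \<in> degpart m"
  shows "\<exists>r. \<exists>y\<in>degpart (m - 1). P_op c x = const r + form_d y"
  using assms
proof (induction x rule: degpart_induct)
  case zero
  then show ?case
    by (intro exI[of _ 0] bexI[of _ 0])
      (simp_all add: P_op.zero const_eq_fscale form_d.zero falg.subspace_0[OF subspace_degpart])
next
  case (add x y)
  then obtain r u r' u' where "u \<in> degpart (m - 1)" "P_op c x = const r + form_d u"
    "u' \<in> degpart (m - 1)" "P_op c y = const r' + form_d u'" by blast
  then show ?case
    by (intro exI[of _ "r + r'"] bexI[of _ "u + u'"])
      (simp_all add: P_op.add const_eq_fscale form_d.add falg.scale_left_distrib
        falg.subspace_add[OF subspace_degpart])
next
  case (scale s x)
  then obtain r u where "u \<in> degpart (m - 1)" "P_op c x = const r + form_d u" by blast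
  then show ?case
    by (intro exI[of _ "s * r"] bexI[of _ "fscale s u"])
      (simp_all add: P_op.scale const_eq_fscale form_d.scale falg.scale_right_distrib
        falg.subspace_scale[OF subspace_degpart])
next
  case (mon w)
  then show ?case
  proof (induction w arbitrary: c)
    case Nil
    then show ?case
      by (intro exI[of _ "p c"] bexI[of _ 0])
        (simp_all add: mon_Nil P_op_one form_d.zero falg.subspace_0[OF subspace_degpart])
  next
    case (Cons g w)
    show ?case
    proof (cases g)
      case (Elt a)
      then show ?thesis using Cons by (simp add: mon_Elt P_op_el_mult)
    next
      case (Dif a)
      let ?w = "mon w :: ('a, 'k) falg"
      have w: "?w \<in> degpart (m - 1)" using Cons.prems Dif by (intro mon_degpartI) simp
      then have "el a * ?w \<in> degpart (m - 1)" using degpart_mult[OF el_degpart w] by simp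
      then have "fscale (p c) (el a * ?w) - fscale (p (c * a)) ?w \<in> degpart (m - 1)"
        using w by (intro falg.subspace_diff[OF subspace_degpart] falg.subspace_scale[OF subspace_degpart])
      then show ?thesis using Dif
        by (intro exI[of _ 0] bexI[of _ "fscale (p c) (el a * ?w) - fscale (p (c * a)) ?w"])
          (simp_all add: mon_Dif P_op_df_mult const_eq_fscale form_d.diff form_d.scale)
    qed
  qed
qed

text \<open>By the homotopy formula a closed \<open>x\<close> equals its projection modulo the
  relations, which is a constant plus an exact form. The constants are why reduced forms are the
  acyclic ones.\<close>

lemma form_d_exact:
  assumes x: "x \<in> degpart m" and dx: "form_d x \<in> N_\<Omega> scale"
  shows "\<exists>y\<in>degpart (m - 1). x - form_d y \<in> N_\<Omega> scale"
proof -
  obtain z r where z: "z \<in> rel_ideal scale" "form_d x = z + const r"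
    using dx by (auto simp: N_\<Omega>_def elim!: set_plus_elim)
  have "h_op 1 (form_d x) = h_op 1 z"
    by (simp add: z h_op.add const_eq_fscale h_op.scale h_op_one)
  then have h0: "h_op 1 (form_d x) \<simeq> 0" using h_op_rel_ideal[OF z(1)] by (simp add: eqv_0_iff)
  have e1: "el 1 * x \<simeq> x" using eqv_mult[OF eqv_relators(2) eqv_refl[of x]] by simp
  have "h_op 1 (form_d x) \<simeq> h_op 1 (form_d (el 1 * x))"
    by (intro eqv_map[OF h_op_linear] eqv_form_d eqv_sym[OF e1]) (auto intro: h_op_rel_ideal)
  also have "\<dots> \<simeq> el 1 * x - P_op 1 x" by (rule h_op_form_d)
  also have "\<dots> \<simeq> x - P_op 1 x" by (intro eqv_diff e1 eqv_refl)
  finally have "x - P_op 1 x \<simeq> 0" using eqv_trans[OF eqv_sym h0] by blast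
  moreover obtain r' y where y: "y \<in> degpart (m - 1)" "P_op 1 x = const r' + form_d y"
    using P_op_closed[OF x] by blast
  ultimately have "(x - P_op 1 x) + const r' \<in> N_\<Omega> scale"
    unfolding N_\<Omega>_def by (intro set_plus_intro rangeI) (simp add: eqv_0_iff)
  then have "x - form_d y \<in> N_\<Omega> scale" by (simp add: y)
  then show ?thesis using y(1) by blast
qed

end

section \<open>The operators of the cyclic theory\<close>

definition B_op :: "('a, 'k::comm_ring_1) falg \<Rightarrow> ('a, 'k) falg" where
  "B_op = lin_ext (\<lambda>w. \<Sum>j\<le>wdeg w. (k_op ^^ j) (form_d (mon (letters w))))"

definition i_op :: "('a, 'k::comm_ring_1) falg \<Rightarrow> ('a, 'k) falg" where
  "i_op = lin_ext (\<lambda>w. b_op (\<Sum>j<wdeg w. (k_op ^^ j) (mon (letters w))))"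

lemma B_op_linear: "linear_op B_op" and i_op_linear: "linear_op i_op"
  unfolding B_op_def i_op_def by (rule lin_ext_linear)+

interpretation B_op: module_hom fscale fscale B_op by (rule B_op_linear)
interpretation i_op: module_hom fscale fscale i_op by (rule i_op_linear)

lemma k_op_pow_linear: "linear_op (k_op ^^ j)"
proof (induction j)
  case (Suc j)
  then show ?case using linear_op_compose[OF k_op_linear Suc] by (simp add: o_def)
qed (simp add: linear_op_id id_def)

interpretation k_op_pow: module_hom fscale fscale "k_op ^^ j" for j by (rule k_op_pow_linear)

lemma B_op_eq:
  assumes "x \<in> degpart m"
  shows "B_op x = (\<Sum>j<nat (m + 1). (k_op ^^ j) (form_d x))"
  using assms
proof (induction x rule: degpart_induct)
  case (mon w)
  then have "{..<nat (m + 1)} = {..wdeg (FWord w)}" by auto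
  then show ?case by (simp add: B_op_def lin_ext_mon)
qed (simp_all add: form_d.zero form_d.add form_d.scale B_op.add B_op.scale k_op_pow.zero k_op_pow.add
    k_op_pow.scale sum.distrib falg.scale_sum_right)

lemma i_op_eq:
  assumes "x \<in> degpart m"
  shows "i_op x = b_op (\<Sum>j<nat m. (k_op ^^ j) x)"
  using assms
proof (induction x rule: degpart_induct)
  case (mon w)
  then show ?case by (auto simp: i_op_def lin_ext_mon)
qed (simp_all add: i_op.add i_op.scale b_op.add b_op.zero b_op.scale k_op_pow.zero k_op_pow.add
    k_op_pow.scale sum.distrib flip: falg.scale_sum_right)

lemma neg_one_power_cong: "even i = even j \<Longrightarrow> (-1) ^ i = ((-1) ^ j :: 'k::comm_ring_1)"
  by (simp add: minus_one_power_iff)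

text \<open>The summand with index \<open>l\<close> comes from \<open>length as - l\<close>
  rotations: then the differential of the \<open>l\<close>-th entry stands last, and
  \<open>b\<close> turns it into a commutator with that entry.\<close>

lemma i_op_form:
  fixes as :: "'a list" and a0 :: 'a
  shows "i_op (el a0 * dfs as :: ('a, 'k::comm_ring_1) falg) =
    (\<Sum>l = 1..length as.
       let a = el (as ! (l - 1)); \<beta> = dfs (drop l as) * el a0 * dfs (take (l - 1) as)
       in (-1) ^ ((l - 1) * (length as - 1) + 1) * (a * \<beta> - \<beta> * a))"
proof -
  let ?n = "length as" and ?x = "el a0 * dfs as :: ('a, 'k) falg"
  define \<beta> :: "nat \<Rightarrow> ('a, 'k) falg" where "\<beta> l = dfs (drop l as) * el a0 * dfs (take (l - 1) as)" for l
  have x: "?x \<in> degpart (int ?n)" using degpart_mult[OF el_degpart dfs_degpart, of a0 as] by simp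
  have summand: "b_op ((k_op ^^ (?n - l)) ?x) =
      (-1) ^ ((l - 1) * (?n - 1) + 1) * (el (as ! (l - 1)) * \<beta> l - \<beta> l * el (as ! (l - 1)))"
    if l: "l \<in> {1..?n}" for l
  proof -
    obtain i where i: "l = Suc i" "i < ?n" using l by (cases l) auto
    have n: "?n - (?n - l) = Suc i" "?n - l \<le> ?n" using i by auto
    have "\<beta> l \<in> degpart (int (?n - Suc i) + 0 + int i)"
      using dfs_degpart[of "drop (Suc i) as"] dfs_degpart[of "take i as"] i
      unfolding \<beta>_def by (intro degpart_mult el_degpart) (simp_all add: min_def)
    then have \<beta>: "\<beta> l \<in> degpart (int (?n - 1))" using i by (simp add: of_nat_diff)
    have tk: "(dfs (take (Suc i) as) :: ('a, 'k) falg) = dfs (take i as) * df (as ! i)"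
      using i by (simp add: take_Suc_conv_app_nth dfs_append dfs_Cons)
    have "(k_op ^^ (?n - l)) ?x = fscale ((-1) ^ ((?n - l) * (?n - 1))) (\<beta> l * df (as ! i))"
      unfolding k_op_rotate[OF n(2)] n(1) tk by (simp add: \<beta>_def i mult.assoc)
    then have "b_op ((k_op ^^ (?n - l)) ?x) =
        fscale ((-1) ^ ((?n - l) * (?n - 1)) * (-1) ^ (?n - 1)) (\<beta> l * el (as ! i) - el (as ! i) * \<beta> l)"
      by (simp only: b_op.scale b_op_mult_df[OF \<beta>] falg.scale_scale)
    also have "(-1) ^ ((?n - l) * (?n - 1)) * (-1) ^ (?n - 1) = ((-1) ^ ((l - 1) * (?n - 1)) :: 'k)"
    proof -
      obtain k where k: "?n = Suc (i + k)" using i(2) less_imp_Suc_add by blast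
      \<comment> \<open>The exponents of the two signs add up to \<open>n (n - 1)\<close>, with
        \<open>n\<close> the length, so they have the same parity.\<close>
      have "even ((?n - l) * (?n - 1) + (?n - 1) + (l - 1) * (?n - 1))"
      proof -
        have "(?n - l) * (?n - 1) + (?n - 1) + (l - 1) * (?n - 1) = (i + k) * Suc (i + k)"
          unfolding k i(1) by (simp add: algebra_simps)
        then show ?thesis by simp
      qed
      then have "even ((?n - l) * (?n - 1) + (?n - 1)) \<longleftrightarrow> even ((l - 1) * (?n - 1))"
        by presburger
      then show ?thesis unfolding power_add[symmetric] by (rule neg_one_power_cong)
    qed
    also have "fscale \<dots> (\<beta> l * el (as ! i) - el (as ! i) * \<beta> l) =
        (-1) ^ ((l - 1) * (?n - 1) + 1) * (el (as ! i) * \<beta> l - \<beta> l * el (as ! i))"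
      unfolding neg_one_power_fscale by (simp add: falg.scale_right_diff_distrib)
    finally show ?thesis by (simp add: i)
  qed
  have "i_op ?x = (\<Sum>j<?n. b_op ((k_op ^^ j) ?x))"
    using i_op_eq[OF x] by (simp add: b_op.sum)
  also have "\<dots> = (\<Sum>l\<in>{1..?n}. b_op ((k_op ^^ (?n - l)) ?x))"
    by (rule sum.reindex_bij_witness[of _ "\<lambda>l. ?n - l" "\<lambda>j. ?n - j"]) auto
  also have "\<dots> = (\<Sum>l\<in>{1..?n}. (-1) ^ ((l - 1) * (?n - 1) + 1) *
      (el (as ! (l - 1)) * \<beta> l - \<beta> l * el (as ! (l - 1))))"
    by (rule sum.cong) (use summand in auto)
  finally show ?thesis by (simp add: \<beta>_def Let_def)
qed

text \<open>Commutators are decomposed below without regard to degree; the components of the right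
  degrees are extracted afterwards.\<close>

definition proj :: "int \<Rightarrow> ('a, 'k::comm_ring_1) falg \<Rightarrow> ('a, 'k) falg" where
  "proj m = lin_ext (\<lambda>w. if int (wdeg w) = m then mon (letters w) else 0)"

lemma proj_linear: "linear_op (proj m)"
  unfolding proj_def by (rule lin_ext_linear)

interpretation proj: module_hom fscale fscale "proj m" for m by (rule proj_linear)

lemma proj_degpart: "x \<in> degpart m' \<Longrightarrow> proj m x = (if m' = m then x else 0)"
proof (induction x rule: degpart_induct)
  case (mon w)
  then show ?case by (simp add: proj_def lin_ext_mon)
qed (simp_all add: proj.add proj.scale)

lemma proj_in_degpart: "proj m x \<in> degpart m"
proof (induction x rule: falg_induct)
  case (mon w)
  show ?case
    by (subst proj_degpart[OF mon_degpart]) (simp add: mon_degpartI falg.subspace_0[OF subspace_degpart])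
qed (simp_all add: proj.add proj.scale falg.subspace_0[OF subspace_degpart]
    falg.subspace_add[OF subspace_degpart] falg.subspace_scale[OF subspace_degpart])

lemma proj_b_op: "proj m (b_op x) = b_op (proj (m + 1) x)"
proof (induction x rule: falg_induct)
  case (mon w)
  show ?case
    by (subst proj_degpart[OF b_op_degpart[OF mon_degpart]], subst proj_degpart[OF mon_degpart])
      (auto simp: b_op.zero)
qed (simp_all add: proj.add proj.scale b_op.add b_op.scale b_op.zero proj.zero)

lemma proj_form_d: "proj m (form_d x) = form_d (proj (m - 1) x)"
proof (induction x rule: falg_induct)
  case (mon w)
  show ?case
    by (subst proj_degpart[OF form_d_degpart[OF mon_degpart]], subst proj_degpart[OF mon_degpart])
      (auto simp: form_d.zero)
qed (simp_all add: proj.add proj.scale form_d.add form_d.scale form_d.zero proj.zero)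

subsection \<open>Supercommutators\<close>

lemma subspace_supercomm: "falg.subspace supercomm"
  by (simp add: supercomm_def)

lemma supercommI:
  "x \<in> degpart (int p) \<Longrightarrow> y \<in> degpart (int q) \<Longrightarrow> x * y - fscale ((-1) ^ (p * q)) (y * x) \<in> supercomm"
  unfolding supercomm_def neg_one_power_fscale[symmetric] by (rule falg.span_base) blast

lemma b_op_supercomm:
  fixes x :: "('a, 'k::comm_ring_1) falg"
  shows "b_op x \<in> supercomm"
proof (induction x rule: falg_induct)
  case (mon w)
  show ?case
  proof (cases w rule: word_cases)
    case zero
    then show ?thesis by (simp add: b_op_degree_0 mon_degpartI falg.subspace_0[OF subspace_supercomm])
  next
    case (dif u c v)
    let ?vu = "mon v * mon u :: ('a, 'k) falg"
    have "?vu \<in> degpart (int (wdeg (FWord v)) + int (wdeg (FWord u)))"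
      by (intro degpart_mult mon_degpart)
    then have "?vu \<in> degpart (int (wdeg (FWord u)))" using dif by simp
    from supercommI[OF this, of "el c" 0] show ?thesis
      using dif by (simp add: b_op_mon mult.assoc falg.subspace_scale[OF subspace_supercomm])
  qed
qed (simp_all add: b_op.zero b_op.add b_op.scale falg.subspace_0[OF subspace_supercomm]
    falg.subspace_add[OF subspace_supercomm] falg.subspace_scale[OF subspace_supercomm])

lemma neg_one_mult_self: "((-1) ^ p * (-1) ^ p :: 'k::comm_ring_1) = 1"
  by (simp flip: power_add mult_2)

lemma form_d_supercomm:
  fixes x :: "('a, 'k::comm_ring_1) falg"
  assumes "x \<in> supercomm"
  shows "form_d x \<in> supercomm"
  using assms unfolding supercomm_def
proof (induction x rule: falg.span_induct_alt)
  case base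
  then show ?case by (simp add: form_d.zero falg.span_zero)
next
  case (step c g z)
  then obtain x y p q where g: "g = x * y - (-1) ^ (p * q) * (y * x)"
    and x: "x \<in> degpart (int p)" and y: "y \<in> degpart (int q)" by blast
  have dx: "form_d x \<in> degpart (int (Suc p))" and dy: "form_d y \<in> degpart (int (Suc q))"
    using form_d_degpart[OF x] form_d_degpart[OF y] by (simp_all add: add.commute)
  have "form_d g = (form_d x * y - fscale ((-1) ^ (Suc p * q)) (y * form_d x))
      + fscale ((-1) ^ p) (x * form_d y - fscale ((-1) ^ (p * Suc q)) (form_d y * x))"
  proof -
    have "(-1) ^ p * (-1) ^ (p * Suc q) = ((-1) ^ (p * q) :: 'k)"
      unfolding mult_Suc_right power_add by (simp flip: mult.assoc add: neg_one_mult_self)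
    then show ?thesis
      unfolding g neg_one_power_fscale
      by (simp add: form_d.diff form_d.scale form_d_mult[OF x] form_d_mult[OF y]
          falg.scale_right_distrib falg.scale_right_diff_distrib power_add mult.commute)
  qed
  also have "\<dots> \<in> supercomm"
    by (intro falg.subspace_add[OF subspace_supercomm] falg.subspace_scale[OF subspace_supercomm]
        supercommI x y dx dy)
  finally have "form_d g \<in> supercomm" .
  then show ?case
    using step(2) by (simp add: form_d.add form_d.scale falg.span_add falg.span_scale supercomm_def)
qed

text \<open>The identity \<open>[g w, y] = [g, w y] \<plusminus> [w, y g]\<close> reduces to commutators with a single letter;
  these are \<open>b (z da)\<close> and \<open>(1 - \<kappa>) (z da)\<close> up to sign.\<close>

lemma supercomm_decomp:
  fixes x :: "('a, 'k::comm_ring_1) falg"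
  assumes "x \<in> supercomm"
  shows "\<exists>y z. x = b_op y + form_d (b_op z)"
proof -
  define T :: "('a, 'k) falg set" where "T = {x. \<exists>y z. x = b_op y + form_d (b_op z)}"
  have T_b: "b_op y \<in> T" and T_db: "form_d (b_op y) \<in> T" for y
    unfolding T_def using form_d.zero b_op.zero by (metis (mono_tags, lifting) add_0 add_0_right mem_Collect_eq)+
  have T: "falg.subspace T"
  proof (rule falg.subspaceI)
    show "0 \<in> T" using T_b[of 0] by (simp add: b_op.zero)
  next
    fix x y assume "x \<in> T" "y \<in> T"
    then obtain a b c e where "x = b_op a + form_d (b_op b)" "y = b_op c + form_d (b_op e)"
      unfolding T_def by blast
    then have "x + y = b_op (a + c) + form_d (b_op (b + e))" by (simp add: b_op.add form_d.add)
    then show "x + y \<in> T" unfolding T_def by blast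
  next
    fix r x assume "x \<in> T"
    then obtain a b where "x = b_op a + form_d (b_op b)" unfolding T_def by blast
    then have "fscale r x = b_op (fscale r a) + form_d (b_op (fscale r b))"
      by (simp add: b_op.scale form_d.scale falg.scale_right_distrib)
    then show "fscale r x \<in> T" unfolding T_def by blast
  qed
  note T_intros = falg.subspace_0[OF T] falg.subspace_add[OF T] falg.subspace_diff[OF T]
    falg.subspace_scale[OF T] falg.subspace_neg[OF T]
  have el: "el a * z - z * el a \<in> T" if z: "z \<in> degpart (int k)" for a z k
  proof -
    have "el a * z - z * el a = - fscale ((-1) ^ k) (b_op (z * df a))"
      by (simp add: b_op_mult_df[OF z] neg_one_mult_self)
    then show ?thesis by (simp add: T_intros T_b)
  qed
  have df: "df a * z - fscale ((-1) ^ k) (z * df a) \<in> T" if z: "z \<in> degpart (int k)" for a z k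
  proof -
    have "df a * z - fscale ((-1) ^ k) (z * df a) = fscale ((-1) ^ k) (k_op (z * df a) - z * df a)"
      by (simp add: k_op_mult_df[OF z] falg.scale_right_diff_distrib neg_one_mult_self)
    also have "k_op (z * df a) - z * df a = - (b_op (form_d (z * df a)) + form_d (b_op (z * df a)))"
      by (simp add: k_op_def)
    finally show ?thesis by (simp only: T_intros T_b T_db)
  qed
  have word: "mon w * y - fscale ((-1) ^ (wdeg (FWord w) * q)) (y * mon w) \<in> T"
    if "y \<in> degpart (int q)" for w y q
    using that
  proof (induction w arbitrary: y q)
    case Nil
    then show ?case by (simp add: mon_Nil T_intros)
  next
    case (Cons g w)
    define k where "k = wdeg (FWord w)"
    let ?w = "mon w :: ('a, 'k) falg"
    have wy: "?w * y \<in> degpart (int (k + q))"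
      using degpart_mult[OF mon_degpart Cons.prems, of w] by (simp add: k_def)
    show ?case
    proof (cases g)
      case (Elt a)
      have ya: "y * el a \<in> degpart (int q)" using degpart_mult[OF Cons.prems el_degpart] by simp
      have "(el a * (?w * y) - ?w * y * el a) + (?w * (y * el a) - fscale ((-1) ^ (k * q)) (y * el a * ?w)) \<in> T"
        using el[OF wy] Cons.IH[OF ya] by (intro T_intros(2)) (simp_all add: k_def)
      then show ?thesis using Elt by (simp add: mon_Elt k_def mult.assoc)
    next
      case (Dif a)
      have ya: "y * df a \<in> degpart (int (Suc q))"
        using degpart_mult[OF Cons.prems df_degpart] by (simp add: add.commute)
      have "(df a * (?w * y) - fscale ((-1) ^ (k + q)) (?w * y * df a))
          + fscale ((-1) ^ (k + q)) (?w * (y * df a) - fscale ((-1) ^ (k * Suc q)) (y * df a * ?w)) \<in> T"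
        using df[OF wy] Cons.IH[OF ya] by (intro T_intros(2) T_intros(4)) (simp_all add: k_def)
      moreover have "(-1) ^ (k + q) * (-1) ^ (k * Suc q) = ((-1) ^ (Suc k * q) :: 'k)"
      proof -
        have "even (k + q + k * Suc q) \<longleftrightarrow> even (Suc k * q)" by auto
        then show ?thesis unfolding power_add[symmetric] by (rule neg_one_power_cong)
      qed
      ultimately show ?thesis
        using Dif by (simp add: mon_Dif k_def mult.assoc falg.scale_right_diff_distrib)
    qed
  qed
  have gen: "g \<in> T"
    if "g \<in> {x * y - (-1) ^ (p * q) * (y * x) | x y p q. x \<in> degpart (int p) \<and> y \<in> degpart (int q)}" for g
  proof -
    obtain x y p q where g: "g = x * y - fscale ((-1) ^ (p * q)) (y * x)"
      and x: "x \<in> degpart (int p)" and y: "y \<in> degpart (int q)"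
      using \<open>g \<in> _\<close> unfolding neg_one_power_fscale by blast
    show "g \<in> T"
      unfolding g using x
    proof (induction x rule: degpart_induct)
      case (add x z)
      then show ?case
        using T_intros(2)[OF add] by (simp add: distrib_left distrib_right falg.scale_right_distrib algebra_simps)
    next
      case (scale r x)
      then show ?case using T_intros(4)[OF scale, of r]
        by (simp add: fscale_mult_left fscale_mult_right falg.scale_right_diff_distrib mult.commute)
    next
      case (mon w)
      then show ?case using word[OF y, of w] by simp
    qed (simp add: T_intros)
  qed
  have "supercomm \<subseteq> T"
    unfolding supercomm_def by (rule falg.span_minimal[OF _ T]) (use gen in blast)
  then show ?thesis using assms unfolding T_def by blast
qed

section \<open>Identification of the operators\<close>

context unital_algebra
begin

text \<open>Modulo the relations, the elements \<open>el a0 * dfs as\<close> span. The induction on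
  the word varies \<open>Q\<close> too, so that a leading letter is absorbed by passing to the
  predicate "\<open>Q\<close> of that letter times the argument".\<close>

lemma form_induct [consumes 1, case_names zero add scale eqv form]:
  assumes x: "x \<in> degpart (int n)"
    and zero: "Q 0" and add: "\<And>x y. Q x \<Longrightarrow> Q y \<Longrightarrow> Q (x + y)"
    and scale: "\<And>r x. Q x \<Longrightarrow> Q (fscale r x)"
    and eqv: "\<And>x y. x \<simeq> y \<Longrightarrow> Q y \<Longrightarrow> Q x"
    and form: "\<And>a0 as. length as = n \<Longrightarrow> Q (el a0 * dfs as)"
  shows "Q x"
  using x
proof (induction x rule: degpart_induct)
  case (mon w)
  then have "wdeg (FWord w) = n" by simp
  then show ?case
    using zero add scale eqv form
  proof (induction w arbitrary: n Q)
    case Nil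
    have "mon [] \<simeq> el 1 * dfs []" using eqv_sym[OF eqv_relators(2)] by (simp add: mon_Nil)
    moreover have "Q (el 1 * dfs [])" using Nil.prems(1) by (intro Nil.prems(6)) simp
    ultimately show ?case by (rule Nil.prems(5))
  next
    case (Cons g w)
    note zero = Cons.prems(2) and add = Cons.prems(3) and scale = Cons.prems(4)
      and eqv = Cons.prems(5) and form = Cons.prems(6)
    show ?case
    proof (cases g)
      case (Elt a)
      have "Q (el a * mon w)"
      proof (rule Cons.IH[where n = n])
        show "wdeg (FWord w) = n" using Cons.prems(1) Elt by simp
        show "Q (el a * x)" if "x \<simeq> y" "Q (el a * y)" for x y
          by (rule eqv[OF eqv_mult[OF eqv_refl that(1)] that(2)])
        show "Q (el a * (el a0 * dfs as))" if "length as = n" for a0 as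
          by (rule eqv[OF _ form[OF that, of "a * a0"]])
            (unfold mult.assoc[symmetric], intro eqv_mult eqv_refl eqv_sym[OF eqv_relators(1)])
      qed (simp_all add: zero add scale distrib_left fscale_mult_right)
      then show ?thesis using Elt by (simp add: mon_Elt)
    next
      case (Dif a)
      then obtain m where n: "n = Suc m" "wdeg (FWord w) = m" using Cons.prems(1) by auto
      have "Q (df a * mon w)"
      proof (rule Cons.IH[where n = m])
        show "Q (df a * x)" if "x \<simeq> y" "Q (df a * y)" for x y
          by (rule eqv[OF eqv_mult[OF eqv_refl that(1)] that(2)])
        show "Q (df a * (el a0 * dfs as))" if as: "length as = m" for a0 as
        proof -
          have "Q (el 1 * dfs ((a * a0) # as) + fscale (-1) (el a * dfs (a0 # as)))"
            using as n by (intro add scale form) simp_all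
          \<comment> \<open>The rule \<open>da a0 = d(a a0) - a da0\<close> moves the coefficient to
            the front and yields two standard forms; \<open>el 1\<close> supplies the missing
            coefficient of the first.\<close>
          moreover have "df a * (el a0 * dfs as) \<simeq> el 1 * dfs ((a * a0) # as) + fscale (-1) (el a * dfs (a0 # as))"
          proof -
            have "df a * (el a0 * dfs as)
                = (df a * el a0 + el a * df a0) * dfs as - el a * dfs (a0 # as)"
              by (simp add: dfs_Cons distrib_right mult.assoc)
            also have "\<dots> \<simeq> df (a * a0) * dfs as - el a * dfs (a0 # as)"
              by (intro eqv_diff eqv_mult eqv_refl eqv_sym[OF eqv_relators(8)])
            also have "df (a * a0) * dfs as = 1 * dfs ((a * a0) # as)" by (simp add: dfs_Cons)
            also have "\<dots> - el a * dfs (a0 # as) \<simeq> el 1 * dfs ((a * a0) # as) - el a * dfs (a0 # as)"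
              by (intro eqv_diff eqv_mult eqv_refl eqv_sym[OF eqv_relators(2)])
            finally show ?thesis by simp
          qed
          ultimately show ?thesis using eqv by blast
        qed
      qed (simp_all add: n zero add scale distrib_left fscale_mult_right)
      then show ?thesis using Dif by (simp add: mon_Dif)
    qed
  qed
qed (use zero add scale in auto)

lemma linear_eqv_on_forms:
  assumes \<phi>: "form_endo scale \<phi>" and \<psi>: "form_endo scale \<psi>"
    and form: "\<And>a0 as. \<phi> (el a0 * dfs as) \<simeq> \<psi> (el a0 * dfs as)"
  shows "\<phi> x \<simeq> \<psi> x"
proof -
  have l: "linear_op \<phi>" "linear_op \<psi>"
    and I: "\<phi> ` rel_ideal scale \<subseteq> rel_ideal scale" "\<psi> ` rel_ideal scale \<subseteq> rel_ideal scale"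
    using \<phi> \<psi> by (auto simp: form_endo_def)
  note hom = module_hom.zero[OF l(1)] module_hom.zero[OF l(2)] module_hom.add[OF l(1)]
    module_hom.add[OF l(2)] module_hom.scale[OF l(1)] module_hom.scale[OF l(2)]
  show ?thesis
  proof (induction x rule: falg_induct)
    case (mon w)
    have "mon w \<in> degpart (int (wdeg (FWord w)))" by (rule mon_degpart)
    then show ?case
    proof (induction rule: form_induct)
      case (eqv x y)
      then show ?case
        using eqv_map[OF l(1) I(1) eqv(1)] eqv_map[OF l(2) I(2) eqv(1)] eqv_trans eqv_sym by blast
    qed (simp_all add: hom form eqv_add eqv_scale)
  qed (simp_all add: hom eqv_add eqv_scale)
qed

section \<open>The explicit operators respect the relations and agree with the chosen lifts\<close>

lemma form_endo_b_op: "form_endo scale b_op"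
  using b_op_rel_ideal by (auto simp: form_endo_def b_op_linear)

lemma form_endo_k_op: "form_endo scale k_op"
  using k_op_rel_ideal by (auto simp: form_endo_def k_op_linear)

lemma eqv_k_op: "x \<simeq> y \<Longrightarrow> k_op x \<simeq> k_op y"
  using k_op_rel_ideal by (auto intro: eqv_map[OF k_op_linear])

lemma k_op_pow_rel_ideal: "x \<in> rel_ideal scale \<Longrightarrow> (k_op ^^ j) x \<in> rel_ideal scale"
  by (induction j) (simp_all add: k_op_rel_ideal)

text \<open>\<open>i_op\<close> and \<open>B_op\<close> are given by a single sum of powers only on
  homogeneous elements, so the generators of the ideal are treated degree by degree.\<close>

lemma homogeneous_rel_ideal:
  assumes "\<rho> \<in> relators scale"
  shows "\<exists>m. mon u * \<rho> * mon v \<in> degpart m"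
  using degpart_mult[OF degpart_mult[OF mon_degpart] mon_degpart] degpart_relator[OF assms] by blast

lemma i_op_rel_ideal:
  assumes "x \<in> rel_ideal scale"
  shows "i_op x \<in> rel_ideal scale"
proof (rule rel_ideal_preserved[OF i_op_linear _ subspace_rel_ideal assms])
  fix u v and \<rho> :: "('a, 'k) falg" assume \<rho>: "\<rho> \<in> relators scale"
  let ?x = "mon u * \<rho> * mon v"
  obtain m where m: "?x \<in> degpart m" using homogeneous_rel_ideal[OF \<rho>] by blast
  have "?x \<in> rel_ideal scale" by (rule rel_ideal_mult[OF relators_rel_ideal[OF \<rho>]])
  then show "i_op ?x \<in> rel_ideal scale"
    unfolding i_op_eq[OF m]
    by (intro b_op_rel_ideal falg.subspace_sum[OF subspace_rel_ideal] k_op_pow_rel_ideal)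
qed

lemma B_op_rel_ideal:
  assumes "x \<in> rel_ideal scale"
  shows "B_op x \<in> rel_ideal scale"
proof (rule rel_ideal_preserved[OF B_op_linear _ subspace_rel_ideal assms])
  fix u v and \<rho> :: "('a, 'k) falg" assume \<rho>: "\<rho> \<in> relators scale"
  let ?x = "mon u * \<rho> * mon v"
  obtain m where m: "?x \<in> degpart m" using homogeneous_rel_ideal[OF \<rho>] by blast
  have "?x \<in> rel_ideal scale" by (rule rel_ideal_mult[OF relators_rel_ideal[OF \<rho>]])
  then show "B_op ?x \<in> rel_ideal scale"
    unfolding B_op_eq[OF m]
    by (intro form_d_rel_ideal falg.subspace_sum[OF subspace_rel_ideal] k_op_pow_rel_ideal)
qed

lemma proj_rel_ideal:
  assumes "x \<in> rel_ideal scale"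
  shows "proj m x \<in> rel_ideal scale"
proof (rule rel_ideal_preserved[OF proj_linear _ subspace_rel_ideal assms])
  fix u v and \<rho> :: "('a, 'k) falg" assume \<rho>: "\<rho> \<in> relators scale"
  let ?x = "mon u * \<rho> * mon v"
  obtain m' where m': "?x \<in> degpart m'" using homogeneous_rel_ideal[OF \<rho>] by blast
  have "?x \<in> rel_ideal scale" by (rule rel_ideal_mult[OF relators_rel_ideal[OF \<rho>]])
  then show "proj m ?x \<in> rel_ideal scale"
    by (simp add: proj_degpart[OF m'] falg.subspace_0[OF subspace_rel_ideal])
qed

lemma form_endo_i_op: "form_endo scale i_op"
  using i_op_rel_ideal by (auto simp: form_endo_def i_op_linear)

text \<open>\<open>b_op\<close> witnesses that the description in the definition can be met, so the
  chosen lift meets it; as a spanning form has degree \<open>0\<close> or ends in a differential,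
  the description determines the lift modulo the relations.\<close>

lemma hoch_b_eqv: "hoch_b scale x \<simeq> b_op x" and form_endo_hoch_b: "form_endo scale (hoch_b scale)"
proof -
  let ?P = "\<lambda>\<phi>. form_endo scale \<phi> \<and> (\<forall>x\<in>degpart 0. \<phi> x \<in> rel_ideal scale) \<and>
     (\<forall>n. \<forall>\<alpha>\<in>degpart (int n). \<forall>a.
        \<phi> (\<alpha> * df a) - (-1) ^ n * (\<alpha> * el a - el a * \<alpha>) \<in> rel_ideal scale)"
  have "?P b_op"
    using form_endo_b_op
    by (simp add: b_op_degree_0 b_op_mult_df neg_one_power_fscale falg.subspace_0[OF subspace_rel_ideal])
  then have P: "?P (hoch_b scale)" unfolding hoch_b_def by (rule someI[where P = ?P])
  then show endo: "form_endo scale (hoch_b scale)" by blast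
  show "hoch_b scale x \<simeq> b_op x"
  proof (rule linear_eqv_on_forms[OF endo form_endo_b_op])
    fix a0 as
    show "hoch_b scale (el a0 * dfs as) \<simeq> b_op (el a0 * dfs as)"
    proof (cases as rule: rev_cases)
      case Nil
      then show ?thesis using P by (simp add: b_op_degree_0 eqv_0_iff)
    next
      case (snoc bs a)
      define \<alpha> where "\<alpha> = (el a0 * dfs bs :: ('a, 'k) falg)"
      have \<alpha>: "\<alpha> \<in> degpart (int (length bs))"
        using degpart_mult[OF el_degpart dfs_degpart, of a0 bs] by (simp add: \<alpha>_def)
      then have "hoch_b scale (\<alpha> * df a) - b_op (\<alpha> * df a) \<in> rel_ideal scale"
        using P unfolding b_op_mult_df[OF \<alpha>] neg_one_power_fscale by blast
      then show ?thesis
        using snoc by (simp add: \<alpha>_def dfs_append dfs_Cons eqv_def mult.assoc)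
    qed
  qed
qed

lemma karoubi_eqv: "karoubi scale x \<simeq> k_op x"
proof -
  let ?P = "\<lambda>\<phi>. form_endo scale \<phi> \<and> (\<forall>x\<in>degpart 0. \<phi> x - x \<in> rel_ideal scale) \<and>
     (\<forall>n. \<forall>\<alpha>\<in>degpart (int n). \<forall>a. \<phi> (\<alpha> * df a) - (-1) ^ n * (df a * \<alpha>) \<in> rel_ideal scale)"
  \<comment> \<open>In degree \<open>0\<close> only \<open>b d\<close> could make \<kappa> differ
    from the identity, and \<open>b (da0)\<close> is the commutator of \<open>1\<close> and
    \<open>a0\<close>.\<close>
  have k0: "k_op x \<simeq> x" if "x \<in> degpart (int 0)" for x
    using that
  proof (induction rule: form_induct)
    case (eqv x y)
    show ?case by (rule eqv_trans[OF eqv_k_op[OF eqv(1)] eqv_trans[OF eqv(2) eqv_sym[OF eqv(1)]]])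
  next
    case (form a0 as)
    have "b_op (df a0 :: ('a, 'k) falg) = 0" using b_op_mult_df[of "1 :: ('a, 'k) falg" 0 a0] by simp
    then show ?case using form by (simp add: k_op_def b_op_degree_0 form_d.zero)
  qed (simp_all add: k_op.zero k_op.add k_op.scale eqv_add eqv_scale)
  then have "?P k_op"
    using form_endo_k_op
    by (simp add: eqv_def k_op_mult_df neg_one_power_fscale falg.subspace_0[OF subspace_rel_ideal])
  then have P: "?P (karoubi scale)" unfolding karoubi_def by (rule someI[where P = ?P])
  then have endo: "form_endo scale (karoubi scale)" by blast
  show ?thesis
  proof (rule linear_eqv_on_forms[OF endo form_endo_k_op])
    fix a0 as
    show "karoubi scale (el a0 * dfs as) \<simeq> k_op (el a0 * dfs as)"
    proof (cases as rule: rev_cases)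
      case Nil
      then have "karoubi scale (el a0 * dfs as) \<simeq> el a0 * dfs as" using P by (simp add: eqv_def)
      also have "\<dots> \<simeq> k_op (el a0 * dfs as)" using Nil by (intro eqv_sym[OF k0]) simp
      finally show ?thesis .
    next
      case (snoc bs a)
      define \<alpha> where "\<alpha> = (el a0 * dfs bs :: ('a, 'k) falg)"
      have \<alpha>: "\<alpha> \<in> degpart (int (length bs))"
        using degpart_mult[OF el_degpart dfs_degpart, of a0 bs] by (simp add: \<alpha>_def)
      then have "karoubi scale (\<alpha> * df a) - k_op (\<alpha> * df a) \<in> rel_ideal scale"
        using P unfolding k_op_mult_df[OF \<alpha>] neg_one_power_fscale by blast
      then show ?thesis
        using snoc by (simp add: \<alpha>_def dfs_append dfs_Cons eqv_def mult.assoc)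
    qed
  qed
qed

lemma contr_eqv: "contr scale x \<simeq> i_op x"
proof -
  let ?P = "\<lambda>\<phi>. form_endo scale \<phi> \<and>
     (\<forall>a0 as. \<phi> (el a0 * dfs as) -
        (\<Sum>l = 1..length as.
           let a = el (as ! (l - 1));
               \<beta> = dfs (drop l as) * el a0 * dfs (take (l - 1) as)
           in (-1) ^ ((l - 1) * (length as - 1) + 1) * (a * \<beta> - \<beta> * a)) \<in> rel_ideal scale)"
  have "?P i_op"
    using form_endo_i_op unfolding i_op_form by (simp add: falg.subspace_0[OF subspace_rel_ideal])
  then have P: "?P (contr scale)" unfolding contr_def by (rule someI[where P = ?P])
  then have "contr scale (el a0 * dfs as) \<simeq> i_op (el a0 * dfs as)" for a0 as
    unfolding eqv_def i_op_form by blast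
  then show ?thesis by (rule linear_eqv_on_forms[OF conjunct1[OF P] form_endo_i_op])
qed

lemma connes_B_eqv: "connes_B scale x \<simeq> B_op x"
proof (induction x rule: falg_induct)
  case (mon w)
  have pow: "(karoubi scale ^^ j) y \<simeq> (k_op ^^ j) y" for j and y :: "('a, 'k) falg"
  proof (induction j)
    case (Suc j)
    have "(karoubi scale ^^ Suc j) y \<simeq> k_op ((karoubi scale ^^ j) y)" by (simp add: karoubi_eqv)
    also have "\<dots> \<simeq> (k_op ^^ Suc j) y"
      using eqv_k_op[OF Suc] by simp
    finally show ?case .
  qed simp
  show ?case
    unfolding connes_B_def B_op_def lin_ext_mon by (simp del: funpow.simps) (intro eqv_sum pow)
qed (simp_all add: connes_B_def module_hom.zero[OF lin_ext_linear] module_hom.add[OF lin_ext_linear]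
    module_hom.scale[OF lin_ext_linear] B_op.zero B_op.add B_op.scale eqv_add eqv_scale)

lemma k_op_power:
  assumes "x \<in> degpart (int n)"
  shows "(k_op ^^ Suc n) x \<simeq> x - form_d (b_op x)"
  using assms
proof (induction rule: form_induct)
  case (eqv x y)
  have "(k_op ^^ Suc n) x \<simeq> (k_op ^^ Suc n) y"
    by (rule eqv_map[OF k_op_pow_linear _ eqv(1)]) (use k_op_pow_rel_ideal in blast)
  also have "\<dots> \<simeq> y - form_d (b_op y)" by (rule eqv(2))
  also have "\<dots> \<simeq> x - form_d (b_op x)"
    by (intro eqv_diff eqv_form_d eqv_b_op eqv_sym[OF eqv(1)])
  finally show ?case .
next
  case (form a0 as)
  show ?case unfolding form[symmetric] k_op_power_form by simp
next
  case zero
  then show ?case by (simp only: k_op_pow.zero b_op.zero form_d.zero) simp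
next
  case (add x y)
  then show ?case
    using eqv_add[OF add] by (simp only: k_op_pow.add b_op.add form_d.add) (simp add: algebra_simps)
next
  case (scale r x)
  then show ?case
    using eqv_scale[OF scale, of r]
    by (simp only: k_op_pow.scale b_op.scale form_d.scale falg.scale_right_diff_distrib)
qed

end

context split_algebra
begin

section \<open>The submodules divided out\<close>

lemma range_const: "range const = range (\<lambda>r. fscale r 1)"
  by (simp add: const_eq_fscale[abs_def])

lemma subspace_range_const: "falg.subspace (range const)"
  by (rule falg.subspaceI)
    (auto simp: range_const image_iff intro: exI[of _ 0]
      simp flip: falg.scale_left_distrib)

lemma subspace_N_\<Omega>: "falg.subspace (N_\<Omega> scale)"
  unfolding N_\<Omega>_def
  by (intro subspace_set_plus module_fscale subspace_rel_ideal subspace_range_const)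

lemma subspace_N_DR: "falg.subspace (N_DR scale)"
  unfolding N_DR_def
  by (intro subspace_set_plus module_fscale subspace_rel_ideal subspace_range_const subspace_supercomm)

lemma rel_ideal_N_\<Omega>: "x \<in> rel_ideal scale \<Longrightarrow> x \<in> N_\<Omega> scale"
  unfolding N_\<Omega>_def using set_plus_intro[of x "rel_ideal scale" 0 "range const"]
    falg.subspace_0[OF subspace_range_const] by simp

lemma eqv_N_\<Omega>: "x \<simeq> y \<Longrightarrow> x - y \<in> N_\<Omega> scale"
  by (simp add: eqv_def rel_ideal_N_\<Omega>)

lemma N_\<Omega>_cases:
  assumes "x \<in> N_\<Omega> scale"
  obtains z r where "z \<in> rel_ideal scale" "x = z + const r"
  using assms by (auto simp: N_\<Omega>_def elim!: set_plus_elim)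

lemma N_\<Omega>_N_DR: "N_\<Omega> scale \<subseteq> N_DR scale"
proof
  fix x assume "x \<in> N_\<Omega> scale"
  then obtain z r where "z \<in> rel_ideal scale" "x = (z + 0) + const r" by (auto elim: N_\<Omega>_cases)
  then show "x \<in> N_DR scale"
    unfolding N_DR_def using falg.subspace_0[OF subspace_supercomm] by (metis rangeI set_plus_intro)
qed

lemma supercomm_N_DR: "x \<in> supercomm \<Longrightarrow> x \<in> N_DR scale"
proof -
  assume "x \<in> supercomm"
  then have "(0 + x) + const 0 \<in> N_DR scale"
    unfolding N_DR_def
    by (intro set_plus_intro rangeI falg.subspace_0[OF subspace_rel_ideal])
  then show ?thesis by (simp add: const_eq_fscale)
qed

lemma proj_N_\<Omega>:
  assumes "x \<in> N_\<Omega> scale"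
  shows "proj m x \<in> N_\<Omega> scale"
proof -
  obtain z r where z: "z \<in> rel_ideal scale" "x = z + const r" using assms by (rule N_\<Omega>_cases)
  have "proj m (const r :: ('a, 'k) falg) = const (if m = 0 then r else 0)"
    by (subst proj_degpart[OF const_degpart]) (simp add: const_def)
  then have "proj m (const r :: ('a, 'k) falg) \<in> range const" by simp
  then show ?thesis
    unfolding z proj.add N_\<Omega>_def by (intro set_plus_intro proj_rel_ideal z)
qed

lemma N_DR_iff:
  assumes x: "x \<in> degpart m"
  shows "x \<in> N_DR scale \<longleftrightarrow>
    (\<exists>y\<in>degpart (m + 1). \<exists>z\<in>degpart m. x - (b_op y + form_d (b_op z)) \<in> N_\<Omega> scale)"
proof
  assume "x \<in> N_DR scale"
  then obtain i c r where i: "i \<in> rel_ideal scale" and c: "c \<in> supercomm" and "x = i + c + const r"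
    unfolding N_DR_def by (auto elim!: set_plus_elim)
  moreover obtain y z where "c = b_op y + form_d (b_op z)" using supercomm_decomp[OF c] by blast
  ultimately have "x - (b_op y + form_d (b_op z)) = i + const r" by simp
  then have "x - (b_op y + form_d (b_op z)) \<in> N_\<Omega> scale"
    unfolding N_\<Omega>_def using i by (metis rangeI set_plus_intro)
  \<comment> \<open>Taking the component of degree \<open>m\<close> makes \<open>y\<close> and
    \<open>z\<close> homogeneous; relations and constants are stable under this.\<close>
  then have "proj m (x - (b_op y + form_d (b_op z))) \<in> N_\<Omega> scale" by (rule proj_N_\<Omega>)
  then have "x - (b_op (proj (m + 1) y) + form_d (b_op (proj m z))) \<in> N_\<Omega> scale"
    using proj_degpart[OF x, of m] by (simp add: proj.diff proj.add proj_b_op proj_form_d)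
  then show "\<exists>y\<in>degpart (m + 1). \<exists>z\<in>degpart m. x - (b_op y + form_d (b_op z)) \<in> N_\<Omega> scale"
    using proj_in_degpart by blast
next
  assume "\<exists>y\<in>degpart (m + 1). \<exists>z\<in>degpart m. x - (b_op y + form_d (b_op z)) \<in> N_\<Omega> scale"
  then obtain y z where "x - (b_op y + form_d (b_op z)) \<in> N_DR scale" using N_\<Omega>_N_DR by blast
  moreover have "b_op y + form_d (b_op z) \<in> N_DR scale"
    by (intro falg.subspace_add[OF subspace_N_DR] supercomm_N_DR b_op_supercomm form_d_supercomm)
  ultimately show "x \<in> N_DR scale"
    using falg.subspace_add[OF subspace_N_DR] by fastforce
qed

lemma N_\<Omega>_preserved:
  assumes "linear_op \<phi>" "\<And>x. x \<in> rel_ideal scale \<Longrightarrow> \<phi> x \<in> rel_ideal scale"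
    "\<And>r. \<phi> (const r) = 0" "x \<in> N_\<Omega> scale"
  shows "\<phi> x \<in> N_\<Omega> scale"
  using assms(4)
proof (rule N_\<Omega>_cases)
  fix z r assume "z \<in> rel_ideal scale" "x = z + const r"
  then show ?thesis
    using assms(2,3) by (simp add: module_hom.add[OF assms(1)] rel_ideal_N_\<Omega>)
qed

lemma mixed_forms:
  assumes inv: "\<And>k. 0 < k \<Longrightarrow> \<exists>q::'k. q * of_nat k = 1"
  shows "mixed_forms fscale (N_\<Omega> scale) (N_DR scale) degpart b_op form_d B_op i_op"
proof (intro mixed_forms.intro mixed_forms_axioms.intro module_fscale subspace_N_\<Omega> subspace_N_DR
    N_\<Omega>_N_DR subspace_degpart degpart_neg b_op_linear form_d_linear B_op_linear i_op_linear
    b_op_degpart form_d_degpart form_d_exact N_DR_iff)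
  fix m and x :: "('a, 'k) falg"
  have k: "(\<lambda>x. x - b_op (form_d x) - form_d (b_op x)) = (k_op :: ('a, 'k) falg \<Rightarrow> _)"
    by (simp add: fun_eq_iff k_op_def)
  show "((\<lambda>x. x - b_op (form_d x) - form_d (b_op x)) ^^ nat (m + 1)) x - (x - form_d (b_op x)) \<in> N_\<Omega> scale"
    if x: "x \<in> degpart m"
  proof (cases "m < 0")
    case True
    then have "x = 0" using degpart_neg x by blast
    then show ?thesis
      by (simp add: k k_op_pow.zero b_op.zero form_d.zero falg.subspace_0[OF subspace_N_\<Omega>])
  next
    case False
    then have "nat (m + 1) = Suc (nat m)" "x \<in> degpart (int (nat m))" using x by auto
    then show ?thesis unfolding k by (metis eqv_N_\<Omega> k_op_power)
  qed
  show "B_op x = (\<Sum>j<nat (m + 1). ((\<lambda>x. x - b_op (form_d x) - form_d (b_op x)) ^^ j) (form_d x))"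
    if "x \<in> degpart m" using B_op_eq[OF that] by (simp add: k)
  show "i_op x = b_op (\<Sum>j<nat m. ((\<lambda>x. x - b_op (form_d x) - form_d (b_op x)) ^^ j) x)"
    if "x \<in> degpart m" using i_op_eq[OF that] by (simp add: k)
next
  fix x :: "('a, 'k) falg" assume x: "x \<in> N_\<Omega> scale"
  show "b_op x \<in> N_\<Omega> scale"
    by (rule N_\<Omega>_preserved[OF b_op_linear b_op_rel_ideal _ x]) (simp_all add: b_op_degree_0)
  show "form_d x \<in> N_\<Omega> scale"
    by (rule N_\<Omega>_preserved[OF form_d_linear form_d_rel_ideal _ x]) simp_all
  show "B_op x \<in> N_\<Omega> scale"
    by (rule N_\<Omega>_preserved[OF B_op_linear B_op_rel_ideal _ x])
      (simp_all add: B_op_eq[OF const_degpart] k_op_pow.zero)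
  show "i_op x \<in> N_\<Omega> scale"
    by (rule N_\<Omega>_preserved[OF i_op_linear i_op_rel_ideal _ x])
      (simp_all add: i_op_eq[OF const_degpart] b_op.zero)
qed (use inv in \<open>simp_all add: falg.subspace_0[OF subspace_N_\<Omega>]\<close>)

end

theorem theorem4p1p1:
  fixes qscale :: "rat \<Rightarrow> 'k::comm_ring_1 \<Rightarrow> 'k"
    and scale :: "'k \<Rightarrow> 'a::ring_1 \<Rightarrow> 'a"
    and n :: int
  assumes "unital_algebra qscale"
    and "unital_algebra scale"
    and "split_unit scale"
  shows
    "(\<forall>m. ident_HH scale \<in> lin_iso (HH scale m) (ker_DR scale m)) \<and>
     (\<forall>m. ident_HC scale m \<in> lin_iso (HC scale m) (ker_DRd scale m)) \<and>
     (\<exists>S\<^sub>2 B I S\<^sub>1.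
        S\<^sub>2 \<in> lin_hom (HD scale n) (HC scale n) \<and>
        B \<in> lin_hom (HC scale n) (HH scale (n + 1)) \<and>
        I \<in> lin_hom (HH scale (n + 1)) (HC scale (n + 1)) \<and>
        S\<^sub>1 \<in> lin_hom (HC scale (n + 1)) (HD scale (n - 1)) \<and>
        (\<forall>f\<in>degpart n. form_d f \<in> N_DR scale \<longrightarrow>
           ident_HC scale n (S\<^sub>2 (f +o N_DRd scale n)) = f +o N_DRd scale n) \<and>
        (\<forall>x\<in>carrier (HC scale n). \<forall>f\<in>degpart n.
           ident_HC scale n x = f +o N_DRd scale n \<longrightarrow>
           ident_HH scale (B x) = form_d f +o N_DR scale) \<and>
        (\<forall>x\<in>carrier (HH scale (n + 1)). \<forall>f\<in>degpart (n + 1).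
           ident_HH scale x = f +o N_DR scale \<longrightarrow>
           ident_HC scale (n + 1) (I x) = f +o N_DRd scale (n + 1)) \<and>
        (\<forall>x\<in>carrier (HC scale (n + 1)). \<forall>f\<in>degpart (n + 1). \<forall>g\<in>degpart (n - 1).
           ident_HC scale (n + 1) x = f +o N_DRd scale (n + 1) \<and>
           contr scale f - form_d g \<in> N_\<Omega> scale \<longrightarrow>
           S\<^sub>1 x = g +o N_DRd scale (n - 1)) \<and>
        inj_on S\<^sub>2 (carrier (HD scale n)) \<and>
        kernel (HC scale n) (HH scale (n + 1)) B = S\<^sub>2 ` carrier (HD scale n) \<and>
        kernel (HH scale (n + 1)) (HC scale (n + 1)) I = B ` carrier (HC scale n) \<and>
        kernel (HC scale (n + 1)) (HD scale (n - 1)) S\<^sub>1 = I ` carrier (HH scale (n + 1)) \<and>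
        S\<^sub>1 ` carrier (HC scale (n + 1)) = carrier (HD scale (n - 1)))"
proof -
  interpret Q: unital_algebra qscale by fact
  interpret unital_algebra scale by fact
  obtain p where p: "module_hom scale (*) p" "\<And>r. p (scale r 1) = r"
    using assms(3) by (auto simp: split_unit_def)
  interpret split_algebra scale p
    by (rule split_algebra.intro[OF assms(2) split_algebra_axioms.intro[OF p]])
  \<comment> \<open>The inverse of \<open>k\<close> is the image of the rational number
    \<open>1 / k\<close> under the unit map of \<open>qscale\<close>.\<close>
  have inv: "\<exists>q::'k. q * of_nat k = 1" if "0 < k" for k
  proof
    have nat: "qscale (of_nat k) 1 = of_nat k" for k
      by (induction k) (simp_all add: Q.scale_left_distrib)
    have "qscale (1 / of_nat k) 1 * of_nat k = qscale (1 / of_nat k) (qscale (of_nat k) 1)"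
      by (simp add: Q.scale_mult_left nat)
    also have "\<dots> = 1" using that by simp
    finally show "qscale (1 / of_nat k) 1 * of_nat k = 1" .
  qed
  \<comment> \<open>The abstract results are applied to the explicit operators; the equations below
    carry them over to the operators chosen in the definitions.\<close>
  interpret M: mixed_forms fscale "N_\<Omega> scale" "N_DR scale" degpart b_op form_d B_op i_op
    by (rule mixed_forms[OF inv])
  have iff: "x \<in> J \<longleftrightarrow> y \<in> J" if "x - y \<in> N_\<Omega> scale" "N_\<Omega> scale \<subseteq> J" "falg.subspace J"
    for x y :: "('a, 'k) falg" and J
    using that falg.subspace_add[OF that(3), of "x - y" y] falg.subspace_diff[OF that(3), of x "x - y"]
    by auto
  have HD: "HD scale m = M.HD_mod m" for m by (simp add: HD_def M.HD_mod_def)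
  have HH: "HH scale m = M.HH_mod m" for m
    unfolding HH_def M.HH_mod_def
    by (rule homology_cong[OF module_fscale subspace_N_\<Omega>]) (rule eqv_N_\<Omega>[OF hoch_b_eqv])
  have us: "uscale = M.us" by (simp add: fun_eq_iff uscale_def M.us_def)
  have uN: "uN_\<Omega> scale = M.uN" by (simp add: uN_\<Omega>_def M.uN_def)
  have U: "udegpart m = M.U m" for m by (simp add: udegpart_def M.U_def)
  have zero: "hoch_b scale 0 = 0" "connes_B scale 0 = 0"
    using form_endo_hoch_b module_hom.zero[OF lin_ext_linear]
    by (auto simp: form_endo_def module_hom.zero connes_B_def)
  have cyc: "cyc_d scale c = total_d (hoch_b scale) (connes_B scale) c" for c
    by (simp add: cyc_d_def total_d_def)
  have HC: "HC scale m = M.HC_mod m" for m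
    unfolding HC_def M.HC_mod_def us uN U
  proof (rule homology_cong[OF M.module_us M.sub_uN])
    fix c
    have "(hoch_b scale x - connes_B scale y) - (b_op x - B_op y) \<in> N_\<Omega> scale" for x y
      by (rule eqv_N_\<Omega>) (intro eqv_diff hoch_b_eqv connes_B_eqv)
    then show "cyc_d scale c - total_d b_op B_op c \<in> M.uN"
      by (simp add: M.uN_def lookup_minus cyc lookup_total_d zero b_op.zero B_op.zero)
  qed
  have contr: "contr scale f - i_op f \<in> N_\<Omega> scale" for f by (rule eqv_N_\<Omega>[OF contr_eqv])
  have Kd: "N_DRd scale m = M.Kd m" for m by (simp add: N_DRd_def M.Kd_def)
  have ker: "ker_DR scale m = M.ker_K m" for m
    using iff[OF contr order_refl subspace_N_\<Omega>] by (simp add: ker_DR_def M.ker_K_def)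
  have kerd: "ker_DRd scale m = M.ker_Kd m" for m
  proof -
    \<comment> \<open>Exact forms of degree \<open>m - 1\<close> come from degree
      \<open>m - 2\<close>: this is \<open>N_\<Omega>d scale (m - 1)\<close>.\<close>
    let ?J = "N_\<Omega> scale + form_d ` degpart (m - 2)"
    have J: "falg.subspace ?J"
      by (intro subspace_set_plus module_fscale subspace_N_\<Omega> form_d.subspace_image subspace_degpart)
    have "0 \<in> form_d ` degpart (m - 2)"
      using falg.subspace_0[OF form_d.subspace_image[OF subspace_degpart]] .
    then have "N_\<Omega> scale \<subseteq> ?J" using set_zero_plus2[of "form_d ` degpart (m - 2)" "N_\<Omega> scale"]
      by (simp add: add.commute)
    then show ?thesis
      using iff[OF contr _ J] by (simp add: ker_DRd_def M.ker_Kd_def Kd N_\<Omega>d_def)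
  qed
  have iHH: "ident_HH scale = M.to_K" by (simp add: fun_eq_iff ident_HH_def M.to_K_def)
  have iHC: "ident_HC scale m = M.to_Kd m" for m
    by (simp add: fun_eq_iff ident_HC_def M.to_Kd_def Kd)
  have S\<^sub>1: "contr scale f - form_d g \<in> N_\<Omega> scale \<longleftrightarrow> i_op f - form_d g \<in> N_\<Omega> scale" for f g
    by (rule iff[OF _ order_refl subspace_N_\<Omega>]) (use contr in simp)
  show ?thesis
    unfolding HD HH HC ker kerd iHH iHC Kd S\<^sub>1
    by (intro conjI allI M.to_K_iso M.to_Kd_iso M.exact_sequence)
qed

end
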